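(* Let $f$ be a smoothly operator-Fenchel liftable generator that is also positively atomizable with atomic measure $\nu_f$, let $\rho,\sigma$ be faithful density operators on $\mathbb C^d$, and let $P=(|j\rangle\langle j|)_{j=1}^d$ be a critical rank-one PVM of $F_f$ which is not globally optimal over all POVMs. Let $j\ne k$ be two outcomes with a common likelihood ratio $t_j=t_k=t_\alpha$ and $a_{jk}:=\langle j|(\rho-t_\alpha\sigma)|k\rangle\neq0$ (such a pair exists), and let $P(\theta)$ be the two-level rotation of $|j\rangle,|k\rangle$ with a phase $\phi$ satisfying $\mathrm{Re}(e^{i\phi}a_{jk})=|a_{jk}|$. Then $$\frac{d^2}{d\theta^2}F_f(P(\theta))\Big|_{\theta=0}=8|a_{jk}|^2\left(\frac1{q_j}+\frac1{q_k}\right)\int_{[0,1]}\frac{\nu_f(d\lambda)}{((1-\lambda)t_\alpha+\lambda)^3}.$$ Equivalently, this second derivative is the superposition, with respect to the positive measure $\nu_f$, of the second derivatives at $\theta=0$ of $F_{h_\lambda}(P(\theta))$ obtained by replacing $f$ with $h_\lambda$.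
   Context: Density operators on $\mathbb C^d$ are positive semidefinite trace-one matrices; faithful means positive definite. A rank-one PVM is $P=(P_1,\dots,P_d)$ with $P_j=|j\rangle\langle j|$ for an orthonormal basis; ordered rank-one PVMs form the flag manifold $U(d)/U(1)^d$. Put $p_j=\mathrm{Tr}(\rho P_j)$, $q_j=\mathrm{Tr}(\sigma P_j)$, $t_j=p_j/q_j$, $F_f(P)=\sum_jq_jf(t_j)$. $P$ is critical if all first derivatives of $F_f$ along paths $e^{i\varepsilon K}Pe^{-i\varepsilon K}$, $K=K^*$, vanish at $\varepsilon=0$. $P$ is globally optimal over all POVMs if $F_f(P)=\sup_M\sum_y q^M_yf(p^M_y/q^M_y)$, supremum over finite POVMs $M$, with $p^M_y=\mathrm{Tr}(\rho M_y)$, $q^M_y=\mathrm{Tr}(\sigma M_y)$. A proper lower-semicontinuous convex $f:\mathbb R\to\mathbb R\cup\{+\infty\}$ with $(0,\infty)\subset\mathrm{dom} f$ is smoothly operator-Fenchel liftable if: (1) $f(1)=0$, $f\in C^2(0,\infty)$, $f''>0$ on $(0,\infty)$; (2) the interior $I_f$ of $\mathrm{dom} f^*$ equals $f'((0,\infty))$, where $f^*$ is the Fenchel conjugate on $\mathbb R$; (3) there are an open interval $J$ and a $C^2$ diffeomorphism $\psi:J\to I_f$ with $\psi'\neq0$ such that $\psi$ is operator concave and $f^*\circ\psi$ is operator convex on $J$. For $\lambda\in[0,1]$ let $h_\lambda(t)=\dfrac{(t-1)^2}{(1-\lambda)t+\lambda}$, $t>0$. A convex $f$ with $f(1)=0$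 is positively atomizable if there is a finite positive Borel measure $\nu_f$ on $[0,1]$ with $f(t)=\int_{[0,1]}h_\lambda(t)\,\nu_f(d\lambda)$ up to an additive multiple of $t-1$. Two-level rotation of $|j\rangle,|k\rangle$ with phase $\phi$: $|j(\theta)\rangle=\cos\theta|j\rangle+e^{i\phi}\sin\theta|k\rangle$, $|k(\theta)\rangle=-e^{-i\phi}\sin\theta|j\rangle+\cos\theta|k\rangle$, other basis vectors fixed. *)

theory Defs
  imports "HOL-Analysis.Analysis" "Jordan_Normal_Form.Spectral_Radius"
begin

unbundle no vec_syntax
unbundle no inner_syntax
hide_const (open) Finite_Cartesian_Product.mat Finite_Cartesian_Product.vec Determinants.trace

section \<open>Hermitian matrices\<close>

definition mat_trace :: "complex mat \<Rightarrow> complex" where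
  "mat_trace A = (\<Sum>i<dim_row A. A $$ (i, i))"

definition hermitian :: "nat \<Rightarrow> complex mat \<Rightarrow> bool" where
  "hermitian n A \<longleftrightarrow> A \<in> carrier_mat n n \<and> mat_adjoint A = A"

text \<open>The sesquilinear form \<open>\<langle>v|A|w\<rangle>\<close>, conjugate-linear in \<open>v\<close>
  (the library's \<open>x \<bullet>c y\<close> conjugates its second argument).\<close>

definition braket :: "complex vec \<Rightarrow> complex mat \<Rightarrow> complex vec \<Rightarrow> complex" where
  "braket v A w = (A *\<^sub>v w) \<bullet>c v"

definition psd :: "nat \<Rightarrow> complex mat \<Rightarrow> bool" where
  "psd n A \<longleftrightarrow> hermitian n A \<and> (\<forall>v\<in>carrier_vec n. 0 \<le> Re (braket v A v))"

definition posdef :: "nat \<Rightarrow> complex mat \<Rightarrow> bool" where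
  "posdef n A \<longleftrightarrow>
     hermitian n A \<and> (\<forall>v\<in>carrier_vec n. v \<noteq> 0\<^sub>v n \<longrightarrow> 0 < Re (braket v A v))"

definition faithful_density :: "nat \<Rightarrow> complex mat \<Rightarrow> bool" where
  "faithful_density d \<rho> \<longleftrightarrow> posdef d \<rho> \<and> mat_trace \<rho> = 1"

text \<open>The exponential series, summed entrywise.\<close>

definition mat_exp :: "complex mat \<Rightarrow> complex mat" where
  "mat_exp A = mat (dim_row A) (dim_row A) (\<lambda>(i, j). \<Sum>n. (A ^\<^sub>m n) $$ (i, j) / fact n)"

text \<open>Functional calculus for a Hermitian matrix \<open>A\<close>: if \<open>A = U diag(r) U\<^sup>*\<close> with \<open>U\<close> unitary,
  then \<open>g(A) = U diag(g \<circ> r) U\<^sup>*\<close>; this does not depend on the diagonalization chosen.\<close>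

definition herm_fun :: "(real \<Rightarrow> real) \<Rightarrow> complex mat \<Rightarrow> complex mat" where
  "herm_fun g A = (let n = dim_row A in
     THE B. \<exists>U r. U \<in> carrier_mat n n \<and> mat_adjoint U * U = 1\<^sub>m n \<and>
       A = U * mat_diag n (\<lambda>i. complex_of_real (r i)) * mat_adjoint U \<and>
       B = U * mat_diag n (\<lambda>i. complex_of_real (g (r i))) * mat_adjoint U)"

definition operator_convex :: "real set \<Rightarrow> (real \<Rightarrow> real) \<Rightarrow> bool" where
  "operator_convex J g \<longleftrightarrow>
     (\<forall>n A B. \<forall>u\<in>{0..1}.
        hermitian n A \<and> hermitian n B \<and>
        spectrum A \<subseteq> complex_of_real ` J \<and> spectrum B \<subseteq> complex_of_real ` J \<longrightarrow>
        psd n (complex_of_real (1 - u) \<cdot>\<^sub>m herm_fun g A + complex_of_real u \<cdot>\<^sub>m herm_fun g B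
               - herm_fun g (complex_of_real (1 - u) \<cdot>\<^sub>m A + complex_of_real u \<cdot>\<^sub>m B)))"

definition operator_concave :: "real set \<Rightarrow> (real \<Rightarrow> real) \<Rightarrow> bool" where
  "operator_concave J g \<longleftrightarrow> operator_convex J (\<lambda>x. - g x)"

section \<open>Generators\<close>

text \<open>Intended for open \<open>S\<close>.\<close>

definition C2_on :: "real set \<Rightarrow> (real \<Rightarrow> real) \<Rightarrow> bool" where
  "C2_on S g \<longleftrightarrow> (\<forall>x\<in>S. g differentiable at x) \<and> deriv g C1_differentiable_on S"

text \<open>\<open>g\<close> is differentiable near \<open>x\<close> and its derivative has derivative \<open>D\<close> at \<open>x\<close>.\<close>

definition has_second_deriv :: "(real \<Rightarrow> real) \<Rightarrow> real \<Rightarrow> real \<Rightarrow> bool" where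
  "has_second_deriv g D x \<longleftrightarrow>
     (\<exists>g'. (\<forall>\<^sub>F y in nhds x. (g has_real_derivative g' y) (at y)) \<and>
           (g' has_real_derivative D) (at x))"

definition proper_lsc_convex :: "(real \<Rightarrow> ereal) \<Rightarrow> bool" where
  "proper_lsc_convex f \<longleftrightarrow>
     (\<forall>x. f x \<noteq> -\<infinity>) \<and> (\<exists>x. f x \<noteq> \<infinity>) \<and>
     (\<forall>x. f x \<le> Liminf (at x) f) \<and>
     (\<forall>x y. \<forall>u\<in>{0..1}. f ((1 - u) * x + u * y) \<le> ereal (1 - u) * f x + ereal u * f y)"

definition fenchel_conj :: "(real \<Rightarrow> ereal) \<Rightarrow> real \<Rightarrow> ereal" where
  "fenchel_conj f s = (SUP x. ereal (s * x) - f x)"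

definition I_dom :: "(real \<Rightarrow> ereal) \<Rightarrow> real set" where
  "I_dom f = interior {s. fenchel_conj f s < \<infinity>}"

definition finite_part :: "(real \<Rightarrow> ereal) \<Rightarrow> real \<Rightarrow> real" where
  "finite_part f x = real_of_ereal (f x)"

definition op_fenchel_liftable :: "(real \<Rightarrow> ereal) \<Rightarrow> bool" where
  "op_fenchel_liftable f \<longleftrightarrow>
     proper_lsc_convex f \<and> (\<forall>t>0. f t < \<infinity>) \<and>
     f 1 = 0 \<and> C2_on {0<..} (finite_part f) \<and>
     (\<forall>t>0. deriv (deriv (finite_part f)) t > 0) \<and>
     I_dom f = deriv (finite_part f) ` {0<..} \<and>
     (\<exists>J \<psi>. open J \<and> is_interval J \<and>
        bij_betw \<psi> J (I_dom f) \<and> C2_on J \<psi> \<and> C2_on (I_dom f) (the_inv_into J \<psi>) \<and>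
        (\<forall>x\<in>J. deriv \<psi> x \<noteq> 0) \<and>
        operator_concave J \<psi> \<and>
        operator_convex J (\<lambda>x. finite_part (fenchel_conj f) (\<psi> x)))"

definition h_atom :: "real \<Rightarrow> real \<Rightarrow> real" where
  "h_atom l t = (t - 1)\<^sup>2 / ((1 - l) * t + l)"

text \<open>\<open>\<nu>\<close> is an atomic measure of \<open>f\<close>: a finite Borel measure on \<open>[0,1]\<close> which represents \<open>f\<close>
  on \<open>(0,\<infinity>)\<close> up to a multiple of \<open>t - 1\<close>.\<close>

definition atomic_measure :: "(real \<Rightarrow> ereal) \<Rightarrow> real measure \<Rightarrow> bool" where
  "atomic_measure f \<nu> \<longleftrightarrow>
     finite_measure \<nu> \<and> sets \<nu> = sets (restrict_space borel {0..1}) \<and>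
     (\<exists>c. \<forall>t>0. f t = ereal ((\<integral>l. h_atom l t \<partial>\<nu>) + c * (t - 1)))"

section \<open>Measurements\<close>

definition outcome_weight :: "complex mat \<Rightarrow> complex mat \<Rightarrow> real" where
  "outcome_weight \<rho> M = Re (mat_trace (\<rho> * M))"

text \<open>\<open>F\<^sub>f(M) = \<Sum>\<^sub>y q\<^sub>y f(p\<^sub>y/q\<^sub>y)\<close> for the outcomes \<open>y < m\<close>. For faithful \<open>\<sigma>\<close>, \<open>q\<^sub>y = 0\<close>
  only if \<open>M\<^sub>y = 0\<close>; such a term is \<open>0\<close> because \<open>0 * \<infinity> = 0\<close> in \<open>ereal\<close>.\<close>

definition measured_div ::
    "(real \<Rightarrow> ereal) \<Rightarrow> complex mat \<Rightarrow> complex mat \<Rightarrow> nat \<Rightarrow> (nat \<Rightarrow> complex mat) \<Rightarrow> ereal" where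
  "measured_div f \<rho> \<sigma> m M =
     (\<Sum>y<m. ereal (outcome_weight \<sigma> (M y)) *
             f (outcome_weight \<rho> (M y) / outcome_weight \<sigma> (M y)))"

definition povm :: "nat \<Rightarrow> nat \<Rightarrow> (nat \<Rightarrow> complex mat) \<Rightarrow> bool" where
  "povm d m M \<longleftrightarrow>
     (\<forall>y<m. psd d (M y)) \<and> mat d d (\<lambda>(a, b). \<Sum>y<m. M y $$ (a, b)) = 1\<^sub>m d"

definition orthonormal_basis :: "nat \<Rightarrow> (nat \<Rightarrow> complex vec) \<Rightarrow> bool" where
  "orthonormal_basis d b \<longleftrightarrow>
     (\<forall>j<d. b j \<in> carrier_vec d) \<and>
     (\<forall>j<d. \<forall>k<d. b j \<bullet>c b k = (if j = k then 1 else 0))"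

text \<open>The projectors \<open>P\<^sub>j = |j\<rangle>\<langle>j|\<close>.\<close>

definition pvm_of :: "nat \<Rightarrow> (nat \<Rightarrow> complex vec) \<Rightarrow> nat \<Rightarrow> complex mat" where
  "pvm_of d b j = mat d d (\<lambda>(x, y). (b j $ x) * cnj (b j $ y))"

definition critical_pvm ::
    "(real \<Rightarrow> ereal) \<Rightarrow> complex mat \<Rightarrow> complex mat \<Rightarrow> nat \<Rightarrow> (nat \<Rightarrow> complex mat) \<Rightarrow> bool" where
  "critical_pvm f \<rho> \<sigma> d P \<longleftrightarrow>
     (\<forall>K. hermitian d K \<longrightarrow>
        ((\<lambda>\<epsilon>. real_of_ereal (measured_div f \<rho> \<sigma> d (\<lambda>j.
             mat_exp ((\<i> * complex_of_real \<epsilon>) \<cdot>\<^sub>m K) * P j *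
             mat_exp ((- \<i> * complex_of_real \<epsilon>) \<cdot>\<^sub>m K))))
          has_real_derivative 0) (at 0))"

definition globally_optimal_pvm ::
    "(real \<Rightarrow> ereal) \<Rightarrow> complex mat \<Rightarrow> complex mat \<Rightarrow> nat \<Rightarrow> (nat \<Rightarrow> complex mat) \<Rightarrow> bool" where
  "globally_optimal_pvm f \<rho> \<sigma> d P \<longleftrightarrow>
     measured_div f \<rho> \<sigma> d P = Sup {measured_div f \<rho> \<sigma> m M | m M. povm d m M}"

definition likelihood_ratio ::
    "complex mat \<Rightarrow> complex mat \<Rightarrow> (nat \<Rightarrow> complex mat) \<Rightarrow> nat \<Rightarrow> real" where
  "likelihood_ratio \<rho> \<sigma> P j = outcome_weight \<rho> (P j) / outcome_weight \<sigma> (P j)"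

definition rotate_basis ::
    "(nat \<Rightarrow> complex vec) \<Rightarrow> nat \<Rightarrow> nat \<Rightarrow> real \<Rightarrow> real \<Rightarrow> nat \<Rightarrow> complex vec" where
  "rotate_basis b j k \<phi> \<theta> = b
     (j := complex_of_real (cos \<theta>) \<cdot>\<^sub>v b j + (cis \<phi> * complex_of_real (sin \<theta>)) \<cdot>\<^sub>v b k,
      k := (- cis (- \<phi>) * complex_of_real (sin \<theta>)) \<cdot>\<^sub>v b j + complex_of_real (cos \<theta>) \<cdot>\<^sub>v b k)"

definition rotated_div ::
    "(real \<Rightarrow> ereal) \<Rightarrow> complex mat \<Rightarrow> complex mat \<Rightarrow> nat \<Rightarrow> (nat \<Rightarrow> complex vec) \<Rightarrow>
     nat \<Rightarrow> nat \<Rightarrow> real \<Rightarrow> real \<Rightarrow> real" where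
  "rotated_div f \<rho> \<sigma> d b j k \<phi> \<theta> =
     real_of_ereal (measured_div f \<rho> \<sigma> d (pvm_of d (rotate_basis b j k \<phi> \<theta>)))"

end

theory Submission
  imports Defs
begin

text \<open>Write \<open>x \<mapsto> \<psi> x\<close> for the parametrization of the interior of the domain of the conjugate \<open>f*\<close>,
  \<open>\<chi> = f* \<circ> \<psi>\<close> and \<open>\<psi> (x j) = f' (t j)\<close>. Criticality says
  \<open>(\<psi> (x j) - \<psi> (x k)) \<rho> j k = (\<chi> (x j) - \<chi> (x k)) \<sigma> j k\<close>, i.e. the matrix
  \<open>Y j k = \<psi> (x j) \<rho> j k - \<chi> (x j) \<sigma> j k\<close> is Hermitian. If no degenerate pair had \<open>a j k \<noteq> 0\<close>,
  then \<open>\<psi> x \<cdot> \<rho> - \<chi> x \<cdot> \<sigma> \<le> Y\<close> for all \<open>x\<close>: the difference is the Hadamard product of \<open>\<sigma>\<close> with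
  \<open>(x j - x) (x k - x) \<chi>[x j, x k, x]\<close> plus the one of \<open>\<rho>\<close> with
  \<open>(x j - x) (x k - x) (- \<psi>)[x j, x k, x]\<close>, and matrices of second divided differences of
  operator convex functions are positive semidefinite. As \<open>q f(p/q) = s p - f*(s) q\<close> at
  \<open>s = f'(p/q)\<close>, the trace of \<open>Y\<close> would bound the value of every POVM; it is the value of \<open>P\<close>, so \<open>P\<close>
  would be globally optimal.

  In the second derivative the terms with \<open>p''\<close> and \<open>q''\<close> cancel between the two rotated outcomes
  because \<open>t j = t k\<close>, which leaves \<open>f'' t (p' - t q')\<^sup>2 / q\<close> for each of them; and
  \<open>f''\<close> is the \<open>\<nu>\<close>-integral of \<open>h_atom'' = 2 / ((1 - \<lambda>) t + \<lambda>)\<^sup>3\<close>.\<close>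

subsection \<open>Spectral theorem for Hermitian matrices\<close>

text \<open>Criticality says nothing about a degenerate pair: for \<open>t j = t k\<close> its
  equation reads \<open>0 = 0\<close>. The Hadamard decomposition needs a confluent version of it
  there, with the derivatives of \<psi> and \<chi> in place of their differences. As the derivative
  of \<open>f*\<close> at \<open>f' t\<close> is \<open>t\<close>, the lift of \<open>t\<close>
  satisfies \<chi>' = t \<psi>', so the confluent equation amounts to
  \<open>\<rho> j k = t \<sigma> j k\<close>, that is \<open>a j k = 0\<close>. A degenerate pair
  violating it is what separates critical from globally optimal.

  Positivity of second divided differences comes from an exact spectral identity and a limit in
  which its weights concentrate at one node. Continuity is used at that node, boundedness at the
  others.

  The 8 is 2 * 4: the 2 is the numerator of the second derivative of an atom, the 4 is the square in
  p' - t q' = +-2 Re(e^{i\<phi>} a).\<close>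

lemma mat_adjoint_carrier [simp]: "A \<in> carrier_mat n m \<Longrightarrow> mat_adjoint A \<in> carrier_mat m n"
  by (auto simp: mat_adjoint_def mat_of_rows_def)

lemma mat_adjoint_dim [simp]: "dim_row (mat_adjoint A) = dim_col A" "dim_col (mat_adjoint A) = dim_row A"
  by (auto simp: mat_adjoint_def mat_of_rows_def)

lemma mat_adjoint_index [simp]:
  "i < dim_col A \<Longrightarrow> j < dim_row A \<Longrightarrow> mat_adjoint (A :: complex mat) $$ (i, j) = cnj (A $$ (j, i))"
  by (simp add: mat_adjoint_def mat_of_rows_def)

lemma mult_index:
  "A \<in> carrier_mat n m \<Longrightarrow> B \<in> carrier_mat m l \<Longrightarrow> i < n \<Longrightarrow> j < l \<Longrightarrow>
   (A * B) $$ (i, j) = (\<Sum>k<m. A $$ (i, k) * B $$ (k, j))"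
  by (simp add: scalar_prod_def lessThan_atLeast0)

lemma mult_vec_index:
  "A \<in> carrier_mat n m \<Longrightarrow> v \<in> carrier_vec m \<Longrightarrow> i < n \<Longrightarrow>
   (A *\<^sub>v v) $ i = (\<Sum>k<m. A $$ (i, k) * v $ k)"
  by (simp add: scalar_prod_def lessThan_atLeast0)

lemma cscalar_index:
  "w \<in> carrier_vec n \<Longrightarrow> v \<bullet>c w = (\<Sum>k<n. v $ k * cnj (w $ k))"
  by (auto simp: scalar_prod_def lessThan_atLeast0 intro!: sum.cong)

lemma mat_adjoint_mult:
  assumes "A \<in> carrier_mat n m" "B \<in> carrier_mat m l"
  shows "mat_adjoint (A * B :: complex mat) = mat_adjoint B * mat_adjoint A"
proof (rule eq_matI)
  fix i j assume *: "i < dim_row (mat_adjoint B * mat_adjoint A)" "j < dim_col (mat_adjoint B * mat_adjoint A)"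
  hence "i < l" "j < n" using assms by auto
  hence "mat_adjoint (A * B) $$ (i, j) = cnj (\<Sum>k<m. A $$ (j, k) * B $$ (k, i))"
    using mult_index[OF assms, of j i] assms by simp
  also have "\<dots> = (\<Sum>k<m. mat_adjoint B $$ (i, k) * mat_adjoint A $$ (k, j))"
    unfolding cnj_sum by (rule sum.cong) (use assms \<open>i < l\<close> \<open>j < n\<close> in \<open>auto simp: mult.commute\<close>)
  also have "\<dots> = (mat_adjoint B * mat_adjoint A) $$ (i, j)"
    by (rule mult_index[symmetric]) (use assms \<open>i < l\<close> \<open>j < n\<close> in auto)
  finally show "mat_adjoint (A * B) $$ (i, j) = (mat_adjoint B * mat_adjoint A) $$ (i, j)" .
qed (use assms in auto)

lemma unitary_right:
  assumes "U \<in> carrier_mat n n" "mat_adjoint U * U = 1\<^sub>m n"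
  shows "U * mat_adjoint U = 1\<^sub>m n"
  using mat_mult_left_right_inverse[of "mat_adjoint U" n U] assms by auto

lemma unitary_cols:
  assumes "U \<in> carrier_mat n n" "mat_adjoint U * U = 1\<^sub>m n" "i < n" "j < n"
  shows "(\<Sum>k<n. cnj (U $$ (k, i)) * U $$ (k, j)) = (if i = j then 1 else 0)"
proof -
  have "(mat_adjoint U * U) $$ (i, j) = (\<Sum>k<n. mat_adjoint U $$ (i, k) * U $$ (k, j))"
    by (rule mult_index) (use assms in auto)
  also have "\<dots> = (\<Sum>k<n. cnj (U $$ (k, i)) * U $$ (k, j))"
    by (rule sum.cong) (use assms in auto)
  finally show ?thesis using assms by simp
qed

lemma unitary_rows:
  assumes "U \<in> carrier_mat n n" "mat_adjoint U * U = 1\<^sub>m n" "i < n" "j < n"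
  shows "(\<Sum>k<n. U $$ (i, k) * cnj (U $$ (j, k))) = (if i = j then 1 else 0)"
proof -
  have "(U * mat_adjoint U) $$ (i, j) = (\<Sum>k<n. U $$ (i, k) * mat_adjoint U $$ (k, j))"
    by (rule mult_index) (use assms in auto)
  also have "\<dots> = (\<Sum>k<n. U $$ (i, k) * cnj (U $$ (j, k)))"
    by (rule sum.cong) (use assms in auto)
  finally show ?thesis using unitary_right[OF assms(1,2)] assms by simp
qed

lemma unitaryI:
  assumes "U \<in> carrier_mat n n"
    "\<And>i j. i < n \<Longrightarrow> j < n \<Longrightarrow> (\<Sum>k<n. cnj (U $$ (k, i)) * U $$ (k, j)) = (if i = j then 1 else 0)"
  shows "mat_adjoint U * U = 1\<^sub>m n"
proof (rule eq_matI)
  fix i j assume *: "i < dim_row (1\<^sub>m n :: complex mat)" "j < dim_col (1\<^sub>m n :: complex mat)"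
  have "(mat_adjoint U * U) $$ (i, j) = (\<Sum>k<n. mat_adjoint U $$ (i, k) * U $$ (k, j))"
    by (rule mult_index) (use assms * in auto)
  also have "\<dots> = (\<Sum>k<n. cnj (U $$ (k, i)) * U $$ (k, j))"
    by (rule sum.cong) (use assms(1) * in auto)
  finally show "(mat_adjoint U * U) $$ (i, j) = 1\<^sub>m n $$ (i, j)" using assms(2) * by simp
qed (use assms in auto)

lemma unitary_diag_index:
  assumes "U \<in> carrier_mat n n" "i < n" "j < n"
  shows "(U * mat_diag n r * mat_adjoint U) $$ (i, j) = (\<Sum>k<n. r k * U $$ (i, k) * cnj (U $$ (j, k)))"
proof -
  have "(U * mat_diag n r * mat_adjoint U) $$ (i, j)
    = (\<Sum>k<n. (U * mat_diag n r) $$ (i, k) * mat_adjoint U $$ (k, j))"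
    by (rule mult_index) (use assms in \<open>auto intro!: mult_carrier_mat[of _ _ n]\<close>)
  also have "\<dots> = (\<Sum>k<n. r k * U $$ (i, k) * cnj (U $$ (j, k)))"
    by (rule sum.cong) (use assms in \<open>auto simp: mat_diag_mult_right[OF assms(1)]\<close>)
  finally show ?thesis .
qed

lemma exists_normalization:
  assumes v: "v \<in> carrier_vec n" "v \<noteq> 0\<^sub>v n"
  shows "\<exists>a. (a \<cdot>\<^sub>v v) \<bullet>c (a \<cdot>\<^sub>v v) = (1 :: complex)"
proof -
  define N where "N = (\<Sum>k<n. (cmod (v $ k))\<^sup>2)"
  have vv: "v \<bullet>c v = complex_of_real N"
    by (simp add: cscalar_index[OF v(1)] N_def complex_norm_square flip: of_real_power)
  have "v \<bullet>c v > 0" using v conjugate_square_greater_0_vec[OF v(1)] by auto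
  hence N: "N > 0" by (simp add: vv less_complex_def)
  define a where "a = complex_of_real (1 / sqrt N)"
  have "(a \<cdot>\<^sub>v v) \<bullet>c (a \<cdot>\<^sub>v v) = a * cnj a * (v \<bullet>c v)"
    using v(1) by (simp add: conjugate_smult_vec)
  also have "\<dots> = complex_of_real ((1 / sqrt N) * (1 / sqrt N) * N)"
    by (simp only: vv a_def complex_cnj_complex_of_real of_real_mult)
  also have "(1 / sqrt N) * (1 / sqrt N) * N = 1" using N by (simp add: field_simps)
  finally show ?thesis by auto
qed

text \<open>The conjugates of the \<open>u i\<close> with \<open>i < k\<close> become rows of an
  \<open>n\<close> by \<open>n\<close> matrix. As \<open>k < n\<close>, row \<open>k\<close> is free
  to be zero, so the matrix is singular, and a normalized kernel vector is orthogonal to all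
  \<open>u i\<close>.\<close>

lemma exists_orthogonal:
  assumes "k < n" "\<And>i. i < k \<Longrightarrow> u i \<in> carrier_vec n"
  shows "\<exists>v\<in>carrier_vec n. v \<bullet>c v = 1 \<and> (\<forall>i<k. v \<bullet>c u i = (0 :: complex))"
proof -
  define c where "c = (\<lambda>i. if i < k then conjugate (u i) else 0\<^sub>v n)"
  define M where "M = mat\<^sub>r n n (\<lambda>i. if i = k then 0\<^sub>v n else c i)"
  have M: "M \<in> carrier_mat n n" by (simp add: M_def)
  have "det M = 0" unfolding M_def
    by (rule det_row_0) (use assms in \<open>auto simp: c_def\<close>)
  then obtain v where v: "v \<in> carrier_vec n" "v \<noteq> 0\<^sub>v n" "M *\<^sub>v v = 0\<^sub>v n"
    using det_0_iff_vec_prod_zero[OF M] by auto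
  have orth: "v \<bullet>c u i = 0" if i: "i < k" for i
  proof -
    have "row M i = conjugate (u i)"
      using i assms by (auto simp: M_def c_def intro!: eq_vecI)
    moreover have "(M *\<^sub>v v) $ i = row M i \<bullet> v" using M i assms by simp
    ultimately have "conjugate (u i) \<bullet> v = 0" using v(3) i assms by simp
    thus ?thesis using v(1) assms(2)[OF i] by (subst comm_scalar_prod[of _ n]) auto
  qed
  obtain a where a: "(a \<cdot>\<^sub>v v) \<bullet>c (a \<cdot>\<^sub>v v) = 1" using exists_normalization[OF v(1,2)] by auto
  define w where "w = a \<cdot>\<^sub>v v"
  have w: "w \<in> carrier_vec n" "w \<bullet>c w = 1" using v a by (auto simp: w_def)
  have "w \<bullet>c u i = 0" if "i < k" for i
    using orth[OF that] v assms(2)[OF that] by (simp add: w_def)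
  thus ?thesis using w by auto
qed

lemma cscalar_swap:
  "v \<in> carrier_vec n \<Longrightarrow> w \<in> carrier_vec n \<Longrightarrow> v \<bullet>c w = cnj (w \<bullet>c (v :: complex vec))"
  by (simp add: cscalar_index mult.commute)

lemma extend_to_orthonormal_basis:
  assumes "v \<in> carrier_vec n" "v \<bullet>c v = (1 :: complex)" "0 < n"
  shows "\<exists>u. orthonormal_basis n u \<and> u 0 = v"
proof -
  have "\<exists>u. u 0 = v \<and> (\<forall>i<Suc k. u i \<in> carrier_vec n) \<and>
     (\<forall>i<Suc k. \<forall>j<Suc k. u i \<bullet>c u j = (if i = j then 1 else 0))" if "k < n" for k
    using that
  proof (induction k)
    case 0
    show ?case by (rule exI[of _ "\<lambda>_. v"]) (use assms in auto)
  next
    case (Suc k)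
    then obtain u where u: "u 0 = v" "\<And>i. i < Suc k \<Longrightarrow> u i \<in> carrier_vec n"
      "\<And>i j. i < Suc k \<Longrightarrow> j < Suc k \<Longrightarrow> u i \<bullet>c u j = (if i = j then 1 else 0)"
      by auto
    obtain w where w: "w \<in> carrier_vec n" "w \<bullet>c w = 1" "\<And>i. i < Suc k \<Longrightarrow> w \<bullet>c u i = 0"
      using exists_orthogonal[of "Suc k" n u] Suc.prems u(2) by auto
    have w': "u i \<bullet>c w = 0" if "i < Suc k" for i
      using w(3)[OF that] cscalar_swap[OF u(2)[OF that] w(1)] by simp
    show ?case
      by (rule exI[of _ "u(Suc k := w)"]) (use u w w' in \<open>auto simp: less_Suc_eq\<close>)
  qed
  from this[of "n - 1"] assms(3) show ?thesis
    by (auto simp: orthonormal_basis_def)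
qed

lemma basis_mat_unitary:
  assumes "orthonormal_basis n u"
  shows "mat_adjoint (mat n n (\<lambda>(i, j). u j $ i)) * mat n n (\<lambda>(i, j). u j $ i) = 1\<^sub>m n"
proof (rule unitaryI)
  fix i j assume ij: "i < n" "j < n"
  have "(\<Sum>k<n. cnj (mat n n (\<lambda>(i, j). u j $ i) $$ (k, i)) * mat n n (\<lambda>(i, j). u j $ i) $$ (k, j)) =
       (\<Sum>k<n. u j $ k * cnj (u i $ k))"
    by (rule sum.cong) (use ij in auto)
  also have "\<dots> = u j \<bullet>c u i"
    by (rule cscalar_index[symmetric]) (use ij assms in \<open>auto simp: orthonormal_basis_def\<close>)
  finally show "(\<Sum>k<n. cnj (mat n n (\<lambda>(i, j). u j $ i) $$ (k, i)) * mat n n (\<lambda>(i, j). u j $ i) $$ (k, j)) =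
       (if i = j then 1 else 0)"
    using assms ij by (simp add: orthonormal_basis_def)
qed auto

lemma hermitian_index:
  assumes "hermitian n A" "i < n" "j < n"
  shows "A $$ (j, i) = cnj (A $$ (i, j))"
proof -
  have "mat_adjoint A $$ (j, i) = cnj (A $$ (i, j))"
    using assms by (intro mat_adjoint_index) (auto simp: hermitian_def)
  thus ?thesis using assms by (simp add: hermitian_def)
qed

lemma hermitianI:
  assumes "A \<in> carrier_mat n n" "\<And>i j. i < n \<Longrightarrow> j < n \<Longrightarrow> A $$ (j, i) = cnj (A $$ (i, j))"
  shows "hermitian n A"
  unfolding hermitian_def
proof
  show "mat_adjoint A = A"
  proof (rule eq_matI)
    fix i j assume *: "i < dim_row A" "j < dim_col A"
    thus "mat_adjoint A $$ (i, j) = A $$ (i, j)" using assms(1) assms(2)[of j i] by simp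
  qed (use assms in auto)
qed fact

lemma unitary_conj_index:
  assumes "U \<in> carrier_mat n n" "A \<in> carrier_mat n n" "i < n" "j < n"
  shows "(mat_adjoint U * A * U) $$ (i, j) = (\<Sum>k<n. \<Sum>l<n. cnj (U $$ (k, i)) * A $$ (k, l) * U $$ (l, j))"
proof -
  have "(mat_adjoint U * A * U) $$ (i, j) = (\<Sum>l<n. (mat_adjoint U * A) $$ (i, l) * U $$ (l, j))"
    by (rule mult_index) (use assms in \<open>auto intro!: mult_carrier_mat[of _ _ n]\<close>)
  also have "\<dots> = (\<Sum>l<n. \<Sum>k<n. cnj (U $$ (k, i)) * A $$ (k, l) * U $$ (l, j))"
    using assms
    by (intro sum.cong refl) (subst mult_index[of _ n n], auto simp: sum_distrib_right)
  finally show ?thesis by (subst sum.swap)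
qed

text \<open>Deflation: a unit eigenvector is extended to an orthonormal basis, in which the first
  column of \<open>A\<close> is supported in its first entry. By Hermiticity so is the first row,
  and the remaining block \<open>A3\<close> falls under the induction hypothesis.\<close>

theorem hermitian_diagonalization:
  "hermitian n A \<Longrightarrow> \<exists>U r. U \<in> carrier_mat n n \<and> mat_adjoint U * U = 1\<^sub>m n \<and>
     A = U * mat_diag n (\<lambda>i. complex_of_real (r i)) * mat_adjoint U"
proof (induction n arbitrary: A)
  case 0
  show ?case
    by (rule exI[of _ "1\<^sub>m 0"], rule exI[of _ "\<lambda>_. 0"])
       (use 0 in \<open>auto simp: hermitian_def mat_diag_def intro!: eq_matI\<close>)
next
  case (Suc m)
  define n where "n = Suc m"
  have A: "A \<in> carrier_mat n n" using Suc.prems by (simp add: hermitian_def n_def)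
  have herm: "A $$ (j, i) = cnj (A $$ (i, j))" if "i < n" "j < n" for i j
    by (rule hermitian_index[OF Suc.prems]) (use that in \<open>auto simp: n_def\<close>)
  have "spectrum A \<noteq> {}" by (rule spectrum_non_empty[OF A]) (simp add: n_def)
  then obtain c v where cv: "eigenvector A v c" by (auto simp: spectrum_def eigenvalue_def)
  hence v: "v \<in> carrier_vec n" "v \<noteq> 0\<^sub>v n" "A *\<^sub>v v = c \<cdot>\<^sub>v v"
    using A by (auto simp: eigenvector_def)
  obtain a where a: "(a \<cdot>\<^sub>v v) \<bullet>c (a \<cdot>\<^sub>v v) = 1" using exists_normalization[OF v(1,2)] by auto
  define e where "e = a \<cdot>\<^sub>v v"
  have e: "e \<in> carrier_vec n" and ee: "e \<bullet>c e = 1" using v a by (auto simp: e_def)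
  have Ae: "A *\<^sub>v e = c \<cdot>\<^sub>v e"
    unfolding e_def using v A by (subst mult_mat_vec) (auto simp: smult_smult_assoc mult.commute)
  obtain u where u: "orthonormal_basis n u" "u 0 = e"
    using extend_to_orthonormal_basis[OF e ee] by (auto simp: n_def)
  define U where "U = mat n n (\<lambda>(i, j). u j $ i)"
  have U: "U \<in> carrier_mat n n" by (simp add: U_def)
  have npos: "0 < n" by (simp add: n_def)
  have U0: "U $$ (k, 0) = e $ k" if "k < n" for k using that npos by (simp add: U_def u)
  have UU: "mat_adjoint U * U = 1\<^sub>m n" unfolding U_def by (rule basis_mat_unitary[OF u(1)])
  have UU': "U * mat_adjoint U = 1\<^sub>m n" by (rule unitary_right[OF U UU])
  define A' where "A' = mat_adjoint U * A * U"
  have A': "A' \<in> carrier_mat n n" unfolding A'_def by (intro mult_carrier_mat[of _ _ n]) (use U A in auto)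
  have hA': "A' $$ (j, i) = cnj (A' $$ (i, j))" if "i < n" "j < n" for i j
    unfolding A'_def unitary_conj_index[OF U A that] unitary_conj_index[OF U A that(2,1)] cnj_sum
    by (subst sum.swap, intro sum.cong refl, subst herm) auto
  have col0: "A' $$ (i, 0) = (if i = 0 then c else 0)" if i: "i < n" for i
  proof -
    have "A' $$ (i, 0) = (\<Sum>k<n. cnj (U $$ (k, i)) * (\<Sum>l<n. A $$ (k, l) * e $ l))"
      unfolding A'_def
      by (subst unitary_conj_index[OF U A i npos]) (auto simp: U0 sum_distrib_left mult.assoc intro!: sum.cong)
    also have "\<dots> = (\<Sum>k<n. cnj (U $$ (k, i)) * (c * e $ k))"
      by (intro sum.cong refl) (use A e arg_cong[OF Ae, of "\<lambda>v. v $ k" for k] in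
        \<open>auto simp flip: mult_vec_index[OF A e] simp del: index_mult_mat_vec\<close>)
    also have "\<dots> = c * (\<Sum>k<n. cnj (U $$ (k, i)) * U $$ (k, 0))"
      by (auto simp: sum_distrib_left U0 intro!: sum.cong)
    finally show ?thesis using unitary_cols[OF U UU i npos] by simp
  qed
  \<comment> \<open>The eigenvalue is a diagonal entry of the Hermitian matrix \<open>A'\<close>,
    hence real.\<close>
  have c: "c = complex_of_real (Re c)"
    using hA'[of 0 0] col0[of 0] by (simp add: n_def complex_eq_iff)
  define A3 where "A3 = mat m m (\<lambda>(i, j). A' $$ (Suc i, Suc j))"
  have "hermitian m A3"
  proof (rule hermitianI)
    fix i j assume "i < m" "j < m"
    thus "A3 $$ (j, i) = cnj (A3 $$ (i, j))" using hA'[of "Suc i" "Suc j"] by (simp add: A3_def n_def)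
  qed (simp add: A3_def)
  from Suc.IH[OF this] obtain V s where V: "V \<in> carrier_mat m m" "mat_adjoint V * V = 1\<^sub>m m"
    "A3 = V * mat_diag m (\<lambda>i. complex_of_real (s i)) * mat_adjoint V" by auto
  \<comment> \<open>\<open>W\<close> is the block sum of the 1 by 1 identity and \<open>V\<close>;
    it leaves the split-off eigenvector alone.\<close>
  define W where "W = mat n n (\<lambda>(i, j). case i of 0 \<Rightarrow> (case j of 0 \<Rightarrow> 1 | Suc j' \<Rightarrow> 0)
     | Suc i' \<Rightarrow> (case j of 0 \<Rightarrow> 0 | Suc j' \<Rightarrow> V $$ (i', j')))"
  define r where "r = (\<lambda>i. case i of 0 \<Rightarrow> Re c | Suc i' \<Rightarrow> s i')"
  have W: "W \<in> carrier_mat n n" by (simp add: W_def)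
  have We: "W $$ (0, 0) = 1" "\<And>i. i < m \<Longrightarrow> W $$ (0, Suc i) = 0" "\<And>i. i < m \<Longrightarrow> W $$ (Suc i, 0) = 0"
    "\<And>i j. i < m \<Longrightarrow> j < m \<Longrightarrow> W $$ (Suc i, Suc j) = V $$ (i, j)"
    by (auto simp: W_def n_def)
  have WW: "mat_adjoint W * W = 1\<^sub>m n"
  proof (rule unitaryI[OF W])
    fix i j assume "i < n" "j < n"
    thus "(\<Sum>k<n. cnj (W $$ (k, i)) * W $$ (k, j)) = (if i = j then 1 else 0)"
      using unitary_cols[OF V(1,2), of "i - 1" "j - 1"]
      by (cases i; cases j) (simp_all add: n_def sum.lessThan_Suc_shift We cong: sum.cong_simp del: sum.lessThan_Suc)
  qed
  have A'W: "A' = W * mat_diag n (\<lambda>i. complex_of_real (r i)) * mat_adjoint W"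
  proof (rule eq_matI)
    fix i j assume "i < dim_row (W * mat_diag n (\<lambda>i. complex_of_real (r i)) * mat_adjoint W)"
      "j < dim_col (W * mat_diag n (\<lambda>i. complex_of_real (r i)) * mat_adjoint W)"
    hence ij: "i < n" "j < n" using W by auto
    have A3: "A3 $$ (i', j') = (\<Sum>k<m. complex_of_real (s k) * V $$ (i', k) * cnj (V $$ (j', k)))"
      if "i' < m" "j' < m" for i' j'
      by (subst V(3)) (rule unitary_diag_index[OF V(1) that])
    show "A' $$ (i, j) = (W * mat_diag n (\<lambda>i. complex_of_real (r i)) * mat_adjoint W) $$ (i, j)"
      unfolding unitary_diag_index[OF W ij]
      using ij A3[of "i - 1" "j - 1"] col0[OF ij(1)] col0[OF ij(2)] hA'[OF ij(2,1)] c[symmetric]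
      by (cases i; cases j)
        (simp_all add: n_def sum.lessThan_Suc_shift We A3_def r_def cong: sum.cong_simp del: sum.lessThan_Suc)
  qed (use W A' in auto)
  let ?D = "mat_diag n (\<lambda>i. complex_of_real (r i))"
  have D: "?D \<in> carrier_mat n n" by simp
  note cs = mult_carrier_mat[of _ n n _ n] mat_adjoint_carrier[of _ n n] U W D A
  have "A = (U * mat_adjoint U) * A * (U * mat_adjoint U)"
    using A by (simp add: UU')
  also have "\<dots> = U * A' * mat_adjoint U"
    unfolding A'_def by (simp add: cs assoc_mult_mat[of _ n n _ n _ n])
  also have "\<dots> = (U * W) * ?D * mat_adjoint (U * W)"
    unfolding A'W mat_adjoint_mult[OF U W] by (simp add: cs assoc_mult_mat[of _ n n _ n _ n])
  finally have "A = (U * W) * ?D * mat_adjoint (U * W)" .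
  moreover have "mat_adjoint (U * W) * (U * W) = 1\<^sub>m n"
  proof -
    have "mat_adjoint (U * W) * (U * W) = mat_adjoint W * ((mat_adjoint U * U) * W)"
      unfolding mat_adjoint_mult[OF U W] by (simp add: cs assoc_mult_mat[of _ n n _ n _ n])
    thus ?thesis using W WW by (simp add: UU)
  qed
  moreover have "U * W \<in> carrier_mat n n" using U W by auto
  ultimately show ?case unfolding n_def by blast
qed

subsection \<open>Functional calculus\<close>

text \<open>Two diagonalizations of \<open>A\<close> differ by the matrix \<open>W\<close>, the
  adjoint of \<open>V\<close> times \<open>U\<close>, which intertwines the two diagonals. An entry
  \<open>W $$ (i, j)\<close> is nonzero only if \<open>s i = r j\<close>, so \<open>W\<close> still
  intertwines the diagonals after \<open>g\<close> is applied to them. This is what makes the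
  \<open>THE\<close> in \<open>herm_fun\<close> well defined.\<close>

lemma herm_fun_eq:
  assumes U: "U \<in> carrier_mat n n" "mat_adjoint U * U = 1\<^sub>m n"
    and A: "A = U * mat_diag n (\<lambda>i. complex_of_real (r i)) * mat_adjoint U"
  shows "herm_fun g A = U * mat_diag n (\<lambda>i. complex_of_real (g (r i))) * mat_adjoint U"
proof -
  have dim: "dim_row A = n" using U by (simp add: A)
  show ?thesis unfolding herm_fun_def Let_def dim
  proof (rule the_equality)
    show "\<exists>V s. V \<in> carrier_mat n n \<and> mat_adjoint V * V = 1\<^sub>m n \<and>
       A = V * mat_diag n (\<lambda>i. complex_of_real (s i)) * mat_adjoint V \<and>
       U * mat_diag n (\<lambda>i. complex_of_real (g (r i))) * mat_adjoint U =
       V * mat_diag n (\<lambda>i. complex_of_real (g (s i))) * mat_adjoint V"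
      using U A by blast
  next
    fix B assume "\<exists>V s. V \<in> carrier_mat n n \<and> mat_adjoint V * V = 1\<^sub>m n \<and>
       A = V * mat_diag n (\<lambda>i. complex_of_real (s i)) * mat_adjoint V \<and>
       B = V * mat_diag n (\<lambda>i. complex_of_real (g (s i))) * mat_adjoint V"
    then obtain V s where V: "V \<in> carrier_mat n n" "mat_adjoint V * V = 1\<^sub>m n"
      "A = V * mat_diag n (\<lambda>i. complex_of_real (s i)) * mat_adjoint V"
      "B = V * mat_diag n (\<lambda>i. complex_of_real (g (s i))) * mat_adjoint V" by blast
    let ?D = "\<lambda>h. mat_diag n (\<lambda>i. complex_of_real (h i))"
    define W where "W = mat_adjoint V * U"
    note cs = mult_carrier_mat[of _ n n _ n] mat_adjoint_carrier[of _ n n] U V(1)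
    have W: "W \<in> carrier_mat n n" by (simp add: W_def cs)
    have VW: "V * W = U"
    proof -
      have "V * W = (V * mat_adjoint V) * U"
        unfolding W_def by (simp add: cs assoc_mult_mat[of _ n n _ n _ n])
      thus ?thesis using U by (simp add: unitary_right[OF V(1,2)])
    qed
    have "?D s * W = mat_adjoint V * (V * ?D s * mat_adjoint V) * U"
    proof -
      have "mat_adjoint V * (V * ?D s * mat_adjoint V) * U = (mat_adjoint V * V) * ?D s * W"
        unfolding W_def by (simp add: cs assoc_mult_mat[of _ n n _ n _ n])
      thus ?thesis using W by (simp add: V(2) left_mult_one_mat[of _ n n] assoc_mult_mat[of _ n n _ n _ n])
    qed
    also have "\<dots> = mat_adjoint V * (U * ?D r * mat_adjoint U) * U"
      using A V(3) by simp
    also have "\<dots> = W * ?D r * (mat_adjoint U * U)"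
      unfolding W_def by (simp add: cs assoc_mult_mat[of _ n n _ n _ n])
    also have "\<dots> = W * ?D r" using W by (simp add: U(2) right_mult_one_mat[of _ n n] mult_carrier_mat[of _ n n _ n])
    finally have comm: "?D s * W = W * ?D r" .
    have "complex_of_real (g (s i)) * W $$ (i, j) = W $$ (i, j) * complex_of_real (g (r j))"
      if "i < n" "j < n" for i j
    proof -
      have "(?D s * W) $$ (i, j) = (W * ?D r) $$ (i, j)" using comm by simp
      hence "complex_of_real (s i) * W $$ (i, j) = W $$ (i, j) * complex_of_real (r j)"
        using that by (simp add: mat_diag_mult_left[OF W] mat_diag_mult_right[OF W])
      thus ?thesis by (cases "W $$ (i, j) = 0") auto
    qed
    hence comm': "?D (\<lambda>i. g (s i)) * W = W * ?D (\<lambda>i. g (r i))"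
      by (intro eq_matI) (use W in \<open>auto simp: mat_diag_mult_left[OF W] mat_diag_mult_right[OF W]\<close>)
    have "B = V * ?D (\<lambda>i. g (s i)) * mat_adjoint V * (U * mat_adjoint U)"
      using V by (simp add: unitary_right[OF U])
    also have "\<dots> = V * (?D (\<lambda>i. g (s i)) * W) * mat_adjoint U"
      unfolding W_def by (simp add: cs assoc_mult_mat[of _ n n _ n _ n])
    also have "\<dots> = (V * W) * ?D (\<lambda>i. g (r i)) * mat_adjoint U"
      unfolding comm' using W by (simp add: cs assoc_mult_mat[of _ n n _ n _ n])
    finally show "B = U * ?D (\<lambda>i. g (r i)) * mat_adjoint U" by (simp add: VW)
  qed
qed

lemma unitary_diag_hermitian:
  assumes "U \<in> carrier_mat n n"
  shows "hermitian n (U * mat_diag n (\<lambda>i. complex_of_real (r i)) * mat_adjoint U)"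
proof (rule hermitianI)
  fix i j assume "i < n" "j < n"
  thus "(U * mat_diag n (\<lambda>i. complex_of_real (r i)) * mat_adjoint U) $$ (j, i) =
        cnj ((U * mat_diag n (\<lambda>i. complex_of_real (r i)) * mat_adjoint U) $$ (i, j))"
    by (simp only: unitary_diag_index[OF assms] cnj_sum) (auto intro!: sum.cong)
qed (use assms in auto)

text \<open>In the coordinates \<open>w\<close> an eigenvector becomes one of the diagonal matrix,
  and any nonzero coordinate of \<open>w\<close> reads off its eigenvalue. The inclusion discharges
  the spectral side conditions of \<open>operator_convex\<close>.\<close>

lemma spectrum_unitary_diag:
  assumes U: "U \<in> carrier_mat n n" "mat_adjoint U * U = 1\<^sub>m n"
  shows "spectrum (U * mat_diag n r * mat_adjoint U) \<subseteq> r ` {..<n}"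
proof
  fix c assume "c \<in> spectrum (U * mat_diag n r * mat_adjoint U)"
  then obtain v where v: "v \<in> carrier_vec n" "v \<noteq> 0\<^sub>v n"
    "(U * mat_diag n r * mat_adjoint U) *\<^sub>v v = c \<cdot>\<^sub>v v"
    using U by (auto simp: spectrum_def eigenvalue_def eigenvector_def)
  define w where "w = mat_adjoint U *\<^sub>v v"
  have w: "w \<in> carrier_vec n" using v U by (auto simp: w_def intro!: mult_mat_vec_carrier[of _ n n])
  note cs = mult_carrier_mat[of _ n n _ n] mat_adjoint_carrier[of _ n n] U(1) v(1) mult_mat_vec_carrier[of _ n n]
  have "U *\<^sub>v w = (U * mat_adjoint U) *\<^sub>v v"
    unfolding w_def by (simp add: cs assoc_mult_mat_vec[of _ n n _ n])
  hence Uw: "U *\<^sub>v w = v" using v by (simp add: unitary_right[OF U])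
  have "w \<noteq> 0\<^sub>v n"
  proof
    assume "w = 0\<^sub>v n"
    hence "v = 0\<^sub>v n" using Uw U by (auto intro!: eq_vecI)
    thus False using v by simp
  qed
  then obtain i where i: "i < n" "w $ i \<noteq> 0" using w by (auto simp: vec_eq_iff)
  have "mat_diag n r *\<^sub>v w = 1\<^sub>m n *\<^sub>v (mat_diag n r *\<^sub>v w)"
    using w by (intro one_mult_mat_vec[symmetric]) (simp add: cs)
  also have "\<dots> = (mat_adjoint U * U) *\<^sub>v (mat_diag n r *\<^sub>v w)"
    by (simp only: U(2))
  also have "\<dots> = mat_adjoint U *\<^sub>v ((U * mat_diag n r * mat_adjoint U) *\<^sub>v v)"
    unfolding w_def by (simp add: cs assoc_mult_mat_vec[of _ n n _ n] assoc_mult_mat[of _ n n _ n _ n])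
  also have "\<dots> = c \<cdot>\<^sub>v w"
    unfolding v(3) w_def by (rule mult_mat_vec) (use v U in auto)
  finally have "(mat_diag n r *\<^sub>v w) $ i = c * w $ i" using w i by simp
  moreover have "(mat_diag n r *\<^sub>v w) $ i = r i * w $ i"
  proof -
    have "(mat_diag n r *\<^sub>v w) $ i = (\<Sum>k<n. mat_diag n r $$ (i, k) * w $ k)"
      by (rule mult_vec_index) (use w i in auto)
    also have "\<dots> = (\<Sum>k<n. if k = i then r i * w $ i else 0)"
      by (rule sum.cong) (use i in \<open>auto simp: mat_diag_def\<close>)
    finally show ?thesis using i by simp
  qed
  ultimately show "c \<in> r ` {..<n}" using i by auto
qed

lemma braket_index:
  assumes "A \<in> carrier_mat n n" "v \<in> carrier_vec n" "w \<in> carrier_vec n"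
  shows "braket v A w = (\<Sum>a<n. \<Sum>c<n. cnj (v $ a) * A $$ (a, c) * w $ c)"
proof -
  have "braket v A w = (\<Sum>a<n. (A *\<^sub>v w) $ a * cnj (v $ a))"
    unfolding braket_def by (rule cscalar_index) fact
  also have "\<dots> = (\<Sum>a<n. \<Sum>c<n. cnj (v $ a) * A $$ (a, c) * w $ c)"
    by (rule sum.cong[OF refl], subst mult_vec_index[OF assms(1,3)])
       (auto simp: sum_distrib_right sum_distrib_left mult_ac intro!: sum.cong)
  finally show ?thesis .
qed

subsection \<open>Divided differences of operator convex functions\<close>

text \<open>The weights \<open>p\<close> are those of the last basis vector in the spectral decomposition of the
  arrow matrix with diagonal \<open>xt\<close> and last column \<open>\<epsilon> w\<close>. Averaging this matrix with its conjugate by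
  \<open>diag(1, \<dots>, 1, -1)\<close> gives \<open>diag xt\<close>, and in the upper left block the operator convexity defect
  of this average is \<open>\<epsilon>\<^sup>2 w j (cnj (w l)) \<Sum>k. h j l (b k) p k\<close> exactly.\<close>

lemma operator_convex_arrow:
  fixes xt :: "nat \<Rightarrow> real" and w :: "nat \<Rightarrow> complex" and d :: nat
  assumes op: "operator_convex J g" and eps: "0 < \<epsilon>"
    and nb: "\<And>a y. a \<le> d \<Longrightarrow> \<bar>y - xt a\<bar> \<le> \<epsilon> * (\<Sum>j<d. cmod (w j)) \<Longrightarrow> y \<in> J"
    and h: "\<And>j l y. j < d \<Longrightarrow> l < d \<Longrightarrow> y \<in> J \<Longrightarrow>
       g y = g (xt j) + (y - xt j) * D j l + (y - xt j) * (y - xt l) * h j l y"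
  shows "\<exists>b p. (\<forall>k\<le>d. 0 \<le> p k \<and> (\<exists>a\<le>d. \<bar>b k - xt a\<bar> \<le> \<epsilon> * (\<Sum>j<d. cmod (w j)))) \<and>
     (\<Sum>k\<le>d. p k) = 1 \<and> (\<Sum>k\<le>d. (b k - xt d)\<^sup>2 * p k) = \<epsilon>\<^sup>2 * (\<Sum>j<d. (cmod (w j))\<^sup>2) \<and>
     0 \<le> Re (\<Sum>j<d. \<Sum>l<d. w j * cnj (w l) * complex_of_real (\<Sum>k\<le>d. h j l (b k) * p k))"
proof -
  define n where "n = Suc d"
  define L where "L = (\<Sum>j<d. cmod (w j))"
  have L: "cmod (w j) \<le> L" if "j < d" for j
    unfolding L_def using that by (intro member_le_sum) auto
  define B where "B = mat n n (\<lambda>(a, c). if a = c then complex_of_real (xt a)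
     else if c = d then complex_of_real \<epsilon> * w a
     else if a = d then complex_of_real \<epsilon> * cnj (w c) else 0)"
  have B: "B \<in> carrier_mat n n" by (simp add: B_def)
  have hermB: "hermitian n B" by (rule hermitianI[OF B]) (auto simp: B_def)
  then obtain U b where U: "U \<in> carrier_mat n n" "mat_adjoint U * U = 1\<^sub>m n"
    and BU: "B = U * mat_diag n (\<lambda>i. complex_of_real (b i)) * mat_adjoint U"
    using hermitian_diagonalization by blast
  let ?D = "mat_diag n (\<lambda>i. complex_of_real (b i))"
  have BUD: "B * U = U * ?D"
  proof -
    have "B * U = U * ?D * (mat_adjoint U * U)"
      unfolding BU using U by (simp add: assoc_mult_mat[of _ n n _ n _ n] mult_carrier_mat[of _ n n _ n])
    thus ?thesis using U by (simp add: mult_carrier_mat[of _ n n _ n] right_mult_one_mat[of _ n n])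
  qed
  have row: "(\<Sum>c<n. B $$ (a, c) * U $$ (c, k)) = U $$ (a, k) * complex_of_real (b k)"
    if "a < n" "k < n" for a k
  proof -
    have "(B * U) $$ (a, k) = (U * ?D) $$ (a, k)" by (simp add: BUD)
    thus ?thesis unfolding mult_index[OF B U(1) that]
      using that by (simp add: mat_diag_mult_right[OF U(1)])
  qed
  \<comment> \<open>Row \<open>j\<close> of the eigenvector equation trades the factor
    \<open>b k - xt j\<close> on \<open>U $$ (j, k)\<close> for \<open>\<epsilon> * w j\<close> on
    the last coordinate. Applied to both \<open>j\<close> and \<open>l\<close>, it produces
    \<open>\<epsilon>\<^sup>2 w j (cnj (w l))\<close> without any error term.\<close>
  have row_j: "complex_of_real (b k - xt j) * U $$ (j, k) = complex_of_real \<epsilon> * w j * U $$ (d, k)"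
    if "j < d" "k < n" for j k
  proof -
    have "(\<Sum>c<d. B $$ (j, c) * U $$ (c, k)) = (\<Sum>c<d. if c = j then complex_of_real (xt j) * U $$ (j, k) else 0)"
      by (rule sum.cong) (use that in \<open>auto simp: B_def n_def\<close>)
    hence "(\<Sum>c<n. B $$ (j, c) * U $$ (c, k)) = complex_of_real (xt j) * U $$ (j, k) + complex_of_real \<epsilon> * w j * U $$ (d, k)"
      using that by (simp add: n_def B_def)
    with row[of j k] that show ?thesis by (simp add: n_def algebra_simps)
  qed
  have row_d: "complex_of_real (b k - xt d) * U $$ (d, k) = complex_of_real \<epsilon> * (\<Sum>c<d. cnj (w c) * U $$ (c, k))"
    if "k < n" for k
  proof -
    have "(\<Sum>c<d. B $$ (d, c) * U $$ (c, k)) = (\<Sum>c<d. complex_of_real \<epsilon> * (cnj (w c) * U $$ (c, k)))"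
      by (rule sum.cong) (use that in \<open>auto simp: B_def n_def\<close>)
    hence "(\<Sum>c<n. B $$ (d, c) * U $$ (c, k)) = complex_of_real \<epsilon> * (\<Sum>c<d. cnj (w c) * U $$ (c, k)) + complex_of_real (xt d) * U $$ (d, k)"
      using that by (simp add: n_def B_def sum_distrib_left)
    with row[of d k] that show ?thesis by (simp add: n_def algebra_simps)
  qed
  define p where "p = (\<lambda>k. (cmod (U $$ (d, k)))\<^sup>2)"
  have p: "complex_of_real (p k) = U $$ (d, k) * cnj (U $$ (d, k))" for k
    by (simp only: p_def complex_norm_square)
  have "complex_of_real (\<Sum>k<n. p k) = 1"
    using unitary_rows[OF U, of d d] by (simp add: p n_def)
  hence sum_p: "(\<Sum>k<n. p k) = 1" by (metis of_real_eq_1_iff)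
  \<comment> \<open>Gershgorin: in the row \<open>a\<close> where the eigenvector has its largest
    modulus, the off-diagonal part of the eigenvector equation is at most
    \<open>\<epsilon> * L\<close> times that modulus.\<close>
  have gersh: "\<exists>a\<le>d. \<bar>b k - xt a\<bar> \<le> \<epsilon> * L" if k: "k < n" for k
  proof -
    define u where "u = Max ((\<lambda>a. cmod (U $$ (a, k))) ` {..<n})"
    have "u \<in> (\<lambda>a. cmod (U $$ (a, k))) ` {..<n}"
      unfolding u_def by (rule Max_in) (auto simp: n_def)
    then obtain a where a: "a < n" "u = cmod (U $$ (a, k))" by auto
    have le: "cmod (U $$ (c, k)) \<le> cmod (U $$ (a, k))" if "c < n" for c
      using that unfolding a(2)[symmetric] u_def by (intro Max_ge) auto
    have pos: "0 < cmod (U $$ (a, k))"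
    proof (rule ccontr)
      assume "\<not> 0 < cmod (U $$ (a, k))"
      hence "U $$ (c, k) = 0" if "c < n" for c using le[OF that] by simp
      thus False using unitary_cols[OF U k k] by simp
    qed
    have "\<bar>b k - xt a\<bar> * cmod (U $$ (a, k)) = cmod (complex_of_real (b k - xt a) * U $$ (a, k))"
      by (simp only: norm_mult norm_of_real)
    also have "\<dots> \<le> \<epsilon> * L * cmod (U $$ (a, k))"
    proof (cases "a = d")
      case True
      have "cmod (\<Sum>c<d. cnj (w c) * U $$ (c, k)) \<le> (\<Sum>c<d. cmod (w c) * cmod (U $$ (a, k)))"
        using le by (intro sum_norm_le) (auto simp: norm_mult n_def intro!: mult_left_mono)
      thus ?thesis unfolding True row_d[OF k] using eps
        by (simp add: norm_mult L_def sum_distrib_right mult.assoc)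
    next
      case False
      hence "a < d" using a by (simp add: n_def)
      have "cmod (w a) * cmod (U $$ (d, k)) \<le> L * cmod (U $$ (a, k))"
        using L[OF \<open>a < d\<close>] le[of d] by (intro mult_mono) (auto simp: n_def intro: order_trans[OF norm_ge_zero])
      thus ?thesis unfolding row_j[OF \<open>a < d\<close> k] using eps by (simp add: norm_mult mult.assoc)
    qed
    finally have "\<bar>b k - xt a\<bar> \<le> \<epsilon> * L" using pos by simp
    thus ?thesis using a by (intro exI[of _ a]) (simp add: n_def)
  qed
  have bJ: "b k \<in> J" if "k < n" for k using gersh[OF that] nb by (auto simp: L_def)
  \<comment> \<open>Second moment of the spectral weights of the last basis vector: it is the
    squared norm of \<open>B - xt d\<close> applied to that vector, hence of the off-diagonal part
    \<open>\<epsilon> w\<close> of the last column.\<close>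
  have var: "(\<Sum>k<n. (b k - xt d)\<^sup>2 * p k) = \<epsilon>\<^sup>2 * (\<Sum>j<d. (cmod (w j))\<^sup>2)"
  proof -
    have "complex_of_real (\<Sum>k<n. (b k - xt d)\<^sup>2 * p k) =
      (\<Sum>k<n. (complex_of_real (b k - xt d) * U $$ (d, k)) * cnj (complex_of_real (b k - xt d) * U $$ (d, k)))"
      by (simp add: p power2_eq_square mult_ac)
    also have "\<dots> = (\<Sum>k<n. complex_of_real (\<epsilon>\<^sup>2) * (\<Sum>c<d. \<Sum>e<d. cnj (w c) * w e * (U $$ (c, k) * cnj (U $$ (e, k)))))"
    proof (rule sum.cong[OF refl])
      fix k assume k: "k \<in> {..<n}"
      define y where "y = (\<Sum>c<d. cnj (w c) * U $$ (c, k))"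
      have "y * cnj y = (\<Sum>c<d. \<Sum>e<d. (cnj (w c) * U $$ (c, k)) * cnj (cnj (w e) * U $$ (e, k)))"
        unfolding y_def cnj_sum sum_product ..
      also have "\<dots> = (\<Sum>c<d. \<Sum>e<d. cnj (w c) * w e * (U $$ (c, k) * cnj (U $$ (e, k))))"
        by (intro sum.cong refl) (simp add: mult_ac)
      finally show "(complex_of_real (b k - xt d) * U $$ (d, k)) * cnj (complex_of_real (b k - xt d) * U $$ (d, k)) =
        complex_of_real (\<epsilon>\<^sup>2) * (\<Sum>c<d. \<Sum>e<d. cnj (w c) * w e * (U $$ (c, k) * cnj (U $$ (e, k))))"
        using k row_d[of k] by (simp add: y_def[symmetric] power2_eq_square mult_ac del: of_real_diff)
    qed
    also have "\<dots> = complex_of_real (\<epsilon>\<^sup>2) * (\<Sum>c<d. \<Sum>e<d. cnj (w c) * w e * (\<Sum>k<n. U $$ (c, k) * cnj (U $$ (e, k))))"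
      unfolding sum_distrib_left[symmetric] by (subst sum.swap, rule arg_cong, rule sum.cong[OF refl], subst sum.swap)
         (simp add: sum_distrib_left)
    also have "(\<Sum>c<d. \<Sum>e<d. cnj (w c) * w e * (\<Sum>k<n. U $$ (c, k) * cnj (U $$ (e, k))))
       = (\<Sum>c<d. \<Sum>e<d. if e = c then cnj (w c) * w c else 0)"
      by (intro sum.cong refl, subst unitary_rows[OF U]) (auto simp: n_def)
    also have "\<dots> = complex_of_real (\<Sum>j<d. (cmod (w j))\<^sup>2)"
      by (simp add: complex_norm_square mult.commute flip: of_real_power)
    finally show ?thesis by (simp only: flip: of_real_mult) (simp only: of_real_eq_iff)
  qed
  define m where "m = (\<lambda>j l. \<Sum>k<n. h j l (b k) * p k)"
  define G where "G = herm_fun g B"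
  have G: "G = U * mat_diag n (\<lambda>i. complex_of_real (g (b i))) * mat_adjoint U"
    unfolding G_def by (rule herm_fun_eq[OF U BU])
  \<comment> \<open>Inserting the expansion \<open>h\<close> of \<open>g (b k)\<close> splits the
    spectral sum in three: the constant term is diagonal because rows of \<open>U\<close> are
    orthonormal, the term with \<open>D\<close> vanishes because rows \<open>d\<close> and
    \<open>l\<close> are orthogonal, and the term with \<open>h\<close> remains.\<close>
  have Gjl: "G $$ (j, l) = (if j = l then complex_of_real (g (xt j)) else 0)
      + complex_of_real (\<epsilon>\<^sup>2) * (w j * cnj (w l) * complex_of_real (m j l))"
    if jl: "j < d" "l < d" for j l
  proof -
    have jl': "j < n" "l < n" "d < n" using jl by (auto simp: n_def)
    have "G $$ (j, l) = (\<Sum>k<n. complex_of_real (g (b k)) * U $$ (j, k) * cnj (U $$ (l, k)))"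
      unfolding G by (rule unitary_diag_index[OF U(1) jl'(1,2)])
    also have "\<dots> = (\<Sum>k<n. complex_of_real (g (xt j)) * (U $$ (j, k) * cnj (U $$ (l, k)))
       + complex_of_real (D j l) * complex_of_real \<epsilon> * w j * (U $$ (d, k) * cnj (U $$ (l, k)))
       + complex_of_real (\<epsilon>\<^sup>2) * (w j * cnj (w l)) * complex_of_real (h j l (b k) * p k))"
    proof (rule sum.cong[OF refl])
      fix k assume "k \<in> {..<n}" hence k: "k < n" by simp
      have "complex_of_real (g (b k)) * U $$ (j, k) * cnj (U $$ (l, k)) =
         complex_of_real (g (xt j)) * (U $$ (j, k) * cnj (U $$ (l, k)))
         + complex_of_real (D j l) * (complex_of_real (b k - xt j) * U $$ (j, k)) * cnj (U $$ (l, k))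
         + complex_of_real (h j l (b k)) * (complex_of_real (b k - xt j) * U $$ (j, k)) *
             cnj (complex_of_real (b k - xt l) * U $$ (l, k))"
        unfolding h[OF jl bJ[OF k]] by (simp add: algebra_simps)
      thus "complex_of_real (g (b k)) * U $$ (j, k) * cnj (U $$ (l, k)) =
        complex_of_real (g (xt j)) * (U $$ (j, k) * cnj (U $$ (l, k)))
       + complex_of_real (D j l) * complex_of_real \<epsilon> * w j * (U $$ (d, k) * cnj (U $$ (l, k)))
       + complex_of_real (\<epsilon>\<^sup>2) * (w j * cnj (w l)) * complex_of_real (h j l (b k) * p k)"
        unfolding row_j[OF jl(1) k] row_j[OF jl(2) k] by (simp add: p power2_eq_square mult_ac)
    qed
    also have "\<dots> = complex_of_real (g (xt j)) * (if j = l then 1 else 0)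
       + complex_of_real (\<epsilon>\<^sup>2) * (w j * cnj (w l) * complex_of_real (m j l))"
      unfolding sum.distrib sum_distrib_left[symmetric]
      using unitary_rows[OF U jl'(1,2)] unitary_rows[OF U jl'(3,2)] jl by (simp add: m_def mult.assoc)
    finally show ?thesis by simp
  qed
  \<comment> \<open>Diagonal of the sign matrix. It flips exactly the couplings to index
    \<open>d\<close>, so they cancel in the average of \<open>B\<close> and \<open>B2\<close>, while
    the upper left blocks of \<open>G\<close> and \<open>G2\<close> agree.\<close>
  define s where "s = (\<lambda>a. if a = d then - 1 else (1::complex))"
  have s: "cnj (s a) = s a" "s a * s a = 1" "j < d \<Longrightarrow> s j = 1" for a j by (auto simp: s_def)
  define U2 where "U2 = mat n n (\<lambda>(a, k). s a * U $$ (a, k))"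
  have U2: "U2 \<in> carrier_mat n n" by (simp add: U2_def)
  have U2e: "U2 $$ (a, k) = s a * U $$ (a, k)" if "a < n" "k < n" for a k using that by (simp add: U2_def)
  have U2U: "mat_adjoint U2 * U2 = 1\<^sub>m n"
  proof (rule unitaryI[OF U2])
    fix i j assume ij: "i < n" "j < n"
    have "(\<Sum>k<n. cnj (U2 $$ (k, i)) * U2 $$ (k, j)) = (\<Sum>k<n. (s k * s k) * (cnj (U $$ (k, i)) * U $$ (k, j)))"
      by (rule sum.cong) (use ij in \<open>auto simp: U2e s(1) mult_ac\<close>)
    thus "(\<Sum>k<n. cnj (U2 $$ (k, i)) * U2 $$ (k, j)) = (if i = j then 1 else 0)"
      using unitary_cols[OF U ij] by (simp add: s(2))
  qed
  have conj_s: "(U2 * mat_diag n r * mat_adjoint U2) $$ (a, c) = s a * s c * (U * mat_diag n r * mat_adjoint U) $$ (a, c)"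
    if "a < n" "c < n" for a c and r :: "nat \<Rightarrow> complex"
    unfolding unitary_diag_index[OF U2 that] unitary_diag_index[OF U(1) that] sum_distrib_left
    by (rule sum.cong) (use that in \<open>auto simp: U2e s(1) mult_ac\<close>)
  define B2 where "B2 = U2 * ?D * mat_adjoint U2"
  define G2 where "G2 = herm_fun g B2"
  have G2: "G2 = U2 * mat_diag n (\<lambda>i. complex_of_real (g (b i))) * mat_adjoint U2"
    unfolding G2_def by (rule herm_fun_eq[OF U2 U2U]) (simp add: B2_def)
  define X where "X = mat_diag n (\<lambda>i. complex_of_real (xt i))"
  define GX where "GX = herm_fun g X"
  have one: "mat_adjoint (1\<^sub>m n) = (1\<^sub>m n :: complex mat)" by (rule eq_matI) auto
  have GX: "GX = mat_diag n (\<lambda>i. complex_of_real (g (xt i)))"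
  proof -
    have "1\<^sub>m n * mat_diag n r * 1\<^sub>m n = mat_diag n r" for r :: "nat \<Rightarrow> complex"
      by (simp add: left_mult_one_mat[of _ n n] right_mult_one_mat[of _ n n])
    thus ?thesis using herm_fun_eq[of "1\<^sub>m n" n X xt g] by (simp add: GX_def one X_def)
  qed
  have mid: "complex_of_real (1 - 1 / 2) \<cdot>\<^sub>m B + complex_of_real (1 / 2) \<cdot>\<^sub>m B2 = X"
  proof (rule eq_matI)
    fix a c assume "a < dim_row X" "c < dim_col X"
    hence ac: "a < n" "c < n" by (auto simp: X_def mat_diag_def)
    have B2ac: "B2 $$ (a, c) = s a * s c * B $$ (a, c)"
      unfolding B2_def conj_s[OF ac] BU[symmetric] ..
    have car: "B2 \<in> carrier_mat n n" using U2 by (auto simp: B2_def intro!: mult_carrier_mat[of _ n n _ n])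
    have "(complex_of_real (1 - 1 / 2) \<cdot>\<^sub>m B + complex_of_real (1 / 2) \<cdot>\<^sub>m B2) $$ (a, c)
      = complex_of_real (1 - 1 / 2) * B $$ (a, c) + complex_of_real (1 / 2) * B2 $$ (a, c)"
      using ac B car by simp
    also have "\<dots> = X $$ (a, c)" unfolding B2ac
      using ac by (auto simp: B_def X_def mat_diag_def s_def n_def)
    finally show "(complex_of_real (1 - 1 / 2) \<cdot>\<^sub>m B + complex_of_real (1 / 2) \<cdot>\<^sub>m B2) $$ (a, c) = X $$ (a, c)" .
  qed (use B U2 in \<open>auto simp: X_def B2_def mat_diag_def\<close>)
  define M where "M = complex_of_real (1 - 1 / 2) \<cdot>\<^sub>m G + complex_of_real (1 / 2) \<cdot>\<^sub>m G2 - GX"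
  have "psd n M"
  proof -
    have "spectrum B \<subseteq> complex_of_real ` J" "spectrum B2 \<subseteq> complex_of_real ` J"
      using spectrum_unitary_diag[OF U, of "\<lambda>i. complex_of_real (b i)"]
        spectrum_unitary_diag[OF U2 U2U, of "\<lambda>i. complex_of_real (b i)"] bJ
      unfolding BU[symmetric] B2_def[symmetric] by auto
    moreover have "hermitian n B2" unfolding B2_def by (rule unitary_diag_hermitian[OF U2])
    moreover have "(1 / 2 :: real) \<in> {0..1}" by simp
    ultimately have "psd n (complex_of_real (1 - 1 / 2) \<cdot>\<^sub>m herm_fun g B + complex_of_real (1 / 2) \<cdot>\<^sub>m herm_fun g B2
               - herm_fun g (complex_of_real (1 - 1 / 2) \<cdot>\<^sub>m B + complex_of_real (1 / 2) \<cdot>\<^sub>m B2))"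
      using op[unfolded operator_convex_def] hermB by blast
    thus ?thesis unfolding mid by (simp only: M_def G_def G2_def GX_def)
  qed
  \<comment> \<open>The test vector is constant on the block, since the entries of \<open>M\<close>
    already carry the factors \<open>w j\<close> and \<open>cnj (w l)\<close>.\<close>
  define v where "v = Matrix.vec n (\<lambda>a. if a < d then 1 else (0::complex))"
  have v: "v \<in> carrier_vec n" by (simp add: v_def)
  have M: "M \<in> carrier_mat n n" using \<open>psd n M\<close> by (simp add: psd_def hermitian_def)
  have Mjl: "M $$ (j, l) = complex_of_real (\<epsilon>\<^sup>2) * (w j * cnj (w l) * complex_of_real (m j l))"
    if "j < d" "l < d" for j l
  proof -
    have jl: "j < n" "l < n" using that by (auto simp: n_def)
    have "G2 $$ (j, l) = G $$ (j, l)"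
      unfolding G2 conj_s[OF jl] using that by (simp add: s(3) G)
    moreover have "G \<in> carrier_mat n n" "G2 \<in> carrier_mat n n" "GX \<in> carrier_mat n n"
      using U U2 by (auto simp: G G2 GX)
    ultimately have "M $$ (j, l) = complex_of_real (1 - 1 / 2) * G $$ (j, l) + complex_of_real (1 / 2) * G $$ (j, l) - GX $$ (j, l)"
      using jl by (simp add: M_def)
    thus ?thesis using jl by (simp add: Gjl[OF that] GX mat_diag_def)
  qed
  have Re_real_mult: "Re (complex_of_real c * z) = c * Re z" for c z by simp
  have "braket v M v = (\<Sum>a<d. \<Sum>c<d. cnj (v $ a) * M $$ (a, c) * v $ c)"
    unfolding braket_index[OF M v v] by (simp add: n_def v_def)
  also have "\<dots> = (\<Sum>j<d. \<Sum>l<d. complex_of_real (\<epsilon>\<^sup>2) * (w j * cnj (w l) * complex_of_real (m j l)))"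
    by (intro sum.cong refl) (auto simp: v_def n_def Mjl)
  also have "\<dots> = complex_of_real (\<epsilon>\<^sup>2) * (\<Sum>j<d. \<Sum>l<d. w j * cnj (w l) * complex_of_real (m j l))"
    by (simp add: sum_distrib_left)
  finally have "Re (braket v M v) = \<epsilon>\<^sup>2 * Re (\<Sum>j<d. \<Sum>l<d. w j * cnj (w l) * complex_of_real (m j l))"
    by (simp only: Re_real_mult)
  moreover have "0 \<le> Re (braket v M v)" using \<open>psd n M\<close> v by (auto simp: psd_def)
  ultimately have fin: "0 \<le> Re (\<Sum>j<d. \<Sum>l<d. w j * cnj (w l) * complex_of_real (m j l))"
    using eps by (simp add: zero_le_mult_iff)
  have le: "{..d} = {..<n}" by (auto simp: n_def)
  show ?thesis
    by (rule exI[of _ b], rule exI[of _ p])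
       (use fin var sum_p gersh in \<open>auto simp: le m_def p_def L_def n_def less_Suc_eq_le\<close>)
qed

section \<open>Local remainder bounds and concentration of spectral weights\<close>

text \<open>The bound must cover \<open>z\<close> itself, where \<open>h z\<close> is unrelated to
  the limit: the functions concerned are quotients whose value at a singular point is the default of
  division by zero.\<close>

lemma eventually_bounded_of_tendsto:
  fixes h :: "real \<Rightarrow> real"
  assumes "(h \<longlongrightarrow> l) (at z)"
  shows "\<exists>M. eventually (\<lambda>y. \<bar>h y\<bar> \<le> M) (nhds z)"
proof -
  have "eventually (\<lambda>y. dist (h y) l < 1) (at z)" using assms by (rule tendstoD) simp
  hence "eventually (\<lambda>y. y \<noteq> z \<longrightarrow> dist (h y) l < 1) (nhds z)" by (simp add: eventually_at_filter)
  hence "eventually (\<lambda>y. \<bar>h y\<bar> \<le> \<bar>l\<bar> + 1 + \<bar>h z\<bar>) (nhds z)"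
  proof (rule eventually_mono)
    fix y assume *: "y \<noteq> z \<longrightarrow> dist (h y) l < 1"
    show "\<bar>h y\<bar> \<le> \<bar>l\<bar> + 1 + \<bar>h z\<bar>"
    proof (cases "y = z")
      case False
      thus ?thesis using * unfolding dist_real_def by linarith
    qed simp
  qed
  thus ?thesis by blast
qed

lemma tendsto_transform_at:
  fixes f g :: "real \<Rightarrow> real"
  assumes "(f \<longlongrightarrow> l) (at z)" "\<And>y. y \<noteq> z \<Longrightarrow> f y = g y"
  shows "(g \<longlongrightarrow> l) (at z)"
  by (rule Lim_transform_eventually[OF assms(1)]) (simp add: eventually_at_filter assms(2))

text \<open>The function \<open>g y - y * g1 z\<close> has derivative \<open>g1 y - g1 z\<close>,
  which is at most linear in \<open>y - z\<close> by differentiability of \<open>g1\<close> at the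
  single point \<open>z\<close>. The mean value estimate adds the second factor
  \<open>y - z\<close>.\<close>

lemma second_order_remainder:
  fixes g g1 :: "real \<Rightarrow> real"
  assumes d1: "eventually (\<lambda>y. (g has_real_derivative g1 y) (at y)) (nhds z)"
    and d2: "g1 differentiable at z"
  shows "\<exists>C. eventually (\<lambda>y. \<bar>g y - g z - (y - z) * g1 z\<bar> \<le> C * (y - z)\<^sup>2) (nhds z)"
proof -
  obtain c where c: "(g1 has_real_derivative c) (at z)" using d2 by (auto simp: real_differentiable_def)
  hence "((\<lambda>y. (g1 y - g1 z) / (y - z)) \<longlongrightarrow> c) (at z)" by (simp add: has_field_derivative_iff)
  from eventually_bounded_of_tendsto[OF this] obtain C where
    C: "eventually (\<lambda>y. \<bar>(g1 y - g1 z) / (y - z)\<bar> \<le> C) (nhds z)" by auto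
  from eventually_conj[OF d1 C] obtain r where r: "r > 0"
    "\<And>y. dist y z < r \<Longrightarrow> (g has_real_derivative g1 y) (at y) \<and> \<bar>(g1 y - g1 z) / (y - z)\<bar> \<le> C"
    unfolding eventually_nhds_metric by auto
  have "\<bar>g y - g z - (y - z) * g1 z\<bar> \<le> C * (y - z)\<^sup>2" if y: "dist y z < r" for y
  proof -
    let ?S = "cball z \<bar>y - z\<bar>"
    have C0: "C \<ge> 0" using r(2)[of z] r(1) by simp
    have "norm ((g y - y * g1 z) - (g z - z * g1 z)) \<le> (C * \<bar>y - z\<bar>) * norm (y - z)"
    proof (rule field_differentiable_bound[of ?S _ "\<lambda>u. g1 u - g1 z"])
      fix u assume "u \<in> ?S"
      hence u: "\<bar>u - z\<bar> \<le> \<bar>y - z\<bar>" by (simp add: dist_real_def abs_minus_commute)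
      hence ur: "dist u z < r" using y by (simp add: dist_real_def)
      show "((\<lambda>y. g y - y * g1 z) has_field_derivative g1 u - g1 z) (at u within ?S)"
        by (rule has_field_derivative_at_within) (use r(2)[OF ur] in \<open>auto intro!: derivative_eq_intros\<close>)
      have "\<bar>g1 u - g1 z\<bar> \<le> C * \<bar>u - z\<bar>"
        using r(2)[OF ur] by (cases "u = z") (auto simp: abs_divide divide_le_eq)
      also have "\<dots> \<le> C * \<bar>y - z\<bar>" using u C0 by (intro mult_left_mono)
      finally show "norm (g1 u - g1 z) \<le> C * \<bar>y - z\<bar>" by simp
    qed (auto simp: dist_real_def)
    moreover have "(g y - y * g1 z) - (g z - z * g1 z) = g y - g z - (y - z) * g1 z"
      by (simp add: algebra_simps)
    moreover have "(C * \<bar>y - z\<bar>) * norm (y - z) = C * (y - z)\<^sup>2"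
      by (simp add: power2_eq_square mult.assoc)
    ultimately show ?thesis by (simp only: real_norm_def)
  qed
  thus ?thesis unfolding eventually_nhds_metric using r(1) by blast
qed

text \<open>Chebyshev: the weights \<open>p\<close> have mean square deviation \<open>\<epsilon>\<^sup>2 V\<close> from \<open>xt d\<close>.\<close>

lemma concentration:
  fixes h :: "real \<Rightarrow> real" and xt :: "nat \<Rightarrow> real" and d :: nat
  assumes cont: "isCont h (xt d)"
    and bdd: "\<And>a. a \<le> d \<Longrightarrow> \<exists>M. eventually (\<lambda>y. \<bar>h y\<bar> \<le> M) (nhds (xt a))"
    and e: "0 < e" and L: "0 \<le> L" and V: "0 \<le> V"
  shows "eventually (\<lambda>\<epsilon>. \<forall>b p. (\<forall>k\<le>d. 0 \<le> p k \<and> (\<exists>a\<le>d. \<bar>b k - xt a\<bar> \<le> \<epsilon> * L)) \<and>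
     (\<Sum>k\<le>d. p k) = 1 \<and> (\<Sum>k\<le>d. (b k - xt d)\<^sup>2 * p k) = \<epsilon>\<^sup>2 * V \<longrightarrow>
     \<bar>(\<Sum>k\<le>d. h (b k) * p k) - h (xt d)\<bar> \<le> e) (at_right 0)"
proof -
  obtain M where M: "\<And>a. a \<le> d \<Longrightarrow> eventually (\<lambda>y. \<bar>h y\<bar> \<le> M a) (nhds (xt a))"
    using bdd by metis
  define K where "K = (\<Sum>a\<le>d. \<bar>M a\<bar>)"
  have K0: "0 \<le> K" unfolding K_def by (intro sum_nonneg) auto
  have MK: "M a \<le> K" if "a \<le> d" for a
  proof -
    have "\<bar>M a\<bar> \<le> K" unfolding K_def by (rule member_le_sum) (use that in auto)
    thus ?thesis by simp
  qed
  have "eventually (\<lambda>\<delta>. \<forall>y. \<bar>y - xt a\<bar> < \<delta> \<longrightarrow> \<bar>h y\<bar> \<le> K) (at_right (0::real))" if a: "a \<le> d" for a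
  proof -
    obtain r where r: "r > 0" "\<And>y. dist y (xt a) < r \<Longrightarrow> \<bar>h y\<bar> \<le> M a"
      using M[OF a] unfolding eventually_nhds_metric by auto
    show ?thesis unfolding eventually_at_right_field
    proof (intro exI[of _ r] conjI allI impI)
      fix \<delta> y :: real assume "\<delta> < r" "\<bar>y - xt a\<bar> < \<delta>"
      thus "\<bar>h y\<bar> \<le> K" using r(2)[of y] MK[OF a] by (simp add: dist_real_def)
    qed (fact r(1))
  qed
  hence "eventually (\<lambda>\<delta>. \<forall>a\<in>{..d}. \<forall>y. \<bar>y - xt a\<bar> < \<delta> \<longrightarrow> \<bar>h y\<bar> \<le> K) (at_right (0::real))"
    by (intro eventually_ball_finite) auto
  hence "eventually (\<lambda>\<delta>. (\<forall>a\<in>{..d}. \<forall>y. \<bar>y - xt a\<bar> < \<delta> \<longrightarrow> \<bar>h y\<bar> \<le> K) \<and> 0 < \<delta>) (at_right (0::real))"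
    by (intro eventually_conj eventually_at_right_less)
  from eventually_happens[OF this] obtain \<delta> where
    \<delta>: "0 < \<delta>" "\<And>a y. a \<le> d \<Longrightarrow> \<bar>y - xt a\<bar> < \<delta> \<Longrightarrow> \<bar>h y\<bar> \<le> K" by auto
  obtain \<eta> where \<eta>: "0 < \<eta>" "\<And>y. \<bar>y - xt d\<bar> < \<eta> \<Longrightarrow> \<bar>h y - h (xt d)\<bar> < e / 2"
    using cont[unfolded continuous_at_real_range, rule_format, of "e / 2"] e by auto
  \<comment> \<open>The three bounds put every eigenvalue within \<open>\<delta>\<close> of a node,
    where \<open>\<bar>h y\<bar> \<le> K\<close>; give
    \<open>\<epsilon>\<^sup>2 \<le> \<epsilon>\<close>; and make the Chebyshev tail
    \<open>2 * K / \<eta>\<^sup>2 * (\<epsilon>\<^sup>2 * V)\<close> at most \<open>e / 2\<close>.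
    Adding \<open>1\<close> to \<open>L\<close>, \<open>K\<close> and \<open>V\<close> keeps the
    denominators positive.\<close>
  define \<epsilon>0 where "\<epsilon>0 = min (\<delta> / (L + 1)) (min 1 (e * \<eta>\<^sup>2 / (4 * (K + 1) * (V + 1))))"
  have pos: "0 < 4 * (K + 1) * (V + 1)" using K0 V by simp
  have "0 < \<epsilon>0" unfolding \<epsilon>0_def using \<delta>(1) \<eta>(1) L e pos by auto
  moreover have "\<bar>(\<Sum>k\<le>d. h (b k) * p k) - h (xt d)\<bar> \<le> e"
    if \<epsilon>: "0 < \<epsilon>" "\<epsilon> < \<epsilon>0" and bp: "\<And>k. k \<le> d \<Longrightarrow> 0 \<le> p k \<and> (\<exists>a\<le>d. \<bar>b k - xt a\<bar> \<le> \<epsilon> * L)"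
      and p1: "(\<Sum>k\<le>d. p k) = 1" and var: "(\<Sum>k\<le>d. (b k - xt d)\<^sup>2 * p k) = \<epsilon>\<^sup>2 * V" for \<epsilon> b p
  proof -
    have "\<epsilon> * (L + 1) < \<delta>" using \<epsilon>(2) L by (simp add: \<epsilon>0_def less_divide_eq)
    hence \<epsilon>L: "\<epsilon> * L < \<delta>" using \<epsilon>(1) by (simp add: algebra_simps)
    have hK: "\<bar>h (b k)\<bar> \<le> K" if "k \<le> d" for k
      using bp[OF that] \<delta>(2)[of _ "b k"] \<epsilon>L by fastforce
    have hx: "\<bar>h (xt d)\<bar> \<le> K" using \<delta>(1) \<delta>(2)[of d "xt d"] by simp
    \<comment> \<open>Closer than \<open>\<eta>\<close> to \<open>xt d\<close> continuity gives
      \<open>e / 2\<close>. Farther away the crude bound \<open>2 * K\<close> is paid for by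
      \<open>(b k - xt d)\<^sup>2 / \<eta>\<^sup>2 \<ge> 1\<close>, whose weighted mean is
      known.\<close>
    have pt: "\<bar>h (b k) - h (xt d)\<bar> \<le> e / 2 + 2 * K / \<eta>\<^sup>2 * (b k - xt d)\<^sup>2" if k: "k \<le> d" for k
    proof (cases "\<bar>b k - xt d\<bar> < \<eta>")
      case True
      have "0 \<le> 2 * K / \<eta>\<^sup>2 * (b k - xt d)\<^sup>2" using K0 by simp
      thus ?thesis using \<eta>(2)[OF True] by linarith
    next
      case False
      hence "\<eta>\<^sup>2 \<le> (b k - xt d)\<^sup>2" using \<eta>(1) by (simp add: abs_le_square_iff[symmetric])
      hence "1 \<le> (b k - xt d)\<^sup>2 / \<eta>\<^sup>2" using \<eta>(1) by (simp add: le_divide_eq)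
      hence "2 * K * 1 \<le> 2 * K * ((b k - xt d)\<^sup>2 / \<eta>\<^sup>2)" using K0 by (intro mult_left_mono) auto
      moreover have "\<bar>h (b k) - h (xt d)\<bar> \<le> 2 * K" using hK[OF k] hx by linarith
      ultimately show ?thesis using e by simp
    qed
    have "(\<Sum>k\<le>d. h (b k) * p k) - h (xt d) = (\<Sum>k\<le>d. (h (b k) - h (xt d)) * p k)"
      using p1 by (simp add: left_diff_distrib sum_subtractf flip: sum_distrib_left)
    also have "\<bar>\<dots>\<bar> \<le> (\<Sum>k\<le>d. (e / 2 + 2 * K / \<eta>\<^sup>2 * (b k - xt d)\<^sup>2) * p k)"
      by (rule order_trans[OF sum_abs], rule sum_mono) (use bp pt in \<open>auto simp: abs_mult intro!: mult_right_mono\<close>)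
    also have "\<dots> = e / 2 * (\<Sum>k\<le>d. p k) + 2 * K / \<eta>\<^sup>2 * (\<Sum>k\<le>d. (b k - xt d)\<^sup>2 * p k)"
      by (simp add: sum.distrib sum_distrib_left distrib_right mult.assoc)
    also have "\<dots> = e / 2 + 2 * K / \<eta>\<^sup>2 * (\<epsilon>\<^sup>2 * V)" by (simp add: p1 var)
    also have "2 * K / \<eta>\<^sup>2 * (\<epsilon>\<^sup>2 * V) \<le> e / 2"
    proof -
      have "\<epsilon> < 1" using \<epsilon>(2) by (simp add: \<epsilon>0_def)
      hence "\<epsilon>\<^sup>2 \<le> \<epsilon>" using \<epsilon>(1) by (simp add: power2_eq_square)
      have "\<epsilon> * (4 * (K + 1) * (V + 1)) < e * \<eta>\<^sup>2"
        using \<epsilon>(2) pos by (simp add: \<epsilon>0_def less_divide_eq)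
      moreover have "4 * K * (\<epsilon>\<^sup>2 * V) \<le> 4 * (K + 1) * (\<epsilon> * (V + 1))"
        using K0 V \<epsilon>(1) \<open>\<epsilon>\<^sup>2 \<le> \<epsilon>\<close> by (intro mult_mono) auto
      ultimately have "4 * K * (\<epsilon>\<^sup>2 * V) \<le> e * \<eta>\<^sup>2" by (simp add: mult_ac)
      thus ?thesis using \<eta>(1) by (simp add: divide_le_eq field_simps)
    qed
    finally show ?thesis by simp
  qed
  ultimately show ?thesis unfolding eventually_at_right_field
    by (intro exI[of _ \<epsilon>0]) simp
qed

lemma quotient_minus_divide:
  fixes a c D e :: real
  assumes "c \<noteq> 0"
  shows "(a / c - D) / e = (a - c * D) / (c * e)"
proof -
  have "a / c - D = (a - c * D) / c" using assms by (simp add: field_simps)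
  thus ?thesis by simp
qed

definition divided_diff :: "(real \<Rightarrow> real) \<Rightarrow> (real \<Rightarrow> real) \<Rightarrow> real \<Rightarrow> real \<Rightarrow> real" where
  "divided_diff g g1 x y = (if x = y then g1 x else (g x - g y) / (x - y))"

text \<open>Away from its singular points, \<open>h j l y\<close> is the second divided difference
  of \<open>g\<close> at \<open>xt j\<close>, \<open>xt l\<close>, \<open>y\<close>. The arrow
  matrix gives positivity for weighted averages of \<open>h j l\<close> over its eigenvalues; as the
  coupling \<epsilon> tends to 0 these averages tend to the value at \<open>xt d\<close>, where
  \<open>ne\<close> makes every \<open>h j l\<close> continuous. The nodes with index below
  \<open>d\<close> may coincide among themselves.\<close>

theorem operator_convex_divided_diff_psd:
  fixes xt :: "nat \<Rightarrow> real" and w :: "nat \<Rightarrow> complex" and d :: nat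
  assumes op: "operator_convex J g" and J: "open J" and xJ: "\<And>a. a \<le> d \<Longrightarrow> xt a \<in> J"
    and ne: "\<And>j. j < d \<Longrightarrow> xt j \<noteq> xt d"
    and d1: "\<And>y. y \<in> J \<Longrightarrow> (g has_real_derivative g1 y) (at y)"
    and d2: "\<And>y. y \<in> J \<Longrightarrow> g1 differentiable at y"
  shows "0 \<le> Re (\<Sum>j<d. \<Sum>l<d. w j * cnj (w l) * complex_of_real
     ((g (xt d) - g (xt j) - (xt d - xt j) * divided_diff g g1 (xt j) (xt l)) / ((xt d - xt j) * (xt d - xt l))))"
proof -
  define D where "D = (\<lambda>j l. divided_diff g g1 (xt j) (xt l))"
  define h where "h = (\<lambda>j l y. (g y - g (xt j) - (y - xt j) * D j l) / ((y - xt j) * (y - xt l)))"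
  \<comment> \<open>also at \<open>y = xt j\<close> and \<open>y = xt l\<close>, where \<open>h j l y = 0\<close> by division by zero\<close>
  have id: "g y = g (xt j) + (y - xt j) * D j l + (y - xt j) * (y - xt l) * h j l y" for j l y
  proof (cases "y = xt j")
    case False
    show ?thesis
    proof (cases "y = xt l")
      case True
      thus ?thesis using False by (simp add: h_def D_def divided_diff_def) (simp add: field_simps)
    qed (use False in \<open>simp add: h_def\<close>)
  qed simp
  have gc: "isCont g y" if "y \<in> J" for y using d1[OF that] by (rule DERIV_isCont)
  have cont: "isCont (h j l) y" if "y \<in> J" "y \<noteq> xt j" "y \<noteq> xt l" for j l y
    unfolding h_def using gc[OF that(1)] that by (intro continuous_intros) auto
  \<comment> \<open>The eigenvalues may also sit near the other nodes, where \<open>h j l\<close>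
    can be discontinuous. Their total weight tends to zero, so boundedness is enough: a double node
    is handled by the second-order remainder, the other cases by existence of a limit.\<close>
  have bdd: "\<exists>M. eventually (\<lambda>y. \<bar>h j l y\<bar> \<le> M) (nhds (xt a))"
    if jla: "j < d" "l < d" "a \<le> d" for j l a
  proof -
    define z where "z = xt a"
    have z: "z \<in> J" using xJ[OF jla(3)] by (simp add: z_def)
    have lim: "((\<lambda>y. (g y - g z) / (y - z)) \<longlongrightarrow> g1 z) (at z)"
      using d1[OF z] by (simp add: has_field_derivative_iff)
    have "\<exists>M. eventually (\<lambda>y. \<bar>h j l y\<bar> \<le> M) (nhds z)"
    proof (cases "z = xt j"; cases "z = xt l")
      assume eq: "z = xt j" "z = xt l"
      have "eventually (\<lambda>y. (g has_real_derivative g1 y) (at y)) (nhds z)"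
        using eventually_nhds_in_open[OF J z] by (rule eventually_mono) (rule d1)
      from second_order_remainder[OF this d2[OF z]] obtain C where
        C: "eventually (\<lambda>y. \<bar>g y - g z - (y - z) * g1 z\<bar> \<le> C * (y - z)\<^sup>2) (nhds z)" by auto
      have "\<bar>h j l y\<bar> \<le> \<bar>C\<bar>" if "\<bar>g y - g z - (y - z) * g1 z\<bar> \<le> C * (y - z)\<^sup>2" for y
      proof (cases "y = z")
        case True thus ?thesis by (simp add: h_def eq[symmetric])
      next
        case False
        have "\<bar>h j l y\<bar> = \<bar>g y - g z - (y - z) * g1 z\<bar> / (y - z)\<^sup>2"
          by (simp add: h_def D_def divided_diff_def eq[symmetric] power2_eq_square)
        also have "\<dots> \<le> C" using that False by (simp add: divide_le_eq)
        finally show ?thesis by simp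
      qed
      thus ?thesis by (intro exI[of _ "\<bar>C\<bar>"] eventually_mono[OF C])
    next
      assume eq: "z = xt j" "z \<noteq> xt l"
      have "((\<lambda>y. ((g y - g z) / (y - z) - D j l) / (y - xt l)) \<longlongrightarrow> (g1 z - D j l) / (z - xt l)) (at z)"
        by (intro tendsto_intros lim) (use eq in auto)
      moreover have "((g y - g z) / (y - z) - D j l) / (y - xt l) = h j l y" if "y \<noteq> z" for y
        using quotient_minus_divide[of "y - z"] that by (simp add: h_def eq(1)[symmetric])
      ultimately have "(h j l \<longlongrightarrow> (g1 z - D j l) / (z - xt l)) (at z)"
        by (rule tendsto_transform_at)
      thus ?thesis by (rule eventually_bounded_of_tendsto)
    next
      assume eq: "z \<noteq> xt j" "z = xt l"
      \<comment> \<open>The secant through \<open>xt j\<close> also passes through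
        \<open>xt l = z\<close>, so the numerator of \<open>h\<close> can be re-based at
        \<open>z\<close>; this reduces the case to the previous one with the nodes
        exchanged.\<close>
      have D: "D j l * (z - xt j) = g z - g (xt j)"
        using eq by (auto simp: D_def divided_diff_def field_simps)
      have "((\<lambda>y. ((g y - g z) / (y - z) - D j l) / (y - xt j)) \<longlongrightarrow> (g1 z - D j l) / (z - xt j)) (at z)"
        by (intro tendsto_intros lim) (use eq in auto)
      moreover have "((g y - g z) / (y - z) - D j l) / (y - xt j) = h j l y" if "y \<noteq> z" for y
      proof -
        have "g y - g (xt j) - (y - xt j) * D j l = g y - g z - (y - z) * D j l"
          using D by (simp add: algebra_simps)
        thus ?thesis
          using quotient_minus_divide[of "y - z"] that by (simp only: h_def eq(2)[symmetric]) (simp add: mult.commute)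
      qed
      ultimately have "(h j l \<longlongrightarrow> (g1 z - D j l) / (z - xt j)) (at z)"
        by (rule tendsto_transform_at)
      thus ?thesis by (rule eventually_bounded_of_tendsto)
    next
      assume "z \<noteq> xt j" "z \<noteq> xt l"
      from cont[OF z this] show ?thesis
        by (intro eventually_bounded_of_tendsto) (rule isContD)
    qed
    thus ?thesis by (simp add: z_def)
  qed
  define L where "L = (\<Sum>j<d. cmod (w j))"
  define V where "V = (\<Sum>j<d. (cmod (w j))\<^sup>2)"
  have L0: "0 \<le> L" "0 \<le> V" unfolding L_def V_def by (auto intro!: sum_nonneg)
  define S where "S = (\<lambda>m :: nat \<Rightarrow> nat \<Rightarrow> real. Re (\<Sum>j<d. \<Sum>l<d. w j * cnj (w l) * complex_of_real (m j l)))"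
  \<comment> \<open>For small \<epsilon> each average differs from its limit by at most
    \<open>e\<close>, which changes the quadratic form by at most \<open>e\<close> times the sum of
    the \<open>cmod (w j) * cmod (w l)\<close>. The averaged form is nonnegative.\<close>
  have "- (e * (\<Sum>j<d. \<Sum>l<d. cmod (w j) * cmod (w l))) \<le> S (\<lambda>j l. h j l (xt d))" if e: "0 < e" for e
  proof -
    have "eventually (\<lambda>\<epsilon>. \<forall>b p. (\<forall>k\<le>d. 0 \<le> p k \<and> (\<exists>a\<le>d. \<bar>b k - xt a\<bar> \<le> \<epsilon> * L)) \<and>
        (\<Sum>k\<le>d. p k) = 1 \<and> (\<Sum>k\<le>d. (b k - xt d)\<^sup>2 * p k) = \<epsilon>\<^sup>2 * V \<longrightarrow>
        \<bar>(\<Sum>k\<le>d. h j l (b k) * p k) - h j l (xt d)\<bar> \<le> e) (at_right 0)" if jl: "j < d" "l < d" for j l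
    proof -
      have "isCont (h j l) (xt d)" using ne jl xJ by (intro cont) (auto dest: sym)
      from concentration[where h = "h j l" and xt = xt and d = d, OF this bdd[OF jl] e L0] show ?thesis
        by simp
    qed
    hence "eventually (\<lambda>\<epsilon>. \<forall>j\<in>{..<d}. \<forall>l\<in>{..<d}. \<forall>b p. (\<forall>k\<le>d. 0 \<le> p k \<and> (\<exists>a\<le>d. \<bar>b k - xt a\<bar> \<le> \<epsilon> * L)) \<and>
        (\<Sum>k\<le>d. p k) = 1 \<and> (\<Sum>k\<le>d. (b k - xt d)\<^sup>2 * p k) = \<epsilon>\<^sup>2 * V \<longrightarrow>
        \<bar>(\<Sum>k\<le>d. h j l (b k) * p k) - h j l (xt d)\<bar> \<le> e) (at_right 0)" (is "eventually ?P1 _")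
      by (intro eventually_ball_finite ballI) auto
    moreover have "eventually (\<lambda>\<epsilon>. \<forall>a\<in>{..d}. \<forall>y. \<bar>y - xt a\<bar> \<le> \<epsilon> * L \<longrightarrow> y \<in> J) (at_right 0)" (is "eventually ?P2 _")
    proof (intro eventually_ball_finite ballI)
      fix a assume "a \<in> {..d}"
      then obtain r where r: "r > 0" "ball (xt a) r \<subseteq> J" using J xJ open_contains_ball by blast
      show "eventually (\<lambda>\<epsilon>. \<forall>y. \<bar>y - xt a\<bar> \<le> \<epsilon> * L \<longrightarrow> y \<in> J) (at_right 0)"
        unfolding eventually_at_right_field
      proof (intro exI[of _ "r / (L + 1)"] conjI allI impI)
        show "0 < r / (L + 1)" using r L0 by simp
        fix \<epsilon> y assume \<epsilon>: "0 < \<epsilon>" "\<epsilon> < r / (L + 1)" and y: "\<bar>y - xt a\<bar> \<le> \<epsilon> * L"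
        have "\<epsilon> * (L + 1) < r" using \<epsilon> L0 by (simp add: less_divide_eq)
        hence "\<bar>y - xt a\<bar> < r" using y \<epsilon>(1) by (simp add: algebra_simps)
        thus "y \<in> J" using r(2) by (auto simp: dist_real_def abs_minus_commute)
      qed
    qed simp
    ultimately have "eventually (\<lambda>\<epsilon>. ?P1 \<epsilon> \<and> ?P2 \<epsilon> \<and> 0 < \<epsilon>) (at_right 0)"
      by (intro eventually_conj eventually_at_right_less)
    from eventually_happens[OF this] obtain \<epsilon> where \<epsilon>: "?P1 \<epsilon>" "?P2 \<epsilon>" "0 < \<epsilon>" by auto
    have "\<exists>b p. (\<forall>k\<le>d. 0 \<le> p k \<and> (\<exists>a\<le>d. \<bar>b k - xt a\<bar> \<le> \<epsilon> * (\<Sum>j<d. cmod (w j)))) \<and>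
     (\<Sum>k\<le>d. p k) = 1 \<and> (\<Sum>k\<le>d. (b k - xt d)\<^sup>2 * p k) = \<epsilon>\<^sup>2 * (\<Sum>j<d. (cmod (w j))\<^sup>2) \<and>
     0 \<le> Re (\<Sum>j<d. \<Sum>l<d. w j * cnj (w l) * complex_of_real (\<Sum>k\<le>d. h j l (b k) * p k))"
      by (rule operator_convex_arrow[OF op \<epsilon>(3), where D = D]) (use \<epsilon>(2) id in \<open>auto simp: L_def\<close>)
    then obtain b p where bp: "\<forall>k\<le>d. 0 \<le> p k \<and> (\<exists>a\<le>d. \<bar>b k - xt a\<bar> \<le> \<epsilon> * L)"
      "(\<Sum>k\<le>d. p k) = 1" "(\<Sum>k\<le>d. (b k - xt d)\<^sup>2 * p k) = \<epsilon>\<^sup>2 * V"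
      "0 \<le> S (\<lambda>j l. \<Sum>k\<le>d. h j l (b k) * p k)" unfolding L_def V_def S_def by blast
    define m where "m = (\<lambda>j l. \<Sum>k\<le>d. h j l (b k) * p k)"
    have m: "\<bar>m j l - h j l (xt d)\<bar> \<le> e" if "j < d" "l < d" for j l
      using \<epsilon>(1) bp(1-3) that unfolding m_def by blast
    have "S m - S (\<lambda>j l. h j l (xt d)) = Re (\<Sum>j<d. \<Sum>l<d. w j * cnj (w l) * complex_of_real (m j l - h j l (xt d)))"
      unfolding S_def minus_complex.sel[symmetric] sum_subtractf[symmetric] by (simp add: algebra_simps)
    also have "\<dots> \<le> cmod (\<Sum>j<d. \<Sum>l<d. w j * cnj (w l) * complex_of_real (m j l - h j l (xt d)))"
      by (rule complex_Re_le_cmod)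
    also have "\<dots> \<le> (\<Sum>j<d. \<Sum>l<d. e * (cmod (w j) * cmod (w l)))"
    proof (intro sum_norm_le)
      fix j l assume "j \<in> {..<d}" "l \<in> {..<d}"
      hence "(cmod (w j) * cmod (w l)) * \<bar>m j l - h j l (xt d)\<bar> \<le> (cmod (w j) * cmod (w l)) * e"
        using m by (intro mult_left_mono) auto
      thus "cmod (w j * cnj (w l) * complex_of_real (m j l - h j l (xt d))) \<le> e * (cmod (w j) * cmod (w l))"
        by (simp only: norm_mult norm_of_real complex_mod_cnj mult.commute)
    qed
    also have "\<dots> = e * (\<Sum>j<d. \<Sum>l<d. cmod (w j) * cmod (w l))" by (simp add: sum_distrib_left)
    finally show ?thesis using bp(4) unfolding m_def by linarith
  qed
  note lower = this
  define T where "T = (\<Sum>j<d. \<Sum>l<d. cmod (w j) * cmod (w l))"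
  have T: "0 \<le> T" unfolding T_def by (intro sum_nonneg) auto
  have "0 \<le> S (\<lambda>j l. h j l (xt d))"
  proof (rule ccontr)
    assume neg: "\<not> ?thesis"
    \<comment> \<open>Half the supposed deficit, divided by \<open>T + 1\<close>: the error
      \<open>e * T\<close> then cannot compensate the deficit.\<close>
    define e where "e = - S (\<lambda>j l. h j l (xt d)) / (2 * (T + 1))"
    have e: "0 < e" unfolding e_def using neg T by (intro divide_pos_pos) auto
    have "e * T \<le> e * (T + 1)" using e by simp
    also have "\<dots> = - S (\<lambda>j l. h j l (xt d)) / 2" unfolding e_def using T by (simp add: field_simps)
    finally show False using lower[OF e] neg unfolding T_def[symmetric] by linarith
  qed
  thus ?thesis by (simp add: S_def h_def D_def)
qed

subsection \<open>Fenchel conjugates and lifts\<close>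

lemma C2_onD:
  assumes "C2_on S g" "x \<in> S"
  shows "(g has_real_derivative deriv g x) (at x)"
    "(deriv g has_real_derivative deriv (deriv g) x) (at x)"
proof -
  have "g differentiable at x" using assms by (simp add: C2_on_def)
  thus "(g has_real_derivative deriv g x) (at x)"
    by (simp add: DERIV_deriv_iff_real_differentiable)
  obtain D where "(deriv g has_vector_derivative D x) (at x)"
    using assms unfolding C2_on_def C1_differentiable_on_def by auto
  hence "(deriv g has_real_derivative D x) (at x)"
    by (simp add: has_real_derivative_iff_has_vector_derivative)
  thus "(deriv g has_real_derivative deriv (deriv g) x) (at x)"
    by (simp add: DERIV_imp_deriv)
qed

text \<open>The tangent at \<open>t\<close> supports \<open>f\<close> on the whole line, including
  arguments \<open>x \<le> 0\<close>, where only convexity is at hand. For small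
  \<open>u > 0\<close> the point \<open>t + u * (x - t)\<close> is still positive, so there
  \<open>f\<close> is \<open>g\<close>; convexity bounds the difference quotient by
  \<open>f x - g t\<close>, and \<open>u\<close> tends to 0 from the right.\<close>

lemma subgradient_bound:
  assumes conv: "proper_lsc_convex f" and t: "0 < t"
    and fin: "\<And>s. 0 < s \<Longrightarrow> f s = ereal (g s)"
    and der: "(g has_real_derivative D) (at t)"
  shows "ereal (g t + D * (x - t)) \<le> f x"
proof (cases "f x")
  case (real r)
  define h where "h = (\<lambda>u. (g (t + u * (x - t)) - g t) / u)"
  have "((\<lambda>u. g (t + u * (x - t))) has_real_derivative D * (x - t)) (at 0)"
    by (rule DERIV_chain2[where g = "\<lambda>u. t + u * (x - t)"]) (use der in \<open>auto intro!: derivative_eq_intros\<close>)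
  hence "(h \<longlongrightarrow> D * (x - t)) (at 0)"
    by (simp add: has_field_derivative_iff h_def)
  hence lim: "(h \<longlongrightarrow> D * (x - t)) (at_right 0)"
    by (rule filterlim_mono) (auto simp: at_le)
  have "((\<lambda>u. t + u * (x - t)) \<longlongrightarrow> t + 0 * (x - t)) (at_right (0::real))"
    by (intro tendsto_intros)
  hence "eventually (\<lambda>u. 0 < t + u * (x - t)) (at_right (0::real))"
    by (rule order_tendstoD(1)) (use t in simp)
  moreover have "eventually (\<lambda>u. u < 1) (at_right (0::real))"
    unfolding eventually_at_right_field by (intro exI[of _ 1]) simp
  moreover have "eventually (\<lambda>u. 0 < u) (at_right (0::real))" by (rule eventually_at_right_less)
  ultimately have "eventually (\<lambda>u. h u \<le> r - g t) (at_right (0::real))"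
  proof eventually_elim
    case (elim u)
    have eq: "(1 - u) * t + u * x = t + u * (x - t)" by (simp add: algebra_simps)
    have "f ((1 - u) * t + u * x) \<le> ereal (1 - u) * f t + ereal u * f x"
      using conv elim unfolding proper_lsc_convex_def by auto
    hence "g (t + u * (x - t)) \<le> (1 - u) * g t + u * r"
      unfolding eq using fin[OF elim(1)] fin[OF t] real by simp
    hence "g (t + u * (x - t)) - g t \<le> (r - g t) * u" by (simp add: algebra_simps)
    thus ?case using elim by (simp add: h_def divide_le_eq)
  qed
  hence "D * (x - t) \<le> r - g t"
    by (rule tendsto_upperbound[OF lim]) simp
  thus ?thesis using real by simp
next
  case MInf
  thus ?thesis using conv by (simp add: proper_lsc_convex_def)
qed simp

text \<open>Equality case of the Fenchel-Young inequality: since the tangent at \<open>t\<close>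
  lies below \<open>f\<close>, the supremum is attained at \<open>t\<close>.\<close>

lemma fenchel_conj_at_derivative:
  assumes conv: "proper_lsc_convex f" and t: "0 < t"
    and fin: "\<And>s. 0 < s \<Longrightarrow> f s = ereal (g s)"
    and der: "(g has_real_derivative D) (at t)"
  shows "fenchel_conj f D = ereal (t * D - g t)"
  unfolding fenchel_conj_def
proof (rule antisym)
  show "(SUP x. ereal (D * x) - f x) \<le> ereal (t * D - g t)"
  proof (rule SUP_least)
    fix x
    show "ereal (D * x) - f x \<le> ereal (t * D - g t)"
      using subgradient_bound[OF conv t fin der, of x] conv
      by (cases "f x") (auto simp: algebra_simps proper_lsc_convex_def)
  qed
  show "ereal (t * D - g t) \<le> (SUP x. ereal (D * x) - f x)"
    by (rule SUP_upper2[of t]) (auto simp: fin[OF t] mult.commute)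
qed

lemma liftable_finite:
  assumes "op_fenchel_liftable f" "0 < t"
  shows "f t = ereal (finite_part f t)"
  using assms by (cases "f t") (auto simp: op_fenchel_liftable_def finite_part_def proper_lsc_convex_def)

lemma liftable_deriv:
  assumes "op_fenchel_liftable f" "0 < t"
  shows "(finite_part f has_real_derivative deriv (finite_part f) t) (at t)"
    "(deriv (finite_part f) has_real_derivative deriv (deriv (finite_part f)) t) (at t)"
    "0 < deriv (deriv (finite_part f)) t"
  using assms C2_onD[of "{0<..}" "finite_part f" t] by (auto simp: op_fenchel_liftable_def)

lemma liftable_deriv_strict_mono:
  assumes "op_fenchel_liftable f" "0 < s" "s < t"
  shows "deriv (finite_part f) s < deriv (finite_part f) t"
proof (rule DERIV_pos_imp_increasing[OF assms(3)])
  fix x assume "s \<le> x" "x \<le> t"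
  hence "0 < x" using assms(2) by simp
  thus "\<exists>y. (deriv (finite_part f) has_real_derivative y) (at x) \<and> 0 < y"
    using liftable_deriv(2,3)[OF assms(1)] by blast
qed

text \<open>Here \<open>\<chi>\<close> is the conjugate composed with \<open>\<psi>\<close>. The
  conjugate has derivative \<open>\<tau>\<close>, the inverse function of \<open>f'\<close>, so
  \<open>\<chi>1 = \<tau> (\<psi> x) * \<psi>1\<close>; at the lift of \<open>t\<close> this is the
  relation \<open>\<chi>1 x = t * \<psi>1 x\<close> that the confluent divided differences need.
  Differentiability of \<open>\<tau>\<close> makes \<open>\<chi>\<close> twice
  differentiable.\<close>

theorem liftable_lift:
  assumes lift: "op_fenchel_liftable f"
  defines "g \<equiv> finite_part f"
  obtains J \<psi> \<psi>1 \<chi> \<chi>1 where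
    "open J" "operator_convex J (\<lambda>x. - \<psi> x)" "operator_convex J \<chi>"
    "\<And>y. y \<in> J \<Longrightarrow> (\<psi> has_real_derivative \<psi>1 y) (at y)"
    "\<And>y. y \<in> J \<Longrightarrow> \<psi>1 differentiable at y"
    "\<And>y. y \<in> J \<Longrightarrow> (\<chi> has_real_derivative \<chi>1 y) (at y)"
    "\<And>y. y \<in> J \<Longrightarrow> \<chi>1 differentiable at y"
    "\<And>t. 0 < t \<Longrightarrow> \<exists>x\<in>J. \<psi> x = deriv g t \<and> \<chi> x = t * deriv g t - g t \<and> \<chi>1 x = t * \<psi>1 x"
proof -
  define I where "I = I_dom f"
  have I: "I = deriv g ` {0<..}" using lift by (simp add: I_def g_def op_fenchel_liftable_def)
  have Io: "open I" by (simp add: I_def I_dom_def)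
  obtain J \<psi> where J: "open J" "bij_betw \<psi> J I" "C2_on J \<psi>" "operator_concave J \<psi>"
    "operator_convex J (\<lambda>x. finite_part (fenchel_conj f) (\<psi> x))"
    using lift unfolding op_fenchel_liftable_def I_def by blast
  define F where "F = finite_part (fenchel_conj f)"
  have conv: "proper_lsc_convex f" using lift by (simp add: op_fenchel_liftable_def)
  have F: "F (deriv g t) = t * deriv g t - g t" if "0 < t" for t
  proof -
    have "fenchel_conj f (deriv g t) = ereal (t * deriv g t - g t)"
      using liftable_finite[OF lift] liftable_deriv(1)[OF lift that] unfolding g_def
      by (rule fenchel_conj_at_derivative[OF conv that])
    thus ?thesis by (simp add: F_def finite_part_def)
  qed
  have inj: "inj_on (deriv g) {0<..}"
  proof (rule linorder_inj_onI')
    fix s t :: real assume "s \<in> {0<..}" "s < t"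
    thus "deriv g s \<noteq> deriv g t" using liftable_deriv_strict_mono[OF lift, of s t] by (simp add: g_def)
  qed
  define \<tau> where "\<tau> = the_inv_into {0<..} (deriv g)"
  have \<tau>: "\<tau> (deriv g t) = t" if "0 < t" for t
    unfolding \<tau>_def using inj that by (simp add: the_inv_into_f_f)
  \<comment> \<open>Inverse function theorem for \<open>f'\<close>; the derivative is invertible
    because \<open>f'' > 0\<close>.\<close>
  have \<tau>d: "(\<tau> has_real_derivative 1 / deriv (deriv g) t) (at (deriv g t))" if t: "0 < t" for t
  proof -
    have pos: "0 < deriv (deriv g) t" using liftable_deriv(3)[OF lift t] by (simp add: g_def)
    show ?thesis unfolding has_field_derivative_def
    proof (rule has_derivative_inverse_strong[where S = "{0<..}" and f = "deriv g" and x = t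
          and f' = "(*) (deriv (deriv g) t)"])
      show "continuous_on {0<..} (deriv g)"
        by (intro continuous_at_imp_continuous_on ballI DERIV_isCont)
           (use liftable_deriv(2)[OF lift] in \<open>auto simp: g_def\<close>)
      show "(deriv g has_derivative (*) (deriv (deriv g) t)) (at t)"
        using liftable_deriv(2)[OF lift t] by (simp add: g_def has_field_derivative_def)
      show "(*) (deriv (deriv g) t) \<circ> (*) (1 / deriv (deriv g) t) = id"
        using pos by (auto simp: fun_eq_iff)
    qed (use t \<tau> in auto)
  qed
  have Fd: "(F has_real_derivative \<tau> s) (at s)" if s: "s \<in> I" for s
  proof -
    obtain t where t: "0 < t" "s = deriv g t" using s unfolding I by auto
    have "(g has_real_derivative deriv g t) (at (\<tau> s))"
      using liftable_deriv(1)[OF lift t(1)] \<tau>[OF t(1)] by (simp add: g_def t(2))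
    moreover have \<tau>s: "(\<tau> has_real_derivative 1 / deriv (deriv g) t) (at s)"
      using \<tau>d[OF t(1)] by (simp add: t(2))
    ultimately have "((\<lambda>s. g (\<tau> s)) has_real_derivative deriv g t * (1 / deriv (deriv g) t)) (at s)"
      by (rule DERIV_chain2)
    \<comment> \<open>The two terms containing the derivative of \<open>\<tau>\<close> cancel,
      because \<open>g'\<close> at \<open>\<tau> s\<close> equals \<open>s\<close>; what is left is
      \<open>\<tau> s\<close>.\<close>
    from DERIV_diff[OF DERIV_mult[OF \<tau>s DERIV_ident] this]
    have "((\<lambda>s. \<tau> s * s - g (\<tau> s)) has_real_derivative \<tau> s) (at s)"
      by (simp add: t(2) mult.commute)
    thus ?thesis
      proof (rule has_field_derivative_transform_within_open[OF _ Io s])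
        fix r assume "r \<in> I"
        then obtain u where "0 < u" "r = deriv g u" unfolding I by auto
        thus "\<tau> r * r - g (\<tau> r) = F r" using F[of u] \<tau>[of u] by simp
      qed
  qed
  have \<psi>I: "\<psi> y \<in> I" if "y \<in> J" for y using bij_betw_apply[OF J(2) that] .
  have c1: "operator_convex J (\<lambda>x. - \<psi> x)" using J(4) by (simp add: operator_concave_def)
  have c2: "operator_convex J (\<lambda>x. F (\<psi> x))" using J(5) by (simp add: F_def)
  have d1: "(\<psi> has_real_derivative deriv \<psi> y) (at y)" if "y \<in> J" for y
      by (rule C2_onD(1)[OF J(3) that])
  have d2: "deriv \<psi> differentiable at y" if "y \<in> J" for y
      using C2_onD(2)[OF J(3) that] by (auto simp: real_differentiable_def)
  have d3: "((\<lambda>x. F (\<psi> x)) has_real_derivative \<tau> (\<psi> y) * deriv \<psi> y) (at y)" if "y \<in> J" for y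
      by (rule DERIV_chain2[OF Fd[OF \<psi>I[OF that]] C2_onD(1)[OF J(3) that]])
  have d4: "(\<lambda>x. \<tau> (\<psi> x) * deriv \<psi> x) differentiable at y" if y: "y \<in> J" for y
    proof -
      obtain t where t: "0 < t" "\<psi> y = deriv g t" using \<psi>I[OF y] unfolding I by auto
      have "((\<lambda>x. \<tau> (\<psi> x)) has_real_derivative 1 / deriv (deriv g) t * deriv \<psi> y) (at y)"
        by (rule DERIV_chain2[OF _ C2_onD(1)[OF J(3) y]]) (use \<tau>d[OF t(1)] t(2) in simp)
      from DERIV_mult[OF this C2_onD(2)[OF J(3) y]] show ?thesis
        unfolding real_differentiable_def by blast
    qed
  have d5: "\<exists>x\<in>J. \<psi> x = deriv g t \<and> F (\<psi> x) = t * deriv g t - g t \<and> \<tau> (\<psi> x) * deriv \<psi> x = t * deriv \<psi> x"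
      if t: "0 < t" for t
    proof -
      have "deriv g t \<in> \<psi> ` J" unfolding bij_betw_imp_surj_on[OF J(2)] I using t by simp
      then obtain x where "x \<in> J" "\<psi> x = deriv g t" by auto
      thus ?thesis using F[OF t] \<tau>[OF t] by (intro bexI[of _ x]) auto
    qed
  show ?thesis by (rule that[OF J(1) c1 c2 d1 d2 d3 d4 d5])
qed

subsection \<open>Global optimality from a dual certificate\<close>

lemma psd_spectral:
  assumes "psd n M"
  obtains U \<mu> where "U \<in> carrier_mat n n" "mat_adjoint U * U = 1\<^sub>m n" "\<And>m. m < n \<Longrightarrow> 0 \<le> \<mu> m"
    "\<And>a c. a < n \<Longrightarrow> c < n \<Longrightarrow> M $$ (a, c) = (\<Sum>m<n. complex_of_real (\<mu> m) * U $$ (a, m) * cnj (U $$ (c, m)))"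
proof -
  have herm: "hermitian n M" using assms by (simp add: psd_def)
  hence M: "M \<in> carrier_mat n n" by (simp add: hermitian_def)
  obtain U \<mu> where U: "U \<in> carrier_mat n n" "mat_adjoint U * U = 1\<^sub>m n"
    and MU: "M = U * mat_diag n (\<lambda>i. complex_of_real (\<mu> i)) * mat_adjoint U"
    using hermitian_diagonalization[OF herm] by auto
  note cs = mult_carrier_mat[of _ n n _ n] mat_adjoint_carrier[of _ n n] U(1)
  have "mat_adjoint U * M * U = (mat_adjoint U * U) * mat_diag n (\<lambda>i. complex_of_real (\<mu> i)) * (mat_adjoint U * U)"
    unfolding MU by (simp add: cs assoc_mult_mat[of _ n n _ n _ n])
  hence UMU: "mat_adjoint U * M * U = mat_diag n (\<lambda>i. complex_of_real (\<mu> i))"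
    by (simp add: U(2) left_mult_one_mat[of _ n n] right_mult_one_mat[of _ n n])
  have pos: "0 \<le> \<mu> m" if m: "m < n" for m
  proof -
    have c: "col U m \<in> carrier_vec n" using U m by simp
    have "braket (col U m) M (col U m) = (mat_adjoint U * M * U) $$ (m, m)"
      unfolding unitary_conj_index[OF U(1) M m m] braket_index[OF M c c]
      by (intro sum.cong refl) (use U m in auto)
    also have "\<dots> = complex_of_real (\<mu> m)" using m by (simp add: UMU mat_diag_def)
    finally show ?thesis using assms c by (auto simp: psd_def)
  qed
  show ?thesis
    by (rule that[OF U pos]) (auto simp: MU unitary_diag_index[OF U(1)])
qed

lemma posdef_imp_psd: "posdef n A \<Longrightarrow> psd n A"
  unfolding psd_def
proof (intro conjI ballI)
  assume A: "posdef n A"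
  thus "hermitian n A" by (simp add: posdef_def)
  hence "A \<in> carrier_mat n n" by (simp add: hermitian_def)
  fix v :: "complex vec" assume v: "v \<in> carrier_vec n"
  show "0 \<le> Re (braket v A v)"
  proof (cases "v = 0\<^sub>v n")
    case True
    thus ?thesis unfolding braket_index[OF \<open>A \<in> carrier_mat n n\<close> v v] by (simp cong: sum.cong_simp)
  qed (use A v in \<open>auto simp: posdef_def less_imp_le\<close>)
qed

lemma trace_mult_index:
  assumes "A \<in> carrier_mat n n" "M \<in> carrier_mat n n"
  shows "mat_trace (A * M) = (\<Sum>a<n. \<Sum>c<n. A $$ (a, c) * M $$ (c, a))"
proof -
  have "mat_trace (A * M) = (\<Sum>a<n. (A * M) $$ (a, a))" using assms by (simp add: mat_trace_def)
  also have "\<dots> = (\<Sum>a<n. \<Sum>c<n. A $$ (a, c) * M $$ (c, a))"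
    by (intro sum.cong refl mult_index[OF assms]) auto
  finally show ?thesis .
qed

text \<open>Reduces the weight of a positive outcome operator to quadratic forms on its
  eigenvectors, so that a vectorwise inequality between forms transfers to outcome weights.\<close>

lemma weight_spectral:
  assumes A: "A \<in> carrier_mat n n" and M: "M \<in> carrier_mat n n" and U: "U \<in> carrier_mat n n"
    and MU: "\<And>a c. a < n \<Longrightarrow> c < n \<Longrightarrow> M $$ (a, c) = (\<Sum>m<n. complex_of_real (\<mu> m) * U $$ (a, m) * cnj (U $$ (c, m)))"
  shows "outcome_weight A M = (\<Sum>m<n. \<mu> m * Re (braket (col U m) A (col U m)))"
proof -
  have "mat_trace (A * M) = (\<Sum>a<n. \<Sum>c<n. \<Sum>m<n. complex_of_real (\<mu> m) * (cnj (U $$ (a, m)) * A $$ (a, c) * U $$ (c, m)))"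
    unfolding trace_mult_index[OF A M]
    by (intro sum.cong refl) (simp add: MU sum_distrib_left mult_ac)
  also have "\<dots> = (\<Sum>a<n. \<Sum>m<n. \<Sum>c<n. complex_of_real (\<mu> m) * (cnj (U $$ (a, m)) * A $$ (a, c) * U $$ (c, m)))"
    by (rule sum.cong[OF refl], rule sum.swap)
  also have "\<dots> = (\<Sum>m<n. \<Sum>a<n. \<Sum>c<n. complex_of_real (\<mu> m) * (cnj (U $$ (a, m)) * A $$ (a, c) * U $$ (c, m)))"
    by (rule sum.swap)
  also have "\<dots> = (\<Sum>m<n. complex_of_real (\<mu> m) * braket (col U m) A (col U m))"
  proof (rule sum.cong[OF refl])
    fix m assume m: "m \<in> {..<n}"
    hence c: "col U m \<in> carrier_vec n" using U by simp
    show "(\<Sum>a<n. \<Sum>c<n. complex_of_real (\<mu> m) * (cnj (U $$ (a, m)) * A $$ (a, c) * U $$ (c, m)))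
       = complex_of_real (\<mu> m) * braket (col U m) A (col U m)"
      unfolding braket_index[OF A c c] sum_distrib_left
      by (intro sum.cong refl) (use U m in auto)
  qed
  finally show ?thesis unfolding outcome_weight_def by simp
qed

section \<open>Schur products and positivity of the certificate\<close>

text \<open>Schur product theorem: the Gram expansion of \<open>R\<close> and the real factors
  \<open>e j\<close> move into the test vector, leaving a sum over \<open>m\<close> of forms of
  \<open>H\<close> with nonnegative coefficients \<open>\<mu> m\<close>.\<close>

lemma schur_product_nonneg:
  fixes H :: "nat \<Rightarrow> nat \<Rightarrow> real" and R :: "nat \<Rightarrow> nat \<Rightarrow> complex" and e :: "nat \<Rightarrow> real"
  assumes R: "\<And>j k. j < d \<Longrightarrow> k < d \<Longrightarrow> R j k = (\<Sum>m<n. complex_of_real (\<mu> m) * \<beta> m j * cnj (\<beta> m k))"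
    and \<mu>: "\<And>m. m < n \<Longrightarrow> 0 \<le> \<mu> m"
    and H: "\<And>w. 0 \<le> Re (\<Sum>j<d. \<Sum>k<d. w j * cnj (w k) * complex_of_real (H j k))"
  shows "0 \<le> Re (\<Sum>j<d. \<Sum>k<d. cnj (c j) * c k * (complex_of_real (e j * e k * H j k) * R j k))"
proof -
  define w where "w = (\<lambda>m j. cnj (c j) * \<beta> m j * complex_of_real (e j))"
  have "(\<Sum>j<d. \<Sum>k<d. cnj (c j) * c k * (complex_of_real (e j * e k * H j k) * R j k))
     = (\<Sum>j<d. \<Sum>k<d. \<Sum>m<n. complex_of_real (\<mu> m) * (w m j * cnj (w m k) * complex_of_real (H j k)))"
    by (intro sum.cong refl) (simp add: R w_def sum_distrib_left mult_ac)
  also have "\<dots> = (\<Sum>j<d. \<Sum>m<n. \<Sum>k<d. complex_of_real (\<mu> m) * (w m j * cnj (w m k) * complex_of_real (H j k)))"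
    by (rule sum.cong[OF refl], rule sum.swap)
  also have "\<dots> = (\<Sum>m<n. \<Sum>j<d. \<Sum>k<d. complex_of_real (\<mu> m) * (w m j * cnj (w m k) * complex_of_real (H j k)))"
    by (rule sum.swap)
  also have "Re \<dots> = (\<Sum>m<n. \<mu> m * Re (\<Sum>j<d. \<Sum>k<d. w m j * cnj (w m k) * complex_of_real (H j k)))"
    unfolding sum_distrib_left[symmetric] Re_sum[of _ "{..<n}"]
    by (rule sum.cong[OF refl]) simp
  also have "\<dots> \<ge> 0" using \<mu> H by (intro sum_nonneg mult_nonneg_nonneg) auto
  finally show ?thesis .
qed

text \<open>The coefficients \<open>\<psi> (X j) - \<psi> x\<close> and
  \<open>\<chi> (X j) - \<chi> x\<close> are not symmetric in \<open>j\<close> and \<open>k\<close>.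
  Subtracting \<open>x - X j\<close> times the equation \<open>crit\<close>, which costs nothing,
  turns them into first-order remainders; dividing these by \<open>(x - X j) * (x - X k)\<close>
  gives second divided differences, to which the Schur product applies with
  \<open>e j = x - X j\<close>. The Gram expansions of \<open>R\<close> and \<open>S\<close> express
  that both matrices are positive semidefinite.\<close>

lemma lifted_certificate:
  fixes R S :: "nat \<Rightarrow> nat \<Rightarrow> complex" and X :: "nat \<Rightarrow> real"
  assumes J: "open J" and op\<psi>: "operator_convex J (\<lambda>x. - \<psi> x)" and op\<chi>: "operator_convex J \<chi>"
    and d\<psi>: "\<And>y. y \<in> J \<Longrightarrow> (\<psi> has_real_derivative \<psi>1 y) (at y)" "\<And>y. y \<in> J \<Longrightarrow> \<psi>1 differentiable at y"
    and d\<chi>: "\<And>y. y \<in> J \<Longrightarrow> (\<chi> has_real_derivative \<chi>1 y) (at y)" "\<And>y. y \<in> J \<Longrightarrow> \<chi>1 differentiable at y"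
    and X: "\<And>j. j < d \<Longrightarrow> X j \<in> J"
    and R: "\<And>j k. j < d \<Longrightarrow> k < d \<Longrightarrow> R j k = (\<Sum>m<n. complex_of_real (\<mu> m) * \<beta> m j * cnj (\<beta> m k))"
      "\<And>m. m < n \<Longrightarrow> 0 \<le> \<mu> m"
    and S: "\<And>j k. j < d \<Longrightarrow> k < d \<Longrightarrow> S j k = (\<Sum>m<n. complex_of_real (\<mu>' m) * \<beta>' m j * cnj (\<beta>' m k))"
      "\<And>m. m < n \<Longrightarrow> 0 \<le> \<mu>' m"
    and crit: "\<And>j k. j < d \<Longrightarrow> k < d \<Longrightarrow>
       complex_of_real (divided_diff \<psi> \<psi>1 (X j) (X k)) * R j k = complex_of_real (divided_diff \<chi> \<chi>1 (X j) (X k)) * S j k"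
    and x: "x \<in> J"
  shows "0 \<le> Re (\<Sum>j<d. \<Sum>k<d. cnj (c j) * c k *
     (complex_of_real (\<psi> (X j) - \<psi> x) * R j k - complex_of_real (\<chi> (X j) - \<chi> x) * S j k))" (is "0 \<le> ?Q x")
proof -
  have generic: "0 \<le> ?Q y" if y: "y \<in> J" "y \<notin> X ` {..<d}" for y
  proof -
    define xt where "xt = (\<lambda>a. if a < d then X a else y)"
    have xt: "xt j = X j" if "j < d" for j using that by (simp add: xt_def)
    have xtd: "xt d = y" by (simp add: xt_def)
    have xtJ: "xt a \<in> J" for a using X y by (simp add: xt_def)
    have ne: "xt j \<noteq> xt d" if "j < d" for j using y that by (auto simp: xt_def)
    define D where "D = (\<lambda>j k. divided_diff \<chi> \<chi>1 (X j) (X k))"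
    define D' where "D' = (\<lambda>j k. divided_diff \<psi> \<psi>1 (X j) (X k))"
    define H where "H = (\<lambda>j k. (\<chi> y - \<chi> (X j) - (y - X j) * D j k) / ((y - X j) * (y - X k)))"
    define H' where "H' = (\<lambda>j k. (\<psi> (X j) - \<psi> y + (y - X j) * D' j k) / ((y - X j) * (y - X k)))"
    have H: "0 \<le> Re (\<Sum>j<d. \<Sum>k<d. w j * cnj (w k) * complex_of_real (H j k))" for w
      using operator_convex_divided_diff_psd[where g = \<chi> and ?g1.0 = \<chi>1 and xt = xt and d = d and w = w, OF op\<chi> J xtJ ne d\<chi>]
      by (simp add: H_def D_def xt xtd cong: sum.cong_simp)
    have neg: "divided_diff (\<lambda>x. - \<psi> x) (\<lambda>x. - \<psi>1 x) u v = - divided_diff \<psi> \<psi>1 u v" for u v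
      by (simp add: divided_diff_def minus_divide_left)
    have H': "0 \<le> Re (\<Sum>j<d. \<Sum>k<d. w j * cnj (w k) * complex_of_real (H' j k))" for w
    proof -
      have d1: "((\<lambda>x. - \<psi> x) has_real_derivative - \<psi>1 z) (at z)" if "z \<in> J" for z
        using d\<psi>(1)[OF that] by (rule DERIV_minus)
      have d2: "(\<lambda>x. - \<psi>1 x) differentiable at z" if "z \<in> J" for z
        using d\<psi>(2)[OF that] by (rule differentiable_minus)
      show ?thesis
        using operator_convex_divided_diff_psd[where g = "\<lambda>x. - \<psi> x" and ?g1.0 = "\<lambda>x. - \<psi>1 x" and xt = xt and d = d and w = w, OF op\<psi> J xtJ ne d1 d2]
        by (simp add: H'_def D'_def xt xtd neg algebra_simps cong: sum.cong_simp)
    qed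
    have "cnj (c j) * c k * (complex_of_real (\<psi> (X j) - \<psi> y) * R j k - complex_of_real (\<chi> (X j) - \<chi> y) * S j k)
      = cnj (c j) * c k * (complex_of_real ((y - X j) * (y - X k) * H j k) * S j k)
      + cnj (c j) * c k * (complex_of_real ((y - X j) * (y - X k) * H' j k) * R j k)" if jk: "j < d" "k < d" for j k
    proof -
      have "(y - X j) * (y - X k) \<noteq> 0" using y jk by auto
      hence e: "(y - X j) * (y - X k) * H j k = \<chi> y - \<chi> (X j) - (y - X j) * D j k"
        "(y - X j) * (y - X k) * H' j k = \<psi> (X j) - \<psi> y + (y - X j) * D' j k"
        by (simp_all add: H_def H'_def)
      have "complex_of_real (\<psi> (X j) - \<psi> y) * R j k - complex_of_real (\<chi> (X j) - \<chi> y) * S j k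
        = complex_of_real (\<chi> y - \<chi> (X j) - (y - X j) * D j k) * S j k
        + complex_of_real (\<psi> (X j) - \<psi> y + (y - X j) * D' j k) * R j k
        - complex_of_real (y - X j) * (complex_of_real (D' j k) * R j k - complex_of_real (D j k) * S j k)"
        by (simp add: algebra_simps)
      thus ?thesis unfolding e using crit[OF jk] by (simp add: D_def D'_def distrib_left)
    qed
    hence "?Q y = Re (\<Sum>j<d. \<Sum>k<d. cnj (c j) * c k * (complex_of_real ((y - X j) * (y - X k) * H j k) * S j k))
      + Re (\<Sum>j<d. \<Sum>k<d. cnj (c j) * c k * (complex_of_real ((y - X j) * (y - X k) * H' j k) * R j k))"
      unfolding plus_complex.sel(1)[symmetric] sum.distrib[symmetric]
      by (intro arg_cong[where f = Re] sum.cong refl) simp_all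
    thus ?thesis
      using schur_product_nonneg[OF S H, where c = c and e = "\<lambda>j. y - X j"]
        schur_product_nonneg[OF R H', where c = c and e = "\<lambda>j. y - X j"] by simp
  qed
  \<comment> \<open>\<open>x = X j\<close> is reached by continuity\<close>
  have cont: "isCont \<psi> x" "isCont \<chi> x" using d\<psi>(1)[OF x] d\<chi>(1)[OF x] DERIV_isCont by blast+
  have "(?Q \<longlongrightarrow> ?Q x) (at x)"
    using cont unfolding isCont_def by (intro tendsto_intros)
  moreover have "eventually (\<lambda>y. 0 \<le> ?Q y) (at x)"
  proof -
    have "eventually (\<lambda>y. y \<in> J) (at x)" using J x by (rule eventually_at_in_open')
    moreover have "eventually (\<lambda>y. y \<in> - (X ` {..<d} - {x})) (at x)"
      by (rule eventually_at_in_open', rule open_Compl, rule finite_imp_closed) auto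
    moreover have "eventually (\<lambda>y. y \<noteq> x) (at x)" by (simp add: eventually_at_filter)
    ultimately show ?thesis by eventually_elim (rule generic, auto)
  qed
  ultimately show ?thesis by (intro tendsto_lowerbound) auto
qed

section \<open>Quadratic forms and outcome weights\<close>

lemma adjoint_move:
  assumes V: "V \<in> carrier_mat n m" and x: "x \<in> carrier_vec m" and u: "u \<in> carrier_vec n"
  shows "(V *\<^sub>v x) \<bullet>c u = x \<bullet>c (mat_adjoint V *\<^sub>v (u :: complex vec))"
proof -
  have w: "mat_adjoint V *\<^sub>v u \<in> carrier_vec m" using V u by (intro mult_mat_vec_carrier) auto
  have "(V *\<^sub>v x) \<bullet>c u = (\<Sum>a<n. \<Sum>k<m. V $$ (a, k) * x $ k * cnj (u $ a))"
    unfolding cscalar_index[OF u]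
    by (intro sum.cong refl, subst mult_vec_index[OF V x]) (auto simp: sum_distrib_right)
  also have "\<dots> = (\<Sum>k<m. \<Sum>a<n. V $$ (a, k) * x $ k * cnj (u $ a))" by (rule sum.swap)
  also have "\<dots> = (\<Sum>k<m. x $ k * cnj (\<Sum>a<n. mat_adjoint V $$ (k, a) * u $ a))"
    unfolding cnj_sum sum_distrib_left by (intro sum.cong refl) (use V in auto)
  also have "\<dots> = x \<bullet>c (mat_adjoint V *\<^sub>v u)"
    unfolding cscalar_index[OF w]
    by (intro sum.cong refl, subst mult_vec_index[of _ m n]) (use V u in auto)
  finally show ?thesis .
qed

lemma braket_conj:
  assumes V: "V \<in> carrier_mat n n" and B: "B \<in> carrier_mat n n" and u: "u \<in> carrier_vec n"
  shows "braket u (V * B * mat_adjoint V) u = braket (mat_adjoint V *\<^sub>v u) B (mat_adjoint V *\<^sub>v u)"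
proof -
  note cs = mult_carrier_mat[of _ n n _ n] mat_adjoint_carrier[of _ n n] V B u mult_mat_vec_carrier[of _ n n]
  have "(V * B * mat_adjoint V) *\<^sub>v u = V *\<^sub>v (B *\<^sub>v (mat_adjoint V *\<^sub>v u))"
    by (simp add: cs assoc_mult_mat_vec[of _ n n _ n])
  thus ?thesis unfolding braket_def
    by (simp add: adjoint_move[OF V _ u] cs)
qed

lemma trace_commute:
  assumes "A \<in> carrier_mat n n" "B \<in> carrier_mat n n"
  shows "mat_trace (A * B) = mat_trace (B * A)"
  unfolding trace_mult_index[OF assms] trace_mult_index[OF assms(2,1)]
  by (subst sum.swap) (simp add: mult.commute)

lemma braket_swap:
  assumes A: "hermitian n A" and v: "v \<in> carrier_vec n" and w: "w \<in> carrier_vec n"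
  shows "braket v A w = cnj (braket w A v)"
proof -
  have Ac: "A \<in> carrier_mat n n" and Aa: "mat_adjoint A = A" using A by (auto simp: hermitian_def)
  have "braket v A w = w \<bullet>c (A *\<^sub>v v)"
    unfolding braket_def adjoint_move[OF Ac w v] Aa ..
  also have "\<dots> = cnj ((A *\<^sub>v v) \<bullet>c w)"
    by (rule cscalar_swap[OF w]) (use Ac v in \<open>auto intro!: mult_mat_vec_carrier[of _ n n]\<close>)
  finally show ?thesis by (simp add: braket_def)
qed

lemma braket_real:
  assumes "hermitian n A" "v \<in> carrier_vec n"
  shows "braket v A v = complex_of_real (Re (braket v A v))"
  using braket_swap[OF assms assms(2)] by (simp add: complex_eq_iff)

lemma pvm_weight:
  assumes A: "A \<in> carrier_mat d d" and b: "b j \<in> carrier_vec d"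
  shows "outcome_weight A (pvm_of d b j) = Re (braket (b j) A (b j))"
proof -
  have "mat_trace (A * pvm_of d b j) = (\<Sum>a<d. \<Sum>c<d. A $$ (a, c) * pvm_of d b j $$ (c, a))"
    by (rule trace_mult_index[OF A]) (simp add: pvm_of_def)
  also have "\<dots> = (\<Sum>a<d. \<Sum>c<d. cnj (b j $ a) * A $$ (a, c) * b j $ c)"
    by (intro sum.cong refl) (simp add: pvm_of_def mult_ac)
  finally show ?thesis by (simp add: outcome_weight_def braket_index[OF A b b])
qed

lemma posdef_braket_pos:
  "posdef n A \<Longrightarrow> v \<in> carrier_vec n \<Longrightarrow> v \<bullet>c v = 1 \<Longrightarrow> 0 < Re (braket v A v)"
  by (auto simp: posdef_def)

text \<open>\<open>\<beta> m j\<close> is the inner product of \<open>b j\<close> with the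
  \<open>m\<close>-th eigenvector of \<open>A\<close>. This brings the matrix of \<open>A\<close> in
  the given vectors into the form that the Schur product argument consumes.\<close>

lemma gram_decomposition:
  assumes A: "psd n A" and b: "\<And>j. j < d \<Longrightarrow> b j \<in> carrier_vec n"
  obtains \<mu> \<beta> where "\<And>m. m < n \<Longrightarrow> 0 \<le> \<mu> m"
    "\<And>j k. j < d \<Longrightarrow> k < d \<Longrightarrow> braket (b j) A (b k) = (\<Sum>m<n. complex_of_real (\<mu> m) * \<beta> m j * cnj (\<beta> m k))"
proof -
  have Ac: "A \<in> carrier_mat n n" using A by (simp add: psd_def hermitian_def)
  obtain U \<mu> where U: "U \<in> carrier_mat n n" and \<mu>: "\<And>m. m < n \<Longrightarrow> 0 \<le> \<mu> m"
    and AU: "\<And>a c. a < n \<Longrightarrow> c < n \<Longrightarrow> A $$ (a, c) = (\<Sum>m<n. complex_of_real (\<mu> m) * U $$ (a, m) * cnj (U $$ (c, m)))"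
    by (rule psd_spectral[OF A]) blast
  define \<beta> where "\<beta> = (\<lambda>m j. \<Sum>a<n. cnj (b j $ a) * U $$ (a, m))"
  have "braket (b j) A (b k) = (\<Sum>m<n. complex_of_real (\<mu> m) * \<beta> m j * cnj (\<beta> m k))" if "j < d" "k < d" for j k
  proof -
    have "braket (b j) A (b k) = (\<Sum>a<n. \<Sum>c<n. \<Sum>m<n. complex_of_real (\<mu> m) * ((cnj (b j $ a) * U $$ (a, m)) * cnj (cnj (b k $ c) * U $$ (c, m))))"
      unfolding braket_index[OF Ac b[OF that(1)] b[OF that(2)]]
      by (intro sum.cong refl) (simp add: AU sum_distrib_left sum_distrib_right mult_ac)
    also have "\<dots> = (\<Sum>a<n. \<Sum>m<n. \<Sum>c<n. complex_of_real (\<mu> m) * ((cnj (b j $ a) * U $$ (a, m)) * cnj (cnj (b k $ c) * U $$ (c, m))))"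
      by (rule sum.cong[OF refl], rule sum.swap)
    also have "\<dots> = (\<Sum>m<n. \<Sum>a<n. \<Sum>c<n. complex_of_real (\<mu> m) * ((cnj (b j $ a) * U $$ (a, m)) * cnj (cnj (b k $ c) * U $$ (c, m))))"
      by (rule sum.swap)
    also have "\<dots> = (\<Sum>m<n. complex_of_real (\<mu> m) * (\<beta> m j * cnj (\<beta> m k)))"
      unfolding \<beta>_def cnj_sum sum_product by (simp only: sum_distrib_left)
    finally show ?thesis by (simp add: mult.assoc)
  qed
  with \<mu> show ?thesis by (rule that)
qed

lemma pvm_povm:
  assumes b: "orthonormal_basis d b"
  shows "povm d d (pvm_of d b)"
  unfolding povm_def
proof (intro conjI allI impI)
  fix y assume y: "y < d"
  have c: "pvm_of d b y \<in> carrier_mat d d" by (simp add: pvm_of_def)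
  show "psd d (pvm_of d b y)" unfolding psd_def
  proof (intro conjI ballI)
    show "hermitian d (pvm_of d b y)" by (rule hermitianI[OF c]) (simp add: pvm_of_def mult.commute)
    fix v :: "complex vec" assume v: "v \<in> carrier_vec d"
    define z where "z = (\<Sum>a<d. cnj (v $ a) * b y $ a)"
    have "braket v (pvm_of d b y) v = (\<Sum>a<d. \<Sum>c<d. (cnj (v $ a) * b y $ a) * cnj (cnj (v $ c) * b y $ c))"
      unfolding braket_index[OF c v v] by (intro sum.cong refl) (simp add: pvm_of_def mult_ac)
    also have "\<dots> = z * cnj z" unfolding z_def cnj_sum sum_product ..
    also have "\<dots> = complex_of_real ((cmod z)\<^sup>2)" by (simp only: complex_norm_square)
    finally show "0 \<le> Re (braket v (pvm_of d b y) v)" by simp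
  qed
next
  show "mat d d (\<lambda>(a, c). \<Sum>y<d. pvm_of d b y $$ (a, c)) = 1\<^sub>m d"
  proof (rule eq_matI)
    fix a c assume "a < dim_row (1\<^sub>m d :: complex mat)" "c < dim_col (1\<^sub>m d :: complex mat)"
    hence ac: "a < d" "c < d" by auto
    let ?U = "mat d d (\<lambda>(i, j). b j $ i)"
    have "(\<Sum>y<d. ?U $$ (a, y) * cnj (?U $$ (c, y))) = (if a = c then 1 else 0)"
      by (rule unitary_rows[OF _ basis_mat_unitary[OF b] ac]) simp
    hence "(\<Sum>y<d. b y $ a * cnj (b y $ c)) = (if a = c then 1 else 0)"
      using ac by (simp cong: sum.cong_simp)
    thus "mat d d (\<lambda>(a, c). \<Sum>y<d. pvm_of d b y $$ (a, c)) $$ (a, c) = 1\<^sub>m d $$ (a, c)"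
      using ac by (simp add: pvm_of_def)
  qed auto
qed

text \<open>By completeness the total weight depends on \<open>A\<close> alone, which turns
  outcomewise bounds into one bound valid for every POVM.\<close>

lemma povm_weight_sum:
  assumes M: "povm d m M" and A: "A \<in> carrier_mat d d"
  shows "(\<Sum>y<m. outcome_weight A (M y)) = Re (mat_trace A)"
proof -
  have Mc: "M y \<in> carrier_mat d d" if "y < m" for y
    using M that by (auto simp: povm_def psd_def hermitian_def)
  have one: "(\<Sum>y<m. M y $$ (c, a)) = (if c = a then 1 else 0)" if "a < d" "c < d" for a c
  proof -
    have "mat d d (\<lambda>(a, c). \<Sum>y<m. M y $$ (a, c)) $$ (c, a) = 1\<^sub>m d $$ (c, a)"
      using M by (simp add: povm_def)
    thus ?thesis using that by simp
  qed
  have "(\<Sum>y<m. mat_trace (A * M y)) = (\<Sum>y<m. \<Sum>a<d. \<Sum>c<d. A $$ (a, c) * M y $$ (c, a))"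
    by (intro sum.cong refl trace_mult_index[OF A Mc]) auto
  also have "\<dots> = (\<Sum>a<d. \<Sum>y<m. \<Sum>c<d. A $$ (a, c) * M y $$ (c, a))" by (rule sum.swap)
  also have "\<dots> = (\<Sum>a<d. \<Sum>c<d. \<Sum>y<m. A $$ (a, c) * M y $$ (c, a))"
    by (rule sum.cong[OF refl], rule sum.swap)
  also have "\<dots> = (\<Sum>a<d. \<Sum>c<d. if c = a then A $$ (a, a) else 0)"
    unfolding sum_distrib_left[symmetric] by (intro sum.cong refl) (auto simp: one)
  also have "\<dots> = mat_trace A" using A by (simp add: mat_trace_def)
  finally show ?thesis unfolding outcome_weight_def by (simp flip: Re_sum)
qed

text \<open>Positive weights keep all likelihood ratios in the region where \<open>f\<close> is
  real-valued, so the extended-real sum can be treated, and differentiated, as a real one.\<close>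

lemma measured_div_finite:
  assumes "\<And>y. y < m \<Longrightarrow> 0 < outcome_weight \<rho> (M y)" "\<And>y. y < m \<Longrightarrow> 0 < outcome_weight \<sigma> (M y)"
    and "\<And>t. 0 < t \<Longrightarrow> f t = ereal (g t)"
  shows "measured_div f \<rho> \<sigma> m M =
    ereal (\<Sum>y<m. outcome_weight \<sigma> (M y) * g (outcome_weight \<rho> (M y) / outcome_weight \<sigma> (M y)))"
  unfolding measured_div_def using assms by simp

text \<open>Weak duality. The operator \<open>Z\<close>, which is \<open>Y\<close> moved back from
  the basis \<open>b\<close>, dominates \<open>\<psi> y * \<rho> - \<chi> y * \<sigma>\<close> for
  every \<open>y\<close> in \<open>J\<close>. Since \<open>y\<close> is free, each outcome may use
  the lift of its own likelihood ratio. Only real parts of quadratic forms and of the trace of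
  \<open>Z\<close> enter. \<open>stat\<close> handles distinct ratios, \<open>degen\<close> the
  coinciding ones.\<close>

theorem stationary_globally_optimal:
  fixes b :: "nat \<Rightarrow> complex vec"
  assumes lift: "op_fenchel_liftable f" and \<rho>: "posdef d \<rho>" and \<sigma>: "posdef d \<sigma>"
    and b: "orthonormal_basis d b"
  defines "g \<equiv> finite_part f" and "P \<equiv> pvm_of d b"
  defines "t \<equiv> likelihood_ratio \<rho> \<sigma> P"
  assumes stat: "\<And>j k. j < d \<Longrightarrow> k < d \<Longrightarrow> j \<noteq> k \<Longrightarrow>
      complex_of_real (deriv g (t j) - deriv g (t k)) * braket (b j) \<rho> (b k) =
      complex_of_real ((t j * deriv g (t j) - g (t j)) - (t k * deriv g (t k) - g (t k))) * braket (b j) \<sigma> (b k)"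
    and degen: "\<And>j k. j < d \<Longrightarrow> k < d \<Longrightarrow> j \<noteq> k \<Longrightarrow> t j = t k \<Longrightarrow>
      braket (b j) \<rho> (b k) = complex_of_real (t j) * braket (b j) \<sigma> (b k)"
  shows "globally_optimal_pvm f \<rho> \<sigma> d P"
proof -
  define R where "R = (\<lambda>j k. braket (b j) \<rho> (b k))"
  define S where "S = (\<lambda>j k. braket (b j) \<sigma> (b k))"
  define p where "p = (\<lambda>j. Re (R j j))"
  define q where "q = (\<lambda>j. Re (S j j))"
  have \<rho>c: "\<rho> \<in> carrier_mat d d" "hermitian d \<rho>" and \<sigma>c: "\<sigma> \<in> carrier_mat d d" "hermitian d \<sigma>"
    using \<rho> \<sigma> by (auto simp: posdef_def hermitian_def)
  have bc: "b j \<in> carrier_vec d" "b j \<bullet>c b j = 1" if "j < d" for j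
    using b that by (auto simp: orthonormal_basis_def)
  have pq: "0 < p j" "0 < q j" "R j j = complex_of_real (p j)" "S j j = complex_of_real (q j)" if "j < d" for j
    using posdef_braket_pos[OF \<rho> bc[OF that]] posdef_braket_pos[OF \<sigma> bc[OF that]]
      braket_real[OF \<rho>c(2) bc(1)[OF that]] braket_real[OF \<sigma>c(2) bc(1)[OF that]]
    by (simp_all add: p_def q_def R_def S_def)
  have w: "outcome_weight \<rho> (P j) = p j" "outcome_weight \<sigma> (P j) = q j" if "j < d" for j
    using pvm_weight[OF \<rho>c(1), of b j] pvm_weight[OF \<sigma>c(1), of b j] bc(1)[OF that]
    by (simp_all add: P_def p_def q_def R_def S_def)
  have t: "t j = p j / q j" "0 < t j" if "j < d" for j
    using w[OF that] pq[OF that] by (simp_all add: t_def likelihood_ratio_def)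
  obtain J \<psi> \<psi>1 \<chi> \<chi>1 where
    J: "open J" "operator_convex J (\<lambda>x. - \<psi> x)" "operator_convex J \<chi>"
    and d\<psi>: "\<And>y. y \<in> J \<Longrightarrow> (\<psi> has_real_derivative \<psi>1 y) (at y)" "\<And>y. y \<in> J \<Longrightarrow> \<psi>1 differentiable at y"
    and d\<chi>: "\<And>y. y \<in> J \<Longrightarrow> (\<chi> has_real_derivative \<chi>1 y) (at y)" "\<And>y. y \<in> J \<Longrightarrow> \<chi>1 differentiable at y"
    and ex: "\<And>t. 0 < t \<Longrightarrow> \<exists>x\<in>J. \<psi> x = deriv g t \<and> \<chi> x = t * deriv g t - g t \<and> \<chi>1 x = t * \<psi>1 x"
    unfolding g_def by (rule liftable_lift[OF lift]) blast
  \<comment> \<open>One choice per ratio rather than per outcome: equal ratios then have equal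
    lifts, so degenerate pairs fall into the confluent branch of
    \<open>divided_diff\<close>.\<close>
  define x where "x = (\<lambda>t. SOME x. x \<in> J \<and> \<psi> x = deriv g t \<and> \<chi> x = t * deriv g t - g t \<and> \<chi>1 x = t * \<psi>1 x)"
  have x: "x s \<in> J" "\<psi> (x s) = deriv g s" "\<chi> (x s) = s * deriv g s - g s" "\<chi>1 (x s) = s * \<psi>1 (x s)"
    if "0 < s" for s
    using someI_ex[OF ex[OF that, unfolded Bex_def]] by (auto simp: x_def)
  have fin: "f s = ereal (g s)" if "0 < s" for s using liftable_finite[OF lift that] by (simp add: g_def)
  have mono: "deriv g s \<noteq> deriv g s'" if "0 < s" "0 < s'" "s \<noteq> s'" for s s'
    using liftable_deriv_strict_mono[OF lift] that unfolding g_def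
    by (metis less_irrefl linorder_neqE_linordered_idom)
  define X where "X = (\<lambda>j. x (t j))"
  \<comment> \<open>For equal ratios \<open>\<chi>1 = t * \<psi>1\<close> reduces the claim to
    \<open>R j k = t * S j k\<close>, which on the diagonal is the definition of the ratio and off
    it is \<open>degen\<close>. For distinct ratios strict monotonicity of \<open>f'\<close>
    separates the lifts, and \<open>stat\<close> is divided by \<open>X j - X k\<close>.\<close>
  have crit: "complex_of_real (divided_diff \<psi> \<psi>1 (X j) (X k)) * R j k = complex_of_real (divided_diff \<chi> \<chi>1 (X j) (X k)) * S j k"
    if jk: "j < d" "k < d" for j k
  proof (cases "t j = t k")
    case True
    have "R j k = complex_of_real (t j) * S j k"
    proof (cases "j = k")
      case True
      thus ?thesis using pq[OF jk(1)] t(1)[OF jk(1)] by simp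
    qed (use degen[OF jk] True in \<open>simp add: R_def S_def\<close>)
    moreover have "X j = X k" using True by (simp add: X_def)
    ultimately show ?thesis using x(4)[OF t(2)[OF jk(1)]] by (simp add: divided_diff_def X_def)
  next
    case False
    have ne: "\<psi> (X j) \<noteq> \<psi> (X k)"
      using mono[OF t(2)[OF jk(1)] t(2)[OF jk(2)] False] t(2) jk by (simp add: X_def x(2))
    hence "X j \<noteq> X k" by auto
    moreover have "complex_of_real (\<psi> (X j) - \<psi> (X k)) * R j k = complex_of_real (\<chi> (X j) - \<chi> (X k)) * S j k"
      using stat[OF jk] False t(2) jk by (auto simp: X_def x(2,3) R_def S_def)
    ultimately show ?thesis by (simp add: divided_diff_def)
  qed
  have XJ: "X j \<in> J" if "j < d" for j using x(1) t(2) that by (simp add: X_def)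
  obtain \<mu>\<rho> \<beta>\<rho> where g\<rho>: "\<And>m. m < d \<Longrightarrow> 0 \<le> \<mu>\<rho> m"
    "\<And>j k. j < d \<Longrightarrow> k < d \<Longrightarrow> R j k = (\<Sum>m<d. complex_of_real (\<mu>\<rho> m) * \<beta>\<rho> m j * cnj (\<beta>\<rho> m k))"
    unfolding R_def by (rule gram_decomposition[OF posdef_imp_psd[OF \<rho>], of d b]) (use bc in auto)
  obtain \<mu>\<sigma> \<beta>\<sigma> where g\<sigma>: "\<And>m. m < d \<Longrightarrow> 0 \<le> \<mu>\<sigma> m"
    "\<And>j k. j < d \<Longrightarrow> k < d \<Longrightarrow> S j k = (\<Sum>m<d. complex_of_real (\<mu>\<sigma> m) * \<beta>\<sigma> m j * cnj (\<beta>\<sigma> m k))"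
    unfolding S_def by (rule gram_decomposition[OF posdef_imp_psd[OF \<sigma>], of d b]) (use bc in auto)
  define V where "V = mat d d (\<lambda>(i, j). b j $ i)"
  have V: "V \<in> carrier_mat d d" "mat_adjoint V * V = 1\<^sub>m d"
    using basis_mat_unitary[OF b] by (simp_all add: V_def)
  note cs = mult_carrier_mat[of _ d d _ d] mat_adjoint_carrier[of _ d d] V(1)
  have conj_entry: "(mat_adjoint V * A * V) $$ (j, k) = braket (b j) A (b k)"
    if "A \<in> carrier_mat d d" "j < d" "k < d" for A j k
    unfolding unitary_conj_index[OF V(1) that] braket_index[OF that(1) bc(1)[OF that(2)] bc(1)[OF that(3)]]
    by (intro sum.cong refl) (use that in \<open>simp add: V_def\<close>)
  have recon: "V * (mat_adjoint V * A * V) * mat_adjoint V = A" if A: "A \<in> carrier_mat d d" for A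
  proof -
    have "V * (mat_adjoint V * A * V) * mat_adjoint V = (V * mat_adjoint V) * A * (V * mat_adjoint V)"
      using A by (simp add: cs assoc_mult_mat[of _ d d _ d _ d])
    thus ?thesis using A by (simp add: unitary_right[OF V])
  qed
  define Y where "Y = mat d d (\<lambda>(j, k). complex_of_real (\<psi> (X j)) * R j k - complex_of_real (\<chi> (X j)) * S j k)"
  define Z where "Z = V * Y * mat_adjoint V"
  have Yc: "Y \<in> carrier_mat d d" by (simp add: Y_def)
  have Zc: "Z \<in> carrier_mat d d" by (simp add: Z_def cs Yc)
  \<comment> \<open>Operator domination, tested on \<open>u\<close>: with \<open>c\<close> the
    coordinates of \<open>u\<close> in the basis \<open>b\<close>, the difference of the two sides
    is the form of \<open>lifted_certificate\<close>.\<close>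
  have key: "\<psi> y * Re (braket u \<rho> u) - \<chi> y * Re (braket u \<sigma> u) \<le> Re (braket u Z u)"
    if y: "y \<in> J" and u: "u \<in> carrier_vec d" for y u
  proof -
    define c where "c = mat_adjoint V *\<^sub>v u"
    have c: "c \<in> carrier_vec d" using u V by (auto simp: c_def intro!: mult_mat_vec_carrier[of _ d d])
    have ex: "braket u (V * B * mat_adjoint V) u = (\<Sum>j<d. \<Sum>k<d. cnj (c $ j) * B $$ (j, k) * c $ k)"
      if "B \<in> carrier_mat d d" for B
      unfolding braket_conj[OF V(1) that u] c_def[symmetric] by (rule braket_index[OF that c c])
    have ex': "braket u A u = (\<Sum>j<d. \<Sum>k<d. cnj (c $ j) * braket (b j) A (b k) * c $ k)"
      if A: "A \<in> carrier_mat d d" for A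
    proof -
      have "braket u A u = braket u (V * (mat_adjoint V * A * V) * mat_adjoint V) u" by (simp only: recon[OF A])
      also have "\<dots> = (\<Sum>j<d. \<Sum>k<d. cnj (c $ j) * (mat_adjoint V * A * V) $$ (j, k) * c $ k)"
        by (rule ex) (simp add: cs A)
      also have "\<dots> = (\<Sum>j<d. \<Sum>k<d. cnj (c $ j) * braket (b j) A (b k) * c $ k)"
        by (intro sum.cong refl) (simp only: conj_entry[OF A] lessThan_iff)
      finally show ?thesis .
    qed
    have "0 \<le> Re (\<Sum>j<d. \<Sum>k<d. cnj (c $ j) * c $ k *
     (complex_of_real (\<psi> (X j) - \<psi> y) * R j k - complex_of_real (\<chi> (X j) - \<chi> y) * S j k))"
      by (rule lifted_certificate[where X = X and R = R and S = S and \<psi> = \<psi> and \<chi> = \<chi> and ?\<psi>1.0 = \<psi>1 and ?\<chi>1.0 = \<chi>1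
        and d = d and J = J, OF J d\<psi> d\<chi> XJ g\<rho>(2,1) g\<sigma>(2,1) crit y])
    also have "(\<Sum>j<d. \<Sum>k<d. cnj (c $ j) * c $ k *
     (complex_of_real (\<psi> (X j) - \<psi> y) * R j k - complex_of_real (\<chi> (X j) - \<chi> y) * S j k))
      = (\<Sum>j<d. \<Sum>k<d. cnj (c $ j) * Y $$ (j, k) * c $ k - complex_of_real (\<psi> y) * (cnj (c $ j) * R j k * c $ k)
          + complex_of_real (\<chi> y) * (cnj (c $ j) * S j k * c $ k))"
      by (intro sum.cong refl) (simp add: Y_def algebra_simps)
    also have "\<dots> = braket u Z u - complex_of_real (\<psi> y) * braket u \<rho> u + complex_of_real (\<chi> y) * braket u \<sigma> u"
      unfolding Z_def ex[OF Yc] ex'[OF \<rho>c(1)] ex'[OF \<sigma>c(1)] R_def S_def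
      by (simp only: sum.distrib sum_subtractf sum_distrib_left)
    finally show ?thesis by simp
  qed
  have outcome: "ereal (outcome_weight \<sigma> M) * f (outcome_weight \<rho> M / outcome_weight \<sigma> M) \<le> ereal (outcome_weight Z M)"
    if M: "psd d M" for M
  proof -
    have Mc: "M \<in> carrier_mat d d" using M by (simp add: psd_def hermitian_def)
    obtain U \<mu> where U: "U \<in> carrier_mat d d" "mat_adjoint U * U = 1\<^sub>m d" and \<mu>: "\<And>m. m < d \<Longrightarrow> 0 \<le> \<mu> m"
      and MU: "\<And>a c. a < d \<Longrightarrow> c < d \<Longrightarrow> M $$ (a, c) = (\<Sum>m<d. complex_of_real (\<mu> m) * U $$ (a, m) * cnj (U $$ (c, m)))"
      by (rule psd_spectral[OF M]) blast
    define u where "u = (\<lambda>m. col U m)"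
    have u: "u m \<in> carrier_vec d" "u m \<bullet>c u m = 1" if "m < d" for m
    proof -
      show uc: "u m \<in> carrier_vec d" using U that by (simp add: u_def)
      have "u m \<bullet>c u m = (\<Sum>k<d. cnj (U $$ (k, m)) * U $$ (k, m))"
        unfolding cscalar_index[OF uc] by (intro sum.cong refl) (use U that in \<open>simp add: u_def mult.commute\<close>)
      thus "u m \<bullet>c u m = 1" using unitary_cols[OF U that that] by simp
    qed
    have ow: "outcome_weight A M = (\<Sum>m<d. \<mu> m * Re (braket (u m) A (u m)))" if "A \<in> carrier_mat d d" for A
      unfolding u_def by (rule weight_spectral[OF that Mc U(1) MU])
    show ?thesis
    proof (cases "\<exists>m<d. 0 < \<mu> m")
      \<comment> \<open>A zero outcome operator: both weights are \<open>0\<close>, and the term is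
        \<open>0\<close> whatever \<open>f (0 / 0)\<close> is, since
        \<open>0 * \<infinity> = 0\<close> in \<open>ereal\<close>.\<close>
      case False
      hence "\<mu> m = 0" if "m < d" for m using \<mu>[OF that] that by force
      hence "outcome_weight A M = 0" if "A \<in> carrier_mat d d" for A by (simp add: ow[OF that])
      thus ?thesis using \<sigma>c Zc by (simp flip: zero_ereal_def)
    next
      case True
      then obtain m0 where m0: "m0 < d" "0 < \<mu> m0" by auto
      have pos: "0 < outcome_weight A M" if A: "posdef d A" for A
      proof -
        have Ac: "A \<in> carrier_mat d d" using A by (simp add: posdef_def hermitian_def)
        show ?thesis unfolding ow[OF Ac]
        proof (rule sum_pos2[of _ m0])
          show "0 < \<mu> m0 * Re (braket (u m0) A (u m0))"
            using m0 posdef_braket_pos[OF A u] by simp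
          fix m assume "m \<in> {..<d}"
          thus "0 \<le> \<mu> m * Re (braket (u m) A (u m))"
            using \<mu>[of m] posdef_braket_pos[OF A u, of m] by simp
        qed (use m0 in auto)
      qed
      define s where "s = outcome_weight \<rho> M / outcome_weight \<sigma> M"
      have s: "0 < s" using pos[OF \<rho>] pos[OF \<sigma>] by (simp add: s_def)
      have sw: "outcome_weight \<sigma> M * s = outcome_weight \<rho> M" using pos[OF \<sigma>] by (simp add: s_def)
      \<comment> \<open>At the lift of \<open>s = p / q\<close> the perspective
        \<open>q * g s\<close> becomes \<open>p * \<psi> - q * \<chi>\<close>, which is linear in
        the outcome operator and so splits over its eigenvectors.\<close>
      have gs: "g s = s * \<psi> (x s) - \<chi> (x s)" using x(2,3)[OF s] by simp
      have "outcome_weight \<sigma> M * g s = (outcome_weight \<sigma> M * s) * \<psi> (x s) - outcome_weight \<sigma> M * \<chi> (x s)"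
        unfolding gs by (simp add: algebra_simps)
      also have "\<dots> = (\<Sum>m<d. \<mu> m * (\<psi> (x s) * Re (braket (u m) \<rho> (u m)) - \<chi> (x s) * Re (braket (u m) \<sigma> (u m))))"
        unfolding sw unfolding ow[OF \<rho>c(1)] ow[OF \<sigma>c(1)]
        by (simp add: sum_distrib_left sum_distrib_right sum_subtractf right_diff_distrib mult_ac)
      also have "\<dots> \<le> (\<Sum>m<d. \<mu> m * Re (braket (u m) Z (u m)))"
        by (intro sum_mono mult_left_mono key x(1)[OF s]) (use u \<mu> in auto)
      finally show ?thesis unfolding s_def[symmetric] fin[OF s] by (simp add: ow[OF Zc])
    qed
  qed
  have val: "measured_div f \<rho> \<sigma> d P = ereal (Re (mat_trace Z))"
  proof -
    have "mat_trace Z = mat_trace (mat_adjoint V * (V * Y))"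
      unfolding Z_def by (rule trace_commute[of _ d]) (simp_all add: cs Yc)
    also have "mat_adjoint V * (V * Y) = Y"
    proof -
      have "mat_adjoint V * (V * Y) = (mat_adjoint V * V) * Y" by (simp add: cs Yc assoc_mult_mat[of _ d d _ d _ d])
      thus ?thesis using Yc by (simp add: V(2))
    qed
    also have "mat_trace Y = (\<Sum>j<d. complex_of_real (q j * g (t j)))"
    proof -
      have "Y $$ (j, j) = complex_of_real (q j * g (t j))" if j: "j < d" for j
      proof -
        have "t j * q j = p j" using t(1)[OF j] pq[OF j] by simp
        hence "\<psi> (X j) * p j - \<chi> (X j) * q j = q j * g (t j)"
          unfolding X_def x(2)[OF t(2)[OF j]] x(3)[OF t(2)[OF j]] by (simp add: algebra_simps)
        thus ?thesis using j pq[OF j] by (simp add: Y_def flip: of_real_mult of_real_diff)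
      qed
      thus ?thesis using Yc by (simp add: mat_trace_def)
    qed
    finally have "Re (mat_trace Z) = (\<Sum>j<d. q j * g (t j))" by simp
    moreover have "measured_div f \<rho> \<sigma> d P = ereal (\<Sum>j<d. q j * g (t j))"
      by (subst measured_div_finite[where g = g]) (auto simp: w pq fin t)
    ultimately show ?thesis by simp
  qed
  show ?thesis unfolding globally_optimal_pvm_def
  proof (rule antisym)
    show "measured_div f \<rho> \<sigma> d P \<le> Sup {measured_div f \<rho> \<sigma> m M |m M. povm d m M}"
      by (rule Sup_upper) (use pvm_povm[OF b] in \<open>auto simp: P_def\<close>)
    show "Sup {measured_div f \<rho> \<sigma> m M |m M. povm d m M} \<le> measured_div f \<rho> \<sigma> d P"
    proof (rule Sup_least)
      fix e assume "e \<in> {measured_div f \<rho> \<sigma> m M |m M. povm d m M}"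
      then obtain m M where e: "e = measured_div f \<rho> \<sigma> m M" and M: "povm d m M" by auto
      have "e \<le> (\<Sum>y<m. ereal (outcome_weight Z (M y)))"
        unfolding e measured_div_def using M by (intro sum_mono outcome) (auto simp: povm_def)
      also have "\<dots> = ereal (Re (mat_trace Z))" by (simp add: povm_weight_sum[OF M Zc])
      finally show "e \<le> measured_div f \<rho> \<sigma> d P" by (simp add: val)
    qed
  qed
qed

subsection \<open>First-order condition\<close>

lemma smult_pow_index:
  assumes K: "(K :: complex mat) \<in> carrier_mat n n" and "a < n" "c < n"
  shows "((z \<cdot>\<^sub>m K) ^\<^sub>m m) $$ (a, c) = z ^ m * (K ^\<^sub>m m) $$ (a, c)"
  using assms(2,3)
proof (induction m arbitrary: c)
  case 0
  thus ?case using K by simp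
next
  case (Suc m)
  have p: "(z \<cdot>\<^sub>m K) ^\<^sub>m m \<in> carrier_mat n n" "K ^\<^sub>m m \<in> carrier_mat n n"
    using K by (auto intro!: pow_carrier_mat)
  have "((z \<cdot>\<^sub>m K) ^\<^sub>m m * (z \<cdot>\<^sub>m K)) $$ (a, c) = (\<Sum>k<n. ((z \<cdot>\<^sub>m K) ^\<^sub>m m) $$ (a, k) * (z \<cdot>\<^sub>m K) $$ (k, c))"
    by (rule mult_index[OF p(1)]) (use K Suc.prems in auto)
  also have "\<dots> = (\<Sum>k<n. z ^ Suc m * ((K ^\<^sub>m m) $$ (a, k) * K $$ (k, c)))"
    by (intro sum.cong refl) (use K Suc in \<open>simp add: mult_ac\<close>)
  also have "\<dots> = z ^ Suc m * (K ^\<^sub>m m * K) $$ (a, c)"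
    unfolding mult_index[OF p(2) K Suc.prems] sum_distrib_left ..
  finally show ?case by simp
qed

text \<open>The sum of all entry moduli dominates each column sum, so every further factor
  \<open>K\<close> costs at most that number. This allows comparison with the scalar exponential
  series.\<close>

lemma pow_index_bound:
  assumes K: "(K :: complex mat) \<in> carrier_mat n n" and "a < n" "c < n"
  shows "cmod ((K ^\<^sub>m m) $$ (a, c)) \<le> (\<Sum>k<n. \<Sum>l<n. cmod (K $$ (k, l))) ^ m"
  using assms(2,3)
proof (induction m arbitrary: c)
  case 0
  thus ?case using K by simp
next
  case (Suc m)
  let ?B = "\<Sum>k<n. \<Sum>l<n. cmod (K $$ (k, l))"
  have p: "K ^\<^sub>m m \<in> carrier_mat n n" using K by (auto intro!: pow_carrier_mat)
  have B: "0 \<le> ?B" by (intro sum_nonneg) auto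
  have "cmod ((K ^\<^sub>m m * K) $$ (a, c)) \<le> (\<Sum>k<n. ?B ^ m * cmod (K $$ (k, c)))"
    unfolding mult_index[OF p K Suc.prems]
    by (intro sum_norm_le) (use Suc in \<open>auto simp: norm_mult intro!: mult_right_mono\<close>)
  also have "\<dots> = ?B ^ m * (\<Sum>k<n. cmod (K $$ (k, c)))" by (simp add: sum_distrib_left)
  also have "\<dots> \<le> ?B ^ m * ?B"
    using B Suc.prems by (intro mult_left_mono sum_mono member_le_sum) auto
  finally show ?case by (simp add: mult.commute)
qed

text \<open>Each entry of the exponential is an everywhere convergent power series in the scalar
  \<open>z\<close>; its derivative at 0 is its linear coefficient, the entry of
  \<open>K\<close>.\<close>

lemma mat_exp_derivative_0:
  assumes K: "K \<in> carrier_mat n n" and ac: "a < n" "c < n"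
  shows "((\<lambda>z. mat_exp (z \<cdot>\<^sub>m K) $$ (a, c)) has_field_derivative K $$ (a, c)) (at 0)"
    "mat_exp (0 \<cdot>\<^sub>m K) $$ (a, c) = 1\<^sub>m n $$ (a, c)"
proof -
  define e where "e = (\<lambda>m. (K ^\<^sub>m m) $$ (a, c) / fact m)"
  define B where "B = (\<Sum>k<n. \<Sum>l<n. cmod (K $$ (k, l)))"
  have ex: "mat_exp (z \<cdot>\<^sub>m K) $$ (a, c) = (\<Sum>m. e m * z ^ m)" for z
    using K ac by (simp add: mat_exp_def smult_pow_index[OF K ac] e_def mult.commute)
  have "summable (\<lambda>m. e m * z ^ m)" for z
  proof (rule summable_comparison_test'[where N = 0])
    show "summable (\<lambda>m. (B * cmod z) ^ m /\<^sub>R fact m)" by (rule summable_exp_generic)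
    fix m :: nat
    have "norm (e m * z ^ m) = cmod ((K ^\<^sub>m m) $$ (a, c)) * cmod z ^ m / fact m"
      by (simp add: e_def norm_mult norm_divide norm_power)
    also have "\<dots> \<le> B ^ m * cmod z ^ m / fact m"
      using pow_index_bound[OF K ac, of m] by (intro divide_right_mono mult_right_mono) (auto simp: B_def)
    finally show "norm (e m * z ^ m) \<le> (B * cmod z) ^ m /\<^sub>R fact m"
      by (simp add: power_mult_distrib divide_inverse mult.commute)
  qed
  from termdiffs_strong_converges_everywhere[OF this, of 0]
  have "((\<lambda>z. \<Sum>m. e m * z ^ m) has_field_derivative diffs e 0) (at 0)"
    by simp
  moreover have "diffs e 0 = K $$ (a, c)" using K by (simp add: diffs_def e_def)
  ultimately show "((\<lambda>z. mat_exp (z \<cdot>\<^sub>m K) $$ (a, c)) has_field_derivative K $$ (a, c)) (at 0)"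
    unfolding ex by simp
  show "mat_exp (0 \<cdot>\<^sub>m K) $$ (a, c) = 1\<^sub>m n $$ (a, c)" unfolding ex powser_zero using K by (simp add: e_def)
qed

lemma mat_exp_path_derivative:
  assumes K: "K \<in> carrier_mat n n" and ac: "a < n" "c < n"
  shows "((\<lambda>\<epsilon>. mat_exp ((w * complex_of_real \<epsilon>) \<cdot>\<^sub>m K) $$ (a, c)) has_vector_derivative w * K $$ (a, c)) (at 0)"
proof -
  have "((\<lambda>z. w * z) has_field_derivative w) (at (of_real 0))"
    by (auto intro!: derivative_eq_intros)
  moreover have "((\<lambda>z. mat_exp (z \<cdot>\<^sub>m K) $$ (a, c)) has_field_derivative K $$ (a, c)) (at (w * of_real 0))"
    using mat_exp_derivative_0(1)[OF K ac] by simp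
  ultimately have "((\<lambda>z. mat_exp ((w * z) \<cdot>\<^sub>m K) $$ (a, c)) has_field_derivative K $$ (a, c) * w) (at (of_real 0))"
    by (rule DERIV_chain2[rotated])
  from has_vector_derivative_real_field[OF this] show ?thesis by (simp add: mult.commute)
qed

text \<open>Product rule at the identity: the derivative is the real part of the trace of
  \<open>A\<close> times \<open>\<i>\<close> times the commutator of \<open>K\<close> with the
  rank-one matrix \<open>Q\<close>. The two terms are \<open>\<langle>v|A K|v\<rangle>\<close> and
  \<open>\<langle>v|K A|v\<rangle>\<close>, the latter with \<open>K\<close> moved as its adjoint to
  the other side.\<close>

lemma conjugated_weight_derivative:
  assumes K: "K \<in> carrier_mat n n" and A: "A \<in> carrier_mat n n" and v: "v \<in> carrier_vec n"
    and Q: "Q = mat n n (\<lambda>(x, y). (v $ x) * cnj (v $ y))"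
  defines "E \<equiv> (\<lambda>\<epsilon>. mat_exp ((\<i> * complex_of_real \<epsilon>) \<cdot>\<^sub>m K) * Q * mat_exp ((- \<i> * complex_of_real \<epsilon>) \<cdot>\<^sub>m K))"
  shows "((\<lambda>\<epsilon>. outcome_weight A (E \<epsilon>)) has_real_derivative
      Re (\<i> * (braket v A (K *\<^sub>v v) - (A *\<^sub>v v) \<bullet>c (mat_adjoint K *\<^sub>v v)))) (at 0)"
    "outcome_weight A (E 0) = Re (braket v A v)"
proof -
  define X where "X = (\<lambda>w \<epsilon>. mat_exp ((w * complex_of_real \<epsilon>) \<cdot>\<^sub>m K))"
  have X: "X w \<epsilon> \<in> carrier_mat n n" for w \<epsilon> using K by (simp add: X_def mat_exp_def)
  have X0: "X w 0 $$ (a, c) = (if a = c then 1 else 0)" if "a < n" "c < n" for w a c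
    using mat_exp_derivative_0(2)[OF K that] that by (simp add: X_def)
  have Xd: "((\<lambda>\<epsilon>. X w \<epsilon> $$ (a, c)) has_vector_derivative w * K $$ (a, c)) (at 0)" if "a < n" "c < n" for w a c
    unfolding X_def by (rule mat_exp_path_derivative[OF K that])
  have Qc: "Q \<in> carrier_mat n n" by (simp add: Q)
  note cs = mult_carrier_mat[of _ n n _ n] X Qc
  have Ew: "outcome_weight A (E \<epsilon>) = Re (\<Sum>a<n. \<Sum>c<n. \<Sum>k<n. \<Sum>l<n.
      (A $$ (a, c) * v $ k * cnj (v $ l)) * (X \<i> \<epsilon> $$ (c, k) * X (- \<i>) \<epsilon> $$ (l, a)))" for \<epsilon>
  proof -
    have Ec: "E \<epsilon> = X \<i> \<epsilon> * Q * X (- \<i>) \<epsilon>" by (simp add: E_def X_def)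
    have "E \<epsilon> $$ (c, a) = (\<Sum>k<n. \<Sum>l<n. X \<i> \<epsilon> $$ (c, k) * (v $ k * cnj (v $ l)) * X (- \<i>) \<epsilon> $$ (l, a))"
      if "a < n" "c < n" for a c
    proof -
      have "E \<epsilon> $$ (c, a) = (\<Sum>l<n. (X \<i> \<epsilon> * Q) $$ (c, l) * X (- \<i>) \<epsilon> $$ (l, a))"
        unfolding Ec by (rule mult_index) (use that in \<open>simp_all add: cs\<close>)
      also have "\<dots> = (\<Sum>l<n. \<Sum>k<n. X \<i> \<epsilon> $$ (c, k) * (v $ k * cnj (v $ l)) * X (- \<i>) \<epsilon> $$ (l, a))"
        by (rule sum.cong[OF refl], subst mult_index[OF X Qc]) (use that in \<open>auto simp: Q sum_distrib_right\<close>)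
      finally show ?thesis by (subst sum.swap)
    qed
    hence "mat_trace (A * E \<epsilon>) = (\<Sum>a<n. \<Sum>c<n. \<Sum>k<n. \<Sum>l<n.
      (A $$ (a, c) * v $ k * cnj (v $ l)) * (X \<i> \<epsilon> $$ (c, k) * X (- \<i>) \<epsilon> $$ (l, a)))"
      by (subst trace_mult_index[OF A]) (auto simp: Ec cs sum_distrib_left mult_ac intro!: sum.cong)
    thus ?thesis by (simp add: outcome_weight_def)
  qed
  have "((\<lambda>\<epsilon>. \<Sum>a<n. \<Sum>c<n. \<Sum>k<n. \<Sum>l<n.
      (A $$ (a, c) * v $ k * cnj (v $ l)) * (X \<i> \<epsilon> $$ (c, k) * X (- \<i>) \<epsilon> $$ (l, a))) has_vector_derivative
     (\<Sum>a<n. \<Sum>c<n. \<Sum>k<n. \<Sum>l<n. (A $$ (a, c) * v $ k * cnj (v $ l)) *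
       (X \<i> 0 $$ (c, k) * (- \<i> * K $$ (l, a)) + \<i> * K $$ (c, k) * X (- \<i>) 0 $$ (l, a)))) (at 0)"
    by (intro has_vector_derivative_sum has_vector_derivative_mult_right has_vector_derivative_mult Xd) auto
  from bounded_linear.has_vector_derivative[OF bounded_linear_Re this]
  have der: "((\<lambda>\<epsilon>. outcome_weight A (E \<epsilon>)) has_real_derivative
     Re (\<Sum>a<n. \<Sum>c<n. \<Sum>k<n. \<Sum>l<n. (A $$ (a, c) * v $ k * cnj (v $ l)) *
       (X \<i> 0 $$ (c, k) * (- \<i> * K $$ (l, a)) + \<i> * K $$ (c, k) * X (- \<i>) 0 $$ (l, a)))) (at 0)"
    by (simp only: Ew has_real_derivative_iff_has_vector_derivative)
  have "(\<Sum>a<n. \<Sum>c<n. \<Sum>k<n. \<Sum>l<n. (A $$ (a, c) * v $ k * cnj (v $ l)) *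
       (X \<i> 0 $$ (c, k) * (- \<i> * K $$ (l, a)) + \<i> * K $$ (c, k) * X (- \<i>) 0 $$ (l, a)))
     = (\<Sum>a<n. \<Sum>c<n. \<i> * (cnj (v $ a) * A $$ (a, c) * (\<Sum>k<n. K $$ (c, k) * v $ k))
         - \<i> * (A $$ (a, c) * v $ c * (\<Sum>l<n. cnj (v $ l) * K $$ (l, a))))"
  proof (intro sum.cong refl)
    fix a c assume ac: "a \<in> {..<n}" "c \<in> {..<n}"
    have "(\<Sum>k<n. \<Sum>l<n. (A $$ (a, c) * v $ k * cnj (v $ l)) *
       (X \<i> 0 $$ (c, k) * (- \<i> * K $$ (l, a)) + \<i> * K $$ (c, k) * X (- \<i>) 0 $$ (l, a)))
     = (\<Sum>k<n. \<Sum>l<n. (if l = a then \<i> * (cnj (v $ a) * A $$ (a, c) * (K $$ (c, k) * v $ k)) else 0))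
      + (\<Sum>k<n. \<Sum>l<n. (if k = c then - (\<i> * (A $$ (a, c) * v $ c * (cnj (v $ l) * K $$ (l, a)))) else 0))"
      unfolding sum.distrib[symmetric] using ac by (intro sum.cong refl) (auto simp: X0 algebra_simps)
    also have "(\<Sum>k<n. \<Sum>l<n. (if k = c then - (\<i> * (A $$ (a, c) * v $ c * (cnj (v $ l) * K $$ (l, a)))) else 0))
      = (\<Sum>l<n. - (\<i> * (A $$ (a, c) * v $ c * (cnj (v $ l) * K $$ (l, a)))))"
      using ac by (subst sum.swap) simp
    finally show "(\<Sum>k<n. \<Sum>l<n. (A $$ (a, c) * v $ k * cnj (v $ l)) *
       (X \<i> 0 $$ (c, k) * (- \<i> * K $$ (l, a)) + \<i> * K $$ (c, k) * X (- \<i>) 0 $$ (l, a)))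
     = \<i> * (cnj (v $ a) * A $$ (a, c) * (\<Sum>k<n. K $$ (c, k) * v $ k))
         - \<i> * (A $$ (a, c) * v $ c * (\<Sum>l<n. cnj (v $ l) * K $$ (l, a)))"
      using ac by (simp add: sum_distrib_left sum_negf)
  qed
  also have "\<dots> = \<i> * (braket v A (K *\<^sub>v v) - (A *\<^sub>v v) \<bullet>c (mat_adjoint K *\<^sub>v v))"
  proof -
    have Kv: "K *\<^sub>v v \<in> carrier_vec n" "mat_adjoint K *\<^sub>v v \<in> carrier_vec n"
      using K v by (auto intro!: mult_mat_vec_carrier[of _ n n])
    have 1: "braket v A (K *\<^sub>v v) = (\<Sum>a<n. \<Sum>c<n. cnj (v $ a) * A $$ (a, c) * (\<Sum>k<n. K $$ (c, k) * v $ k))"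
      unfolding braket_index[OF A v Kv(1)]
      by (intro sum.cong refl, subst mult_vec_index[OF K v]) auto
    have 2: "(A *\<^sub>v v) \<bullet>c (mat_adjoint K *\<^sub>v v) = (\<Sum>a<n. \<Sum>c<n. A $$ (a, c) * v $ c * (\<Sum>l<n. cnj (v $ l) * K $$ (l, a)))"
    proof -
      have "cnj ((mat_adjoint K *\<^sub>v v) $ a) = (\<Sum>l<n. cnj (v $ l) * K $$ (l, a))" if "a < n" for a
        using K v that by (subst mult_vec_index[of _ n n]) (auto intro!: sum.cong)
      thus ?thesis unfolding cscalar_index[OF Kv(2)]
        by (intro sum.cong refl, subst mult_vec_index[OF A v]) (auto simp: sum_distrib_right)
    qed
    show ?thesis unfolding 1 2 by (simp add: sum_subtractf right_diff_distrib sum_distrib_left)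
  qed
  finally have eq: "(\<Sum>a<n. \<Sum>c<n. \<Sum>k<n. \<Sum>l<n. (A $$ (a, c) * v $ k * cnj (v $ l)) *
       (X \<i> 0 $$ (c, k) * (- \<i> * K $$ (l, a)) + \<i> * K $$ (c, k) * X (- \<i>) 0 $$ (l, a)))
     = \<i> * (braket v A (K *\<^sub>v v) - (A *\<^sub>v v) \<bullet>c (mat_adjoint K *\<^sub>v v))" .
  show "((\<lambda>\<epsilon>. outcome_weight A (E \<epsilon>)) has_real_derivative
      Re (\<i> * (braket v A (K *\<^sub>v v) - (A *\<^sub>v v) \<bullet>c (mat_adjoint K *\<^sub>v v)))) (at 0)"
    using der unfolding eq .
  have "X w 0 = 1\<^sub>m n" for w by (rule eq_matI) (use X[of w 0] in \<open>auto simp: X0\<close>)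
  hence "E 0 = Q" using Qc by (simp add: E_def X_def)
  thus "outcome_weight A (E 0) = Re (braket v A v)"
    using pvm_weight[OF A, of "\<lambda>_. v" 0] v by (simp add: Q pvm_of_def)
qed

lemma braket_smult_right:
  "A \<in> carrier_mat n n \<Longrightarrow> v \<in> carrier_vec n \<Longrightarrow> w \<in> carrier_vec n \<Longrightarrow>
   braket v A (z \<cdot>\<^sub>v w) = z * braket v A w"
  by (simp add: braket_def mult_mat_vec[of _ n n])

text \<open>Grouped by \<open>dp\<close> and \<open>dq\<close>: the coefficients are
  \<open>g'\<close> and \<open>g - t * g'\<close>, the latter being minus the conjugate at
  \<open>g'\<close>. These are the quantities that the stationarity relation compares.\<close>

lemma perspective_derivative:
  assumes "(p has_real_derivative dp) (at x)" "(q has_real_derivative dq) (at x)"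
    and "q x \<noteq> 0" "(g has_real_derivative g') (at (p x / q x))"
  shows "((\<lambda>x. q x * g (p x / q x)) has_real_derivative
    dq * (g (p x / q x) - p x / q x * g') + g' * dp) (at x)"
proof -
  have "((\<lambda>x. p x / q x) has_real_derivative (dp * q x - p x * dq) / (q x * q x)) (at x)"
    using DERIV_divide[OF assms(1,2,3)] .
  from DERIV_mult[OF assms(2) DERIV_chain2[OF assms(4) this]]
  show ?thesis
    by (rule DERIV_cong) (use assms(3) in \<open>simp add: field_simps\<close>)
qed

text \<open>A single generator suffices for each pair: a \<open>K\<close> that couples only
  \<open>b j\<close> and \<open>b k\<close>, with amplitude adapted to the defect \<open>Z\<close>
  of the claimed equation, for which the derivative is a nonzero multiple of
  \<open>(cmod Z)\<^sup>2\<close>.\<close>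

theorem critical_relation:
  fixes b :: "nat \<Rightarrow> complex vec"
  assumes fin: "\<And>s. 0 < s \<Longrightarrow> f s = ereal (g s)" and der: "\<And>s. 0 < s \<Longrightarrow> (g has_real_derivative g1 s) (at s)"
    and \<rho>: "posdef d \<rho>" and \<sigma>: "posdef d \<sigma>" and b: "orthonormal_basis d b"
    and crit: "critical_pvm f \<rho> \<sigma> d (pvm_of d b)"
    and jk: "j < d" "k < d" "j \<noteq> k"
  defines "t \<equiv> likelihood_ratio \<rho> \<sigma> (pvm_of d b)"
  shows "complex_of_real (g1 (t j) - g1 (t k)) * braket (b j) \<rho> (b k) =
      complex_of_real ((t j * g1 (t j) - g (t j)) - (t k * g1 (t k) - g (t k))) * braket (b j) \<sigma> (b k)"
proof -
  define Z where "Z = complex_of_real (g1 (t j) - g1 (t k)) * braket (b j) \<rho> (b k) -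
      complex_of_real ((t j * g1 (t j) - g (t j)) - (t k * g1 (t k) - g (t k))) * braket (b j) \<sigma> (b k)"
  \<comment> \<open>With this amplitude \<open>cnj c * Z\<close> is \<open>\<i>\<close> times the
    squared modulus of \<open>Z\<close>, so the derivative \<open>- 2 * Im (cnj c * Z)\<close>
    vanishes only for \<open>Z = 0\<close>.\<close>
  define c where "c = - \<i> * Z"
  have bc: "b y \<in> carrier_vec d" if "y < d" for y using b that by (simp add: orthonormal_basis_def)
  have bb: "b y \<bullet>c b z = (if y = z then 1 else 0)" if "y < d" "z < d" for y z
    using b that by (simp add: orthonormal_basis_def)
  define K where "K = mat d d (\<lambda>(x, y). c * b j $ x * cnj (b k $ y) + cnj c * b k $ x * cnj (b j $ y))"
  have Kc: "K \<in> carrier_mat d d" by (simp add: K_def)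
  have hK: "hermitian d K" by (rule hermitianI[OF Kc]) (simp add: K_def mult_ac add.commute)
  hence Ka: "mat_adjoint K = K" by (simp add: hermitian_def)
  have Kv: "K *\<^sub>v b y = (if y = j then cnj c \<cdot>\<^sub>v b k else if y = k then c \<cdot>\<^sub>v b j else 0\<^sub>v d)" if y: "y < d" for y
  proof (rule eq_vecI)
    fix x assume "x < dim_vec (if y = j then cnj c \<cdot>\<^sub>v b k else if y = k then c \<cdot>\<^sub>v b j else 0\<^sub>v d)"
    hence x: "x < d" using bc[OF jk(1)] bc[OF jk(2)] by (auto split: if_splits)
    have "(K *\<^sub>v b y) $ x = (\<Sum>z<d. K $$ (x, z) * b y $ z)" by (rule mult_vec_index[OF Kc bc[OF y] x])
    also have "\<dots> = (\<Sum>z<d. c * b j $ x * (b y $ z * cnj (b k $ z)) + cnj c * b k $ x * (b y $ z * cnj (b j $ z)))"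
      by (intro sum.cong refl) (use x in \<open>simp add: K_def algebra_simps\<close>)
    also have "\<dots> = c * b j $ x * (b y \<bullet>c b k) + cnj c * b k $ x * (b y \<bullet>c b j)"
      by (simp only: cscalar_index[OF bc[OF jk(1)]] cscalar_index[OF bc[OF jk(2)]] sum.distrib sum_distrib_left)
    finally show "(K *\<^sub>v b y) $ x = (if y = j then cnj c \<cdot>\<^sub>v b k else if y = k then c \<cdot>\<^sub>v b j else 0\<^sub>v d) $ x"
      using x bb[OF y jk(1)] bb[OF y jk(2)] jk bc[OF jk(1)] bc[OF jk(2)] by auto
  qed (use Kc bc[OF jk(1)] bc[OF jk(2)] in auto)
  define E where "E = (\<lambda>\<epsilon> y. mat_exp ((\<i> * complex_of_real \<epsilon>) \<cdot>\<^sub>m K) * pvm_of d b y * mat_exp ((- \<i> * complex_of_real \<epsilon>) \<cdot>\<^sub>m K))"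
  define dw where "dw = (\<lambda>A y. if y = j then - 2 * Im (cnj c * braket (b j) A (b k))
     else if y = k then 2 * Im (cnj c * braket (b j) A (b k)) else (0::real))"
  have wd: "((\<lambda>\<epsilon>. outcome_weight A (E \<epsilon> y)) has_real_derivative dw A y) (at 0)"
    and w0: "outcome_weight A (E 0 y) = Re (braket (b y) A (b y))"
    if A: "hermitian d A" and y: "y < d" for A y
  proof -
    have Ac: "A \<in> carrier_mat d d" using A by (simp add: hermitian_def)
    note base = conjugated_weight_derivative[OF Kc Ac bc[OF y] pvm_of_def[of d b y]]
    show "outcome_weight A (E 0 y) = Re (braket (b y) A (b y))"
      using base(2) by (simp only: E_def)
    have sm: "(A *\<^sub>v v) \<bullet>c (z \<cdot>\<^sub>v w) = cnj z * braket w A v" if "v \<in> carrier_vec d" "w \<in> carrier_vec d" for v w z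
      using Ac that by (simp add: braket_def conjugate_smult_vec)
    have Av: "A *\<^sub>v b y \<in> carrier_vec d" using Ac bc[OF y] by (auto intro!: mult_mat_vec_carrier[of _ d d])
    have "Re (\<i> * (braket (b y) A (K *\<^sub>v b y) - (A *\<^sub>v b y) \<bullet>c (K *\<^sub>v b y))) = dw A y"
    proof (cases "y = j \<or> y = k")
      case True
      have "braket (b k) A (b j) = cnj (braket (b j) A (b k))"
        by (rule braket_swap[OF A bc[OF jk(2)] bc[OF jk(1)]])
      thus ?thesis using True jk y
        by (auto simp: Kv dw_def sm bc braket_smult_right[OF Ac])
    next
      case False
      have "A *\<^sub>v 0\<^sub>v d = 0\<^sub>v d" using Ac by (intro eq_vecI) auto
      thus ?thesis using False Av bc[OF y] by (simp add: Kv[OF y] dw_def braket_def)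
    qed
    thus "((\<lambda>\<epsilon>. outcome_weight A (E \<epsilon> y)) has_real_derivative dw A y) (at 0)"
      using base(1) unfolding Ka by (simp only: E_def)
  qed
  have h\<rho>: "hermitian d \<rho>" and h\<sigma>: "hermitian d \<sigma>" using \<rho> \<sigma> by (auto simp: posdef_def)
  have pos: "0 < outcome_weight A (E 0 y)" if A: "posdef d A" and y: "y < d" for A y
    using posdef_braket_pos[OF A bc[OF y]] bb[OF y y] A w0[OF _ y] by (simp add: posdef_def)
  have t: "t y = outcome_weight \<rho> (E 0 y) / outcome_weight \<sigma> (E 0 y)" if y: "y < d" for y
    using pvm_weight[of \<rho> d b y] pvm_weight[of \<sigma> d b y] h\<rho> h\<sigma> bc[OF y] w0[OF h\<rho> y] w0[OF h\<sigma> y]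
    by (simp add: t_def likelihood_ratio_def hermitian_def)
  have t0: "0 < t y" if "y < d" for y using pos[OF \<rho> that] pos[OF \<sigma> that] by (simp add: t[OF that])
  define G where "G = (\<lambda>\<epsilon>. \<Sum>y<d. outcome_weight \<sigma> (E \<epsilon> y) * g (outcome_weight \<rho> (E \<epsilon> y) / outcome_weight \<sigma> (E \<epsilon> y)))"
  have dG: "(G has_real_derivative (\<Sum>y<d. dw \<sigma> y * (g (t y) - t y * g1 (t y)) + g1 (t y) * dw \<rho> y)) (at 0)"
    unfolding G_def
  proof (intro DERIV_sum)
    fix y assume "y \<in> {..<d}" hence y: "y < d" by simp
    show "((\<lambda>\<epsilon>. outcome_weight \<sigma> (E \<epsilon> y) * g (outcome_weight \<rho> (E \<epsilon> y) / outcome_weight \<sigma> (E \<epsilon> y)))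
       has_real_derivative dw \<sigma> y * (g (t y) - t y * g1 (t y)) + g1 (t y) * dw \<rho> y) (at 0)"
      unfolding t[OF y]
      by (rule perspective_derivative[OF wd[OF h\<rho> y] wd[OF h\<sigma> y]])
         (use pos[OF \<sigma> y] der[OF t0[OF y]] in \<open>simp_all add: t[OF y]\<close>)
  qed
  have ev: "eventually (\<lambda>\<epsilon>. \<forall>y\<in>{..<d}. 0 < outcome_weight A (E \<epsilon> y)) (nhds 0)" if A: "posdef d A" for A
  proof (intro eventually_ball_finite ballI)
    fix y assume "y \<in> {..<d}" hence y: "y < d" by simp
    have "hermitian d A" using A by (simp add: posdef_def)
    from DERIV_isCont[OF wd[OF this y]] have "((\<lambda>\<epsilon>. outcome_weight A (E \<epsilon> y)) \<longlongrightarrow> outcome_weight A (E 0 y)) (nhds 0)"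
      using tendsto_at_iff_tendsto_nhds[of "\<lambda>\<epsilon>. outcome_weight A (E \<epsilon> y)" 0] by (simp add: isCont_def)
    thus "eventually (\<lambda>\<epsilon>. 0 < outcome_weight A (E \<epsilon> y)) (nhds 0)"
      using pos[OF A y] by (rule order_tendstoD(1))
  qed simp
  \<comment> \<open>Criticality differentiates the extended-real expression; it agrees with the real
    function \<open>G\<close> while all weights are positive, which by continuity holds near
    \<open>0\<close>.\<close>
  have evG: "eventually (\<lambda>\<epsilon>. real_of_ereal (measured_div f \<rho> \<sigma> d (E \<epsilon>)) = G \<epsilon>) (nhds 0)"
    using ev[OF \<rho>] ev[OF \<sigma>]
  proof eventually_elim
    case (elim \<epsilon>)
    thus ?case by (subst measured_div_finite[where g = g]) (auto simp: fin G_def)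
  qed
  have "((\<lambda>\<epsilon>. real_of_ereal (measured_div f \<rho> \<sigma> d (E \<epsilon>))) has_real_derivative 0) (at 0)"
    using crit hK unfolding critical_pvm_def E_def by blast
  hence "(G has_real_derivative 0) (at 0)"
    using DERIV_cong_ev[OF refl evG refl] by simp
  from DERIV_unique[OF dG this] have "(\<Sum>y<d. dw \<sigma> y * (g (t y) - t y * g1 (t y)) + g1 (t y) * dw \<rho> y) = 0" .
  moreover have "(\<Sum>y<d. dw \<sigma> y * (g (t y) - t y * g1 (t y)) + g1 (t y) * dw \<rho> y)
    = (\<Sum>y\<in>{j, k}. dw \<sigma> y * (g (t y) - t y * g1 (t y)) + g1 (t y) * dw \<rho> y)"
    by (rule sum.mono_neutral_right) (use jk in \<open>auto simp: dw_def\<close>)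
  ultimately have "- 2 * Im (cnj c * Z) = 0"
    using jk by (simp add: dw_def Z_def algebra_simps)
  moreover have "cnj c * Z = \<i> * complex_of_real ((cmod Z)\<^sup>2)"
    unfolding complex_norm_square by (simp add: c_def mult_ac)
  ultimately have "Z = 0" by simp
  thus ?thesis by (simp add: Z_def)
qed

subsection \<open>Second derivatives and the atomic representation\<close>

lemma has_second_deriv_add:
  assumes "has_second_deriv g D x" "has_second_deriv h E x"
  shows "has_second_deriv (\<lambda>y. g y + h y) (D + E) x"
proof -
  obtain g' h' where g: "\<forall>\<^sub>F y in nhds x. (g has_real_derivative g' y) (at y)" "(g' has_real_derivative D) (at x)"
    and h: "\<forall>\<^sub>F y in nhds x. (h has_real_derivative h' y) (at y)" "(h' has_real_derivative E) (at x)"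
    using assms unfolding has_second_deriv_def by blast
  have "\<forall>\<^sub>F y in nhds x. ((\<lambda>y. g y + h y) has_real_derivative (g' y + h' y)) (at y)"
    using g(1) h(1) by eventually_elim (rule DERIV_add)
  thus ?thesis unfolding has_second_deriv_def using DERIV_add[OF g(2) h(2)]
    by (intro exI[of _ "\<lambda>y. g' y + h' y"] conjI)
qed

lemma has_second_deriv_sum:
  assumes "\<And>i. i < (n::nat) \<Longrightarrow> has_second_deriv (g i) (D i) x"
  shows "has_second_deriv (\<lambda>y. \<Sum>i<n. g i y) (\<Sum>i<n. D i) x"
  using assms
proof (induction n)
  case 0
  show ?case unfolding has_second_deriv_def by (rule exI[of _ "\<lambda>_. 0"]) simp
qed (simp add: has_second_deriv_add)

text \<open>The first derivative is \<open>q1 * (g t - t * g1 t) + g1 t * p1\<close>.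
  Differentiating the coefficients gives \<open>- t * g2 t\<close> and \<open>g2 t\<close>, each
  times the derivative \<open>(p1 - t * q1) / q\<close> of the ratio, and these two contributions
  combine to the square.\<close>

lemma second_derivative_perspective:
  fixes p q g g1 g2 :: "real \<Rightarrow> real"
  assumes p: "\<And>y. (p has_real_derivative p1 y) (at y)" "(p1 has_real_derivative p2) (at x)"
    and q: "\<And>y. (q has_real_derivative q1 y) (at y)" "(q1 has_real_derivative q2) (at x)"
    and pos: "\<And>y. 0 < p y" "\<And>y. 0 < q y"
    and g: "\<And>t. 0 < t \<Longrightarrow> (g has_real_derivative g1 t) (at t)" "\<And>t. 0 < t \<Longrightarrow> (g1 has_real_derivative g2 t) (at t)"
  defines "t \<equiv> p x / q x"
  shows "has_second_deriv (\<lambda>y. q y * g (p y / q y))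
     (q2 * (g t - t * g1 t) + g1 t * p2 + g2 t * (p1 x - t * q1 x)\<^sup>2 / q x) x"
proof -
  let ?t = "\<lambda>y. p y / q y"
  have tp: "0 < ?t y" for y using pos by simp
  have qn: "q y \<noteq> 0" for y using pos(2)[of y] by simp
  have dt: "(?t has_real_derivative (p1 y - ?t y * q1 y) / q y) (at y)" for y
    by (rule DERIV_cong[OF DERIV_divide[OF p(1) q(1) qn]]) (use qn in \<open>simp add: field_simps\<close>)
  have dg: "((\<lambda>y. g (?t y)) has_real_derivative g1 (?t y) * ((p1 y - ?t y * q1 y) / q y)) (at y)" for y
    by (rule DERIV_chain2[OF g(1)[OF tp] dt])
  have dg1: "((\<lambda>y. g1 (?t y)) has_real_derivative g2 (?t y) * ((p1 y - ?t y * q1 y) / q y)) (at y)" for y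
    by (rule DERIV_chain2[OF g(2)[OF tp] dt])
  define h where "h = (\<lambda>y. q1 y * (g (?t y) - ?t y * g1 (?t y)) + g1 (?t y) * p1 y)"
  have "((\<lambda>y. q y * g (?t y)) has_real_derivative h y) (at y)" for y
    by (rule DERIV_cong[OF DERIV_mult[OF q(1) dg]]) (use qn[of y] in \<open>simp add: h_def field_simps\<close>)
  moreover have "(h has_real_derivative (q2 * (g t - t * g1 t) + g1 t * p2 + g2 t * (p1 x - t * q1 x)\<^sup>2 / q x)) (at x)"
    unfolding h_def
    by (rule DERIV_cong[OF DERIV_add[OF DERIV_mult[OF q(2) DERIV_diff[OF dg DERIV_mult[OF dt dg1]]] DERIV_mult[OF dg1 p(2)]]])
       (use qn[of x] in \<open>simp add: t_def[symmetric] power2_eq_square, simp add: field_simps\<close>)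
  ultimately show ?thesis unfolding has_second_deriv_def
    by (intro exI[of _ h] conjI always_eventually allI)
qed

section \<open>Differentiation under the integral and the atoms\<close>

text \<open>Two successive mean value estimates, hence \<open>C\<close> rather than
  \<open>C / 2\<close>. What matters is that the constant can be taken uniform over a family of
  functions.\<close>

lemma taylor_remainder_bound:
  fixes F F1 F2 :: "real \<Rightarrow> real"
  assumes F: "\<And>u. u \<in> ball t r \<Longrightarrow> (F has_real_derivative F1 u) (at u)"
    "\<And>u. u \<in> ball t r \<Longrightarrow> (F1 has_real_derivative F2 u) (at u)"
    "\<And>u. u \<in> ball t r \<Longrightarrow> \<bar>F2 u\<bar> \<le> C" and u: "u \<in> ball t r"
  shows "\<bar>F u - F t - (u - t) * F1 t\<bar> \<le> C * (u - t)\<^sup>2"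
proof -
  have r: "0 < r" using u by (metis ball_eq_empty empty_iff linorder_not_le)
  have C: "0 \<le> C" using F(3)[of t] r by simp
  have F1: "\<bar>F1 v - F1 t\<bar> \<le> C * \<bar>v - t\<bar>" if v: "v \<in> ball t r" for v
    using field_differentiable_bound[of "ball t r" F1 F2 C v t] F(2,3) v r
    by (auto simp: has_field_derivative_at_within)
  let ?S = "cball t \<bar>u - t\<bar>"
  have S: "v \<in> ball t r" "\<bar>v - t\<bar> \<le> \<bar>u - t\<bar>" if "v \<in> ?S" for v
    using that u by (auto simp: dist_real_def)
  have "norm ((F u - u * F1 t) - (F t - t * F1 t)) \<le> (C * \<bar>u - t\<bar>) * norm (u - t)"
  proof (rule field_differentiable_bound[of ?S _ "\<lambda>v. F1 v - F1 t"])
    fix v assume v: "v \<in> ?S"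
    show "((\<lambda>y. F y - y * F1 t) has_field_derivative F1 v - F1 t) (at v within ?S)"
      by (rule has_field_derivative_at_within) (use F(1)[OF S(1)[OF v]] in \<open>auto intro!: derivative_eq_intros\<close>)
    have "\<bar>F1 v - F1 t\<bar> \<le> C * \<bar>v - t\<bar>" by (rule F1[OF S(1)[OF v]])
    also have "\<dots> \<le> C * \<bar>u - t\<bar>" using S(2)[OF v] C by (intro mult_left_mono)
    finally show "norm (F1 v - F1 t) \<le> C * \<bar>u - t\<bar>" by simp
  qed (auto simp: dist_real_def)
  moreover have "(F u - u * F1 t) - (F t - t * F1 t) = F u - F t - (u - t) * F1 t"
    by (simp add: algebra_simps)
  moreover have "(C * \<bar>u - t\<bar>) * norm (u - t) = C * (u - t)\<^sup>2"
    by (simp add: power2_eq_square mult.assoc)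
  ultimately show ?thesis by (simp only: real_norm_def)
qed

text \<open>A quadratic remainder whose constant does not depend on \<open>l\<close> integrates,
  over a finite measure, to a quadratic remainder for the integral. The difference quotient
  therefore converges with an error linear in \<open>\<bar>u - t\<bar>\<close>.\<close>

lemma derivative_under_integral:
  fixes F F1 :: "'a \<Rightarrow> real \<Rightarrow> real"
  assumes fm: "finite_measure \<nu>" and r: "0 < r"
    and int: "\<And>u. u \<in> ball t r \<Longrightarrow> integrable \<nu> (\<lambda>l. F l u)" "integrable \<nu> (\<lambda>l. F1 l t)"
    and bound: "\<And>l u. l \<in> space \<nu> \<Longrightarrow> u \<in> ball t r \<Longrightarrow> \<bar>F l u - F l t - (u - t) * F1 l t\<bar> \<le> C * (u - t)\<^sup>2"
  shows "((\<lambda>u. \<integral>l. F l u \<partial>\<nu>) has_real_derivative (\<integral>l. F1 l t \<partial>\<nu>)) (at t)"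
proof -
  interpret finite_measure \<nu> by (rule fm)
  let ?G = "\<lambda>u. \<integral>l. F l u \<partial>\<nu>" and ?G' = "\<integral>l. F1 l t \<partial>\<nu>"
  define K where "K = C * measure \<nu> (space \<nu>)"
  have rem: "\<bar>?G u - ?G t - (u - t) * ?G'\<bar> \<le> K * (u - t)\<^sup>2" if u: "u \<in> ball t r" for u
  proof -
    have tb: "t \<in> ball t r" using r by simp
    have i: "integrable \<nu> (\<lambda>l. F l u - F l t - (u - t) * F1 l t)"
      using int u tb by (intro Bochner_Integration.integrable_diff integrable_mult_right)
    have "?G u - ?G t - (u - t) * ?G' = (\<integral>l. F l u - F l t - (u - t) * F1 l t \<partial>\<nu>)"
      using int u tb by (simp add: Bochner_Integration.integral_diff)
    also have "\<bar>\<dots>\<bar> \<le> (\<integral>l. \<bar>F l u - F l t - (u - t) * F1 l t\<bar> \<partial>\<nu>)" by (rule integral_abs_bound)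
    also have "\<dots> \<le> (\<integral>l. C * (u - t)\<^sup>2 \<partial>\<nu>)"
      by (rule integral_mono) (use i bound[OF _ u] in auto)
    also have "\<dots> = K * (u - t)\<^sup>2" by (simp add: K_def mult_ac)
    finally show ?thesis .
  qed
  have "((\<lambda>u. (?G u - ?G t) / (u - t) - ?G') \<longlongrightarrow> 0) (at t)"
  proof (rule Lim_null_comparison)
    have "eventually (\<lambda>u. u \<in> ball t r) (at t)" using r by (intro eventually_at_in_open') auto
    moreover have "eventually (\<lambda>u. u \<noteq> t) (at t)" by (simp add: eventually_at_filter)
    ultimately show "eventually (\<lambda>u. norm ((?G u - ?G t) / (u - t) - ?G') \<le> K * \<bar>u - t\<bar>) (at t)"
    proof eventually_elim
      case (elim u)
      have "(?G u - ?G t) / (u - t) - ?G' = (?G u - ?G t - (u - t) * ?G') / (u - t)"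
        using elim(2) by (simp add: field_simps)
      also have "norm \<dots> \<le> K * (u - t)\<^sup>2 / \<bar>u - t\<bar>"
        unfolding real_norm_def abs_divide by (intro divide_right_mono rem[OF elim(1)]) simp
      also have "\<dots> = K * \<bar>u - t\<bar>" using elim(2) by (simp add: power2_eq_square field_simps abs_mult_self_eq)
      finally show ?case .
    qed
    show "((\<lambda>u. K * \<bar>u - t\<bar>) \<longlongrightarrow> 0) (at t)"
      by (rule tendsto_eq_intros refl | simp)+
  qed
  thus ?thesis unfolding has_field_derivative_iff by (simp add: LIM_zero_iff)
qed

definition atom_den :: "real \<Rightarrow> real \<Rightarrow> real" where
  "atom_den l t = (1 - l) * t + l"

text \<open>The denominator is a convex combination of \<open>t\<close> and \<open>1\<close>, so a
  common lower bound of both works for all \<open>l\<close> at once.\<close>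

lemma atom_den_bounds:
  assumes "l \<in> {0..1}" "0 < m" "m \<le> t" "m \<le> 1"
  shows "m \<le> atom_den l t"
proof -
  have "(1 - l) * m \<le> (1 - l) * t" "l * m \<le> l * 1" using assms by (intro mult_left_mono; simp)+
  thus ?thesis by (simp add: atom_den_def algebra_simps)
qed

lemma atom_den_pos:
  assumes "l \<in> {0..1}" "0 < t"
  shows "0 < atom_den l t"
proof -
  have "min t 1 \<le> atom_den l t" by (rule atom_den_bounds) (use assms in auto)
  thus ?thesis using assms(2) by linarith
qed

definition h_atom1 :: "real \<Rightarrow> real \<Rightarrow> real" where
  "h_atom1 l t = (2 * (t - 1) + (1 - l) * (t - 1)\<^sup>2) / (atom_den l t)\<^sup>2"

definition h_atom2 :: "real \<Rightarrow> real \<Rightarrow> real" where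
  "h_atom2 l t = 2 / (atom_den l t) ^ 3"

text \<open>With \<open>a = 1 - l\<close> and \<open>s = t - 1\<close> the denominator is
  \<open>D = 1 + a * s\<close>. The numerator of the second derivative is
  \<open>2 * D * (D\<^sup>2 - 2 * a * s - a\<^sup>2 * s\<^sup>2)\<close>, which collapses to
  \<open>2 * D\<close>. The third derivative serves as remainder bound when \<open>h_atom1\<close>
  is differentiated under the integral.\<close>

lemma h_atom_derivs:
  assumes l: "l \<in> {0..1}" and t: "0 < t"
  shows "(h_atom l has_real_derivative h_atom1 l t) (at t)"
    "(h_atom1 l has_real_derivative h_atom2 l t) (at t)"
    "(h_atom2 l has_real_derivative - 6 * (1 - l) / (atom_den l t) ^ 4) (at t)"
proof -
  have pos: "0 < atom_den l t" by (rule atom_den_pos[OF l t])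
  define a where "a = 1 - l"
  define D where "D = atom_den l t"
  have D: "D = 1 + a * (t - 1)" by (simp add: D_def a_def atom_den_def algebra_simps)
  have D0: "D \<noteq> 0" using pos by (simp add: D_def)
  have dd: "((\<lambda>t. atom_den l t) has_real_derivative a) (at t)"
    unfolding atom_den_def a_def by (auto intro!: derivative_eq_intros)
  have s2: "((\<lambda>t. (t - 1)\<^sup>2) has_real_derivative 2 * (t - 1)) (at t)"
    by (auto intro!: derivative_eq_intros)
  have d2: "((\<lambda>t. (atom_den l t)\<^sup>2) has_real_derivative 2 * D * a) (at t)"
    by (rule DERIV_cong[OF DERIV_power[OF dd, of 2]]) (simp add: D_def)
  have d3: "((\<lambda>t. (atom_den l t) ^ 3) has_real_derivative 3 * D\<^sup>2 * a) (at t)"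
    by (rule DERIV_cong[OF DERIV_power[OF dd, of 3]]) (simp add: D_def)
  have "((\<lambda>t. (t - 1)\<^sup>2 / atom_den l t) has_real_derivative
     (2 * (t - 1) * D - (t - 1)\<^sup>2 * a) / (D * D)) (at t)"
    using DERIV_divide[OF s2 dd] pos by (simp add: D_def)
  moreover have "(2 * (t - 1) * D - (t - 1)\<^sup>2 * a) / (D * D) = h_atom1 l t"
    unfolding h_atom1_def D_def[symmetric] a_def[symmetric] power2_eq_square
    by (rule arg_cong2[where f = "(/)"]) (simp_all add: D algebra_simps)
  moreover have "h_atom l = (\<lambda>t. (t - 1)\<^sup>2 / atom_den l t)" by (simp add: fun_eq_iff h_atom_def atom_den_def)
  ultimately show "(h_atom l has_real_derivative h_atom1 l t) (at t)" by simp
  have n: "((\<lambda>t. 2 * (t - 1) + a * (t - 1)\<^sup>2) has_real_derivative 2 + 2 * a * (t - 1)) (at t)"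
    by (auto intro!: derivative_eq_intros)
  have "((\<lambda>t. (2 * (t - 1) + a * (t - 1)\<^sup>2) / (atom_den l t)\<^sup>2) has_real_derivative
     ((2 + 2 * a * (t - 1)) * D\<^sup>2 - (2 * (t - 1) + a * (t - 1)\<^sup>2) * (2 * D * a)) / (D\<^sup>2 * D\<^sup>2)) (at t)"
    using DERIV_divide[OF n d2] pos by (simp add: D_def)
  moreover have "((2 + 2 * a * (t - 1)) * D\<^sup>2 - (2 * (t - 1) + a * (t - 1)\<^sup>2) * (2 * D * a)) / (D\<^sup>2 * D\<^sup>2) = h_atom2 l t"
  proof -
    have "(2 + 2 * a * (t - 1)) * D\<^sup>2 - (2 * (t - 1) + a * (t - 1)\<^sup>2) * (2 * D * a) = 2 * D"
    proof -
      define s where "s = t - 1"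
      have Ds: "D = 1 + a * s" by (simp add: D s_def)
      show ?thesis unfolding s_def[symmetric] Ds by (simp add: power2_eq_square algebra_simps)
    qed
    thus ?thesis unfolding h_atom2_def D_def[symmetric] using D0
      by (simp add: power2_eq_square power3_eq_cube)
  qed
  moreover have "h_atom1 l = (\<lambda>t. (2 * (t - 1) + a * (t - 1)\<^sup>2) / (atom_den l t)\<^sup>2)"
    by (simp add: fun_eq_iff h_atom1_def a_def)
  ultimately show "(h_atom1 l has_real_derivative h_atom2 l t) (at t)" by simp
  have "((\<lambda>t. 2 / (atom_den l t) ^ 3) has_real_derivative (0 * D ^ 3 - 2 * (3 * D\<^sup>2 * a)) / (D ^ 3 * D ^ 3)) (at t)"
    using DERIV_divide[OF DERIV_const d3, of 2] pos by (simp add: D_def)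
  moreover have "(0 * D ^ 3 - 2 * (3 * D\<^sup>2 * a)) / (D ^ 3 * D ^ 3) = - 6 * a / D ^ 4"
    using D0 by (simp add: field_simps eval_nat_numeral)
  moreover have "h_atom2 l = (\<lambda>t. 2 / (atom_den l t) ^ 3)" by (simp add: fun_eq_iff h_atom2_def)
  ultimately show "(h_atom2 l has_real_derivative - 6 * (1 - l) / (atom_den l t) ^ 4) (at t)"
    by (simp add: a_def D_def)
qed

lemma h_atom_measurable:
  "(\<lambda>l. h_atom l t) \<in> borel_measurable borel"
  "(\<lambda>l. h_atom1 l t) \<in> borel_measurable borel"
  "(\<lambda>l. h_atom2 l t) \<in> borel_measurable borel"
  unfolding h_atom_def h_atom1_def h_atom2_def atom_den_def by measurable

lemma atoms_integrable:
  assumes fm: "finite_measure \<nu>" and sets: "sets \<nu> = sets (restrict_space borel {0..1})"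
    and "\<phi> \<in> borel_measurable borel" "\<And>l. l \<in> {0..1} \<Longrightarrow> \<bar>\<phi> l\<bar> \<le> (B::real)"
  shows "integrable \<nu> \<phi>"
proof -
  have sp: "space \<nu> = {0..1}" using sets_eq_imp_space_eq[OF sets] by (simp add: space_restrict_space)
  have "\<phi> \<in> borel_measurable \<nu>"
    unfolding measurable_cong_sets[OF sets refl] by (rule measurable_restrict_space1[OF assms(3)])
  thus ?thesis using assms(4)
    by (intro finite_measure.integrable_const_bound[OF fm, where B = B] AE_I2) (auto simp: sp)
qed

text \<open>The atoms and their derivatives are bounded uniformly in \<open>l\<close> as long as the
  argument stays away from 0, so finiteness of the measure gives both integrability and the uniform
  Taylor remainders.\<close>

theorem atomic_representation_derivs:
  assumes fm: "finite_measure \<nu>" and sets: "sets \<nu> = sets (restrict_space borel {0..1})" and t: "0 < t"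
  shows "integrable \<nu> (\<lambda>l. h_atom2 l t)"
    "((\<lambda>u. \<integral>l. h_atom l u \<partial>\<nu>) has_real_derivative (\<integral>l. h_atom1 l t \<partial>\<nu>)) (at t)"
    "((\<lambda>u. \<integral>l. h_atom1 l u \<partial>\<nu>) has_real_derivative (\<integral>l. h_atom2 l t \<partial>\<nu>)) (at t)"
proof -
  have sp: "space \<nu> = {0..1}" using sets_eq_imp_space_eq[OF sets] by (simp add: space_restrict_space)
  have den: "min u 1 \<le> atom_den l u" if "0 < u" "l \<in> {0..1}" for u l
    by (rule atom_den_bounds) (use that in auto)
  have i0: "integrable \<nu> (\<lambda>l. h_atom l u)" if u: "0 < u" for u
  proof (rule atoms_integrable[OF fm sets h_atom_measurable(1)])
    fix l :: real assume l: "l \<in> {0..1}"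
    have "(u - 1)\<^sup>2 / atom_den l u \<le> (u - 1)\<^sup>2 / min u 1"
      using den[OF u l] u by (intro divide_left_mono) auto
    thus "\<bar>h_atom l u\<bar> \<le> (u - 1)\<^sup>2 / min u 1"
      using atom_den_pos[OF l u] by (simp add: h_atom_def atom_den_def)
  qed
  have i1: "integrable \<nu> (\<lambda>l. h_atom1 l u)" if u: "0 < u" for u
  proof (rule atoms_integrable[OF fm sets h_atom_measurable(2)])
    fix l :: real assume l: "l \<in> {0..1}"
    have "\<bar>2 * (u - 1) + (1 - l) * (u - 1)\<^sup>2\<bar> \<le> \<bar>2 * (u - 1)\<bar> + \<bar>(1 - l) * (u - 1)\<^sup>2\<bar>" by (rule abs_triangle_ineq)
    also have "\<bar>(1 - l) * (u - 1)\<^sup>2\<bar> \<le> 1 * (u - 1)\<^sup>2" using l by (simp add: abs_mult mult_left_le_one_le)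
    finally have n: "\<bar>2 * (u - 1) + (1 - l) * (u - 1)\<^sup>2\<bar> \<le> \<bar>2 * (u - 1)\<bar> + (u - 1)\<^sup>2" by simp
    have "(min u 1)\<^sup>2 \<le> (atom_den l u)\<^sup>2" using den[OF u l] u by (intro power_mono) auto
    hence "\<bar>2 * (u - 1) + (1 - l) * (u - 1)\<^sup>2\<bar> / (atom_den l u)\<^sup>2 \<le> (\<bar>2 * (u - 1)\<bar> + (u - 1)\<^sup>2) / (min u 1)\<^sup>2"
      using n u by (intro frac_le) auto
    thus "\<bar>h_atom1 l u\<bar> \<le> (\<bar>2 * (u - 1)\<bar> + (u - 1)\<^sup>2) / (min u 1)\<^sup>2"
      by (simp add: h_atom1_def abs_divide)
  qed
  have b2: "\<bar>h_atom2 l u\<bar> \<le> 2 / m ^ 3" if "l \<in> {0..1}" "0 < m" "m \<le> u" "m \<le> 1" for l u m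
  proof -
    have "m \<le> atom_den l u" by (rule atom_den_bounds[OF that])
    moreover from this have "m ^ 3 \<le> (atom_den l u) ^ 3" using that by (intro power_mono) auto
    ultimately show ?thesis using that
      by (auto simp: h_atom2_def abs_divide power_abs intro!: divide_left_mono)
  qed
  show i2: "integrable \<nu> (\<lambda>l. h_atom2 l t)"
    by (rule atoms_integrable[OF fm sets h_atom_measurable(3), where B = "2 / (min t 1) ^ 3"], rule b2) (use t in auto)
  \<comment> \<open>On the ball of radius \<open>t / 2\<close> arguments exceed
    \<open>t / 2\<close>, so every denominator is at least \<open>m\<close>; this yields the Taylor
    constants \<open>2 / m ^ 3\<close> and \<open>6 / m ^ 4\<close>.\<close>
  define r where "r = t / 2"
  define m where "m = min (t / 2) 1"
  have m: "0 < m" "m \<le> 1" using t by (auto simp: m_def)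
  have u: "0 < u" "m \<le> u" if "u \<in> ball t r" for u
  proof -
    have "t / 2 < u" using that t unfolding r_def mem_ball dist_real_def by linarith
    thus "0 < u" "m \<le> u" using t by (auto simp: m_def)
  qed
  have b3: "\<bar>- 6 * (1 - l) / (atom_den l u) ^ 4\<bar> \<le> 6 / m ^ 4" if l: "l \<in> {0..1}" and "m \<le> u" for l u
  proof -
    have "m \<le> atom_den l u" by (rule atom_den_bounds[OF l m(1) that(2) m(2)])
    hence "m ^ 4 \<le> (atom_den l u) ^ 4" using m by (intro power_mono) auto
    moreover have "\<bar>- 6 * (1 - l)\<bar> \<le> 6" using l by (simp add: abs_mult)
    ultimately have "\<bar>- 6 * (1 - l)\<bar> / (atom_den l u) ^ 4 \<le> 6 / m ^ 4" using m by (intro frac_le) auto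
    thus ?thesis by (simp add: abs_divide power_abs)
  qed
  have r: "0 < r" using t by (simp add: r_def)
  show "((\<lambda>u. \<integral>l. h_atom l u \<partial>\<nu>) has_real_derivative (\<integral>l. h_atom1 l t \<partial>\<nu>)) (at t)"
  proof (rule derivative_under_integral[OF fm r])
    fix l v assume "l \<in> space \<nu>" and v: "v \<in> ball t r"
    hence l: "l \<in> {0..1}" by (simp add: sp)
    show "\<bar>h_atom l v - h_atom l t - (v - t) * h_atom1 l t\<bar> \<le> 2 / m ^ 3 * (v - t)\<^sup>2"
      by (rule taylor_remainder_bound[OF _ _ _ v, where ?F2.0 = "h_atom2 l"])
         (use h_atom_derivs[OF l] b2[OF l m(1)] m u in auto)
  qed (use i0 i1 t u in auto)
  show "((\<lambda>u. \<integral>l. h_atom1 l u \<partial>\<nu>) has_real_derivative (\<integral>l. h_atom2 l t \<partial>\<nu>)) (at t)"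
  proof (rule derivative_under_integral[OF fm r])
    fix l v assume "l \<in> space \<nu>" and v: "v \<in> ball t r"
    hence l: "l \<in> {0..1}" by (simp add: sp)
    show "\<bar>h_atom1 l v - h_atom1 l t - (v - t) * h_atom2 l t\<bar> \<le> 6 / m ^ 4 * (v - t)\<^sup>2"
      by (rule taylor_remainder_bound[OF _ _ _ v, where ?F2.0 = "\<lambda>u. - 6 * (1 - l) / (atom_den l u) ^ 4"])
         (use h_atom_derivs[OF l] b3[OF l] u in auto)
  qed (use i1 i2 u in auto)
qed

subsection \<open>Two-level rotations\<close>

lemma braket_combination:
  assumes A: "A \<in> carrier_mat n n" and u: "u \<in> carrier_vec n" and v: "v \<in> carrier_vec n"
  shows "braket (x \<cdot>\<^sub>v u + y \<cdot>\<^sub>v v) A (x \<cdot>\<^sub>v u + y \<cdot>\<^sub>v v) =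
    cnj x * x * braket u A u + cnj x * y * braket u A v + cnj y * x * braket v A u + cnj y * y * braket v A v"
proof -
  have c: "x \<cdot>\<^sub>v u + y \<cdot>\<^sub>v v \<in> carrier_vec n" using u v by simp
  show ?thesis
    unfolding braket_index[OF A c c] braket_index[OF A u u] braket_index[OF A u v] braket_index[OF A v u]
      braket_index[OF A v v] sum_distrib_left sum.distrib[symmetric]
    by (intro sum.cong refl) (use u v in \<open>simp add: algebra_simps\<close>)
qed

lemma braket_minus_smult:
  assumes "A \<in> carrier_mat n n" "B \<in> carrier_mat n n" "u \<in> carrier_vec n" "v \<in> carrier_vec n"
  shows "braket u (A - z \<cdot>\<^sub>m B) v = braket u A v - z * braket u B v"
proof -
  have c: "A - z \<cdot>\<^sub>m B \<in> carrier_mat n n"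
    using assms(2) by (intro minus_carrier_mat smult_carrier_mat)
  show ?thesis
    unfolding braket_index[OF c assms(3,4)] braket_index[OF assms(1,3,4)] braket_index[OF assms(2-4)]
      sum_distrib_left sum_subtractf[symmetric]
    by (intro sum.cong refl) (use assms in \<open>simp add: algebra_simps\<close>)
qed

context
  fixes b :: "nat \<Rightarrow> complex vec" and d j k :: nat and \<phi> :: real
  assumes b: "orthonormal_basis d b" and jk: "j < d" "k < d" "j \<noteq> k"
begin

text \<open>Closed form of the quadratic form of a Hermitian \<open>A\<close> on the rotated
  vectors: the two cross terms are conjugate and merge into the real part \<open>r\<close>. The
  weights of \<open>j\<close> and \<open>k\<close> add up to a constant.\<close>

definition rot_weight :: "complex mat \<Rightarrow> nat \<Rightarrow> real \<Rightarrow> real" where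
  "rot_weight A y \<theta> = (let \<alpha> = Re (braket (b j) A (b j)); \<beta> = Re (braket (b k) A (b k));
       r = Re (cis \<phi> * braket (b j) A (b k)) in
     if y = j then (cos \<theta>)\<^sup>2 * \<alpha> + (sin \<theta>)\<^sup>2 * \<beta> + 2 * (cos \<theta> * sin \<theta>) * r
     else if y = k then (sin \<theta>)\<^sup>2 * \<alpha> + (cos \<theta>)\<^sup>2 * \<beta> - 2 * (cos \<theta> * sin \<theta>) * r
     else Re (braket (b y) A (b y)))"

definition rot_weight1 :: "complex mat \<Rightarrow> nat \<Rightarrow> real \<Rightarrow> real" where
  "rot_weight1 A y \<theta> = (let \<alpha> = Re (braket (b j) A (b j)); \<beta> = Re (braket (b k) A (b k));
       r = Re (cis \<phi> * braket (b j) A (b k));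
       e = 2 * (cos \<theta> * sin \<theta>) * (\<beta> - \<alpha>) + 2 * ((cos \<theta>)\<^sup>2 - (sin \<theta>)\<^sup>2) * r in
     if y = j then e else if y = k then - e else 0)"

text \<open>The second derivative at angle 0 only, where the contribution of \<open>r\<close>
  vanishes.\<close>

definition rot_weight2 :: "complex mat \<Rightarrow> nat \<Rightarrow> real" where
  "rot_weight2 A y = (let e = 2 * (Re (braket (b k) A (b k)) - Re (braket (b j) A (b j))) in
     if y = j then e else if y = k then - e else 0)"

lemma rot_weight_derivs:
  "(rot_weight A y has_real_derivative rot_weight1 A y \<theta>) (at \<theta>)"
  "(rot_weight1 A y has_real_derivative rot_weight2 A y) (at 0)"
  unfolding rot_weight_def[abs_def] rot_weight1_def[abs_def] rot_weight2_def Let_def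
  using jk(3)
  by (cases "y = j"; cases "y = k";
      force intro!: derivative_eq_intros simp: algebra_simps power2_eq_square)+

lemma rotate_basis_weight:
  assumes A: "hermitian d A" and y: "y < d"
  shows "Re (braket (rotate_basis b j k \<phi> \<theta> y) A (rotate_basis b j k \<phi> \<theta> y)) = rot_weight A y \<theta>"
proof -
  have Ac: "A \<in> carrier_mat d d" using A by (simp add: hermitian_def)
  have bc: "b y \<in> carrier_vec d" if "y < d" for y using b that by (simp add: orthonormal_basis_def)
  have sw: "braket (b k) A (b j) = cnj (braket (b j) A (b k))"
    by (rule braket_swap[OF A bc[OF jk(2)] bc[OF jk(1)]])
  have real: "Im (braket (b z) A (b z)) = 0" if "z < d" for z
    using arg_cong[OF braket_real[OF A bc[OF that]], of Im] by simp
  note comb = braket_combination[OF Ac bc[OF jk(1)] bc[OF jk(2)]]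
  have cs: "cis (- \<phi>) = cnj (cis \<phi>)" by (simp add: cis_cnj)
  have unit: "Re (cis \<phi>) * Re (cis \<phi>) + Im (cis \<phi>) * Im (cis \<phi>) = 1"
    using sin_cos_squared_add3[of \<phi>] by simp
  have cc: "cnj (cis \<phi>) * cis \<phi> = 1" by (simp add: cis_cnj cis_mult)
  show ?thesis
  proof (cases "y = j")
    case True
    have "braket (rotate_basis b j k \<phi> \<theta> y) A (rotate_basis b j k \<phi> \<theta> y) =
      complex_of_real ((cos \<theta>)\<^sup>2) * braket (b j) A (b j) + complex_of_real (cos \<theta> * sin \<theta>) * (cis \<phi> * braket (b j) A (b k))
      + complex_of_real (cos \<theta> * sin \<theta>) * cnj (cis \<phi> * braket (b j) A (b k))
      + (cnj (cis \<phi>) * cis \<phi>) * complex_of_real ((sin \<theta>)\<^sup>2) * braket (b k) A (b k)"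
      using True jk(3) by (simp add: rotate_basis_def comb sw power2_eq_square mult_ac)
    thus ?thesis unfolding cc using True by (simp add: rot_weight_def)
  next
    case nj: False
    show ?thesis
    proof (cases "y = k")
      case True
      have "braket (rotate_basis b j k \<phi> \<theta> y) A (rotate_basis b j k \<phi> \<theta> y) =
        (cnj (cis \<phi>) * cis \<phi>) * complex_of_real ((sin \<theta>)\<^sup>2) * braket (b j) A (b j)
        - complex_of_real (cos \<theta> * sin \<theta>) * (cis \<phi> * braket (b j) A (b k))
        - complex_of_real (cos \<theta> * sin \<theta>) * cnj (cis \<phi> * braket (b j) A (b k))
        + complex_of_real ((cos \<theta>)\<^sup>2) * braket (b k) A (b k)"
        using True by (simp add: rotate_basis_def comb sw cs power2_eq_square mult_ac)
      thus ?thesis unfolding cc using True nj by (simp add: rot_weight_def)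
    next
      case False
      thus ?thesis using nj by (simp add: rotate_basis_def rot_weight_def)
    qed
  qed
qed

text \<open>The norm is the quadratic form of the identity matrix, so
  \<open>rotate_basis_weight\<close> with \<open>A\<close> the identity computes it.\<close>

lemma rotate_basis_unit:
  assumes y: "y < d"
  shows "rotate_basis b j k \<phi> \<theta> y \<in> carrier_vec d"
    "rotate_basis b j k \<phi> \<theta> y \<bullet>c rotate_basis b j k \<phi> \<theta> y = 1"
proof -
  let ?v = "rotate_basis b j k \<phi> \<theta> y"
  have bc: "b y \<in> carrier_vec d" if "y < d" for y using b that by (simp add: orthonormal_basis_def)
  have bb: "b y \<bullet>c b z = (if y = z then 1 else 0)" if "y < d" "z < d" for y z
    using b that by (simp add: orthonormal_basis_def)
  show v: "?v \<in> carrier_vec d" using y jk bc by (simp add: rotate_basis_def)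
  have one: "braket u (1\<^sub>m d) w = w \<bullet>c u" if "w \<in> carrier_vec d" for u w
    using that by (simp add: braket_def)
  have h: "hermitian d (1\<^sub>m d)" by (rule hermitianI) auto
  have "Re (braket ?v (1\<^sub>m d) ?v) = 1"
    unfolding rotate_basis_weight[OF h y]
    using y jk by (simp add: rot_weight_def one bc bb)
  moreover have "braket ?v (1\<^sub>m d) ?v = complex_of_real (Re (braket ?v (1\<^sub>m d) ?v))"
    by (rule braket_real[OF h v])
  ultimately show "?v \<bullet>c ?v = 1" by (simp add: one[OF v])
qed

text \<open>Stated for any twice differentiable generator \<open>g\<close> on the positive axis, so
  that it applies both to \<open>f\<close> and to each single atom; the generator then enters only
  through the factor \<open>g2 s\<close>.\<close>

theorem rotated_div_second_deriv:
  assumes fin: "\<And>s. 0 < s \<Longrightarrow> f s = ereal (g s)"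
    and g1: "\<And>s. 0 < s \<Longrightarrow> (g has_real_derivative g1 s) (at s)"
    and g2: "\<And>s. 0 < s \<Longrightarrow> (g1 has_real_derivative g2 s) (at s)"
    and \<rho>: "posdef d \<rho>" and \<sigma>: "posdef d \<sigma>"
    and t: "likelihood_ratio \<rho> \<sigma> (pvm_of d b) j = s" "likelihood_ratio \<rho> \<sigma> (pvm_of d b) k = s"
  shows "has_second_deriv (rotated_div f \<rho> \<sigma> d b j k \<phi>)
     (g2 s * (4 * (Re (cis \<phi> * braket (b j) (\<rho> - complex_of_real s \<cdot>\<^sub>m \<sigma>) (b k)))\<^sup>2 *
       (1 / outcome_weight \<sigma> (pvm_of d b j) + 1 / outcome_weight \<sigma> (pvm_of d b k)))) 0"
proof -
  have h: "hermitian d \<rho>" "hermitian d \<sigma>" using \<rho> \<sigma> by (auto simp: posdef_def)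
  hence c: "\<rho> \<in> carrier_mat d d" "\<sigma> \<in> carrier_mat d d" by (auto simp: hermitian_def)
  have bc: "b y \<in> carrier_vec d" if "y < d" for y using b that by (simp add: orthonormal_basis_def)
  have w: "outcome_weight A (pvm_of d (rotate_basis b j k \<phi> \<theta>) y) = rot_weight A y \<theta>"
    if "hermitian d A" "y < d" for A y \<theta>
    using pvm_weight[of A d "rotate_basis b j k \<phi> \<theta>" y] rotate_basis_weight[OF that] rotate_basis_unit(1)[OF that(2)] that(1)
    by (simp add: hermitian_def)
  have pos: "0 < rot_weight A y \<theta>" if A: "posdef d A" and y: "y < d" for A y \<theta>
  proof -
    have hA: "hermitian d A" using A by (simp add: posdef_def)
    show ?thesis unfolding rotate_basis_weight[OF hA y, symmetric]
      by (rule posdef_braket_pos[OF A rotate_basis_unit[OF y]])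
  qed
  have wb: "outcome_weight A (pvm_of d b y) = Re (braket (b y) A (b y))" if "A \<in> carrier_mat d d" "y < d" for A y
    by (rule pvm_weight[OF that(1)]) (rule bc[OF that(2)])
  have zero: "rot_weight A y 0 = Re (braket (b y) A (b y))" for A y by (simp add: rot_weight_def Let_def)
  define p where "p = rot_weight \<rho>"
  define q where "q = rot_weight \<sigma>"
  have pq: "0 < p y \<theta>" "0 < q y \<theta>" if "y < d" for y \<theta> using pos[OF \<rho> that] pos[OF \<sigma> that] by (auto simp: p_def q_def)
  have "rotated_div f \<rho> \<sigma> d b j k \<phi> \<theta> = (\<Sum>y<d. q y \<theta> * g (p y \<theta> / q y \<theta>))" for \<theta>
    unfolding rotated_div_def
    by (subst measured_div_finite[where g = g]) (auto simp: w h pq fin p_def[symmetric] q_def[symmetric])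
  hence rd: "rotated_div f \<rho> \<sigma> d b j k \<phi> = (\<lambda>\<theta>. \<Sum>y<d. q y \<theta> * g (p y \<theta> / q y \<theta>))" by auto
  define T where "T = (\<lambda>y. p y 0 / q y 0)"
  define D where "D = (\<lambda>y. rot_weight2 \<sigma> y * (g (T y) - T y * g1 (T y)) + g1 (T y) * rot_weight2 \<rho> y
      + g2 (T y) * (rot_weight1 \<rho> y 0 - T y * rot_weight1 \<sigma> y 0)\<^sup>2 / q y 0)"
  define a where "a = Re (cis \<phi> * braket (b j) (\<rho> - complex_of_real s \<cdot>\<^sub>m \<sigma>) (b k))"
  have "has_second_deriv (\<lambda>\<theta>. \<Sum>y<d. q y \<theta> * g (p y \<theta> / q y \<theta>)) (\<Sum>y<d. D y) 0"
    by (rule has_second_deriv_sum, unfold D_def T_def, rule second_derivative_perspective)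
       (use pq g1 g2 rot_weight_derivs in \<open>auto simp: p_def q_def\<close>)
  moreover have "(\<Sum>y<d. D y) = g2 s * (2 * a)\<^sup>2 / q j 0 + g2 s * (- 2 * a)\<^sup>2 / q k 0"
  proof -
    have T: "T j = s" "T k = s"
      using t jk by (simp_all add: T_def p_def q_def zero likelihood_ratio_def wb c)
    \<comment> \<open>The first derivative of a weight at 0 is linear in the matrix, so
      \<open>p' - s * q'\<close> is that of \<open>\<rho> - s * \<sigma>\<close>: twice the real
      part \<open>a\<close> for outcome \<open>j\<close>, and its negative for
      \<open>k\<close>.\<close>
    have r1: "rot_weight1 \<rho> j 0 - s * rot_weight1 \<sigma> j 0 = 2 * a" "rot_weight1 \<rho> k 0 - s * rot_weight1 \<sigma> k 0 = - 2 * a"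
      using jk(3) unfolding a_def braket_minus_smult[OF c bc[OF jk(1)] bc[OF jk(2)]]
      by (simp_all add: rot_weight1_def Let_def algebra_simps)
    have r2: "rot_weight2 A k = - rot_weight2 A j" for A using jk(3) by (simp add: rot_weight2_def Let_def)
    have "(\<Sum>y<d. D y) = (\<Sum>y\<in>{j, k}. D y)"
      by (rule sum.mono_neutral_right) (use jk in \<open>auto simp: D_def rot_weight1_def rot_weight2_def Let_def\<close>)
    also have "\<dots> = D j + D k" using jk(3) by simp
    finally show ?thesis unfolding D_def T r1 r2 by (simp add: algebra_simps)
  qed
  ultimately have "has_second_deriv (rotated_div f \<rho> \<sigma> d b j k \<phi>)
     (g2 s * (2 * a)\<^sup>2 / q j 0 + g2 s * (- 2 * a)\<^sup>2 / q k 0) 0"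
    by (simp only: rd)
  thus ?thesis
    unfolding a_def[symmetric] using jk by (simp add: wb c q_def zero distrib_left mult_ac)
qed

end

section \<open>Existence of a degenerate pair and superposition of the atomic second
  derivatives\<close>

theorem theorem5p3:
  fixes f :: "real \<Rightarrow> ereal" and \<nu> :: "real measure"
    and d :: nat and \<rho> \<sigma> :: "complex mat" and b :: "nat \<Rightarrow> complex vec"
  defines "P \<equiv> pvm_of d b"
  defines "q \<equiv> (\<lambda>j. outcome_weight \<sigma> (P j))"
  defines "t \<equiv> likelihood_ratio \<rho> \<sigma> P"
  defines "a \<equiv> (\<lambda>s j k. braket (b j) (\<rho> - complex_of_real s \<cdot>\<^sub>m \<sigma>) (b k))"
  assumes "op_fenchel_liftable f"
    and "atomic_measure f \<nu>"
    and "faithful_density d \<rho>"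
    and "faithful_density d \<sigma>"
    and "orthonormal_basis d b"
    and "critical_pvm f \<rho> \<sigma> d P"
    and "\<not> globally_optimal_pvm f \<rho> \<sigma> d P"
  shows
    "(\<exists>j<d. \<exists>k<d. j \<noteq> k \<and> t j = t k \<and> a (t j) j k \<noteq> 0) \<and>
     (\<forall>j<d. \<forall>k<d. \<forall>t\<^sub>\<alpha> \<phi>.
        j \<noteq> k \<and> t j = t\<^sub>\<alpha> \<and> t k = t\<^sub>\<alpha> \<and> a t\<^sub>\<alpha> j k \<noteq> 0 \<and>
        Re (cis \<phi> * a t\<^sub>\<alpha> j k) = cmod (a t\<^sub>\<alpha> j k) \<longrightarrow>
        has_second_deriv (rotated_div f \<rho> \<sigma> d b j k \<phi>)
          (8 * (cmod (a t\<^sub>\<alpha> j k))\<^sup>2 * (1 / q j + 1 / q k) *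
             (\<integral>l. 1 / ((1 - l) * t\<^sub>\<alpha> + l) ^ 3 \<partial>\<nu>)) 0 \<and>
        (\<exists>D. (\<forall>l\<in>{0..1}.
                has_second_deriv (rotated_div (\<lambda>s. ereal (h_atom l s)) \<rho> \<sigma> d b j k \<phi>) (D l) 0) \<and>
             integrable \<nu> D \<and>
             has_second_deriv (rotated_div f \<rho> \<sigma> d b j k \<phi>) (\<integral>l. D l \<partial>\<nu>) 0))"
proof -
  note lift = assms(5) and b = assms(9)
  have \<rho>: "posdef d \<rho>" and \<sigma>: "posdef d \<sigma>" using assms(7,8) by (auto simp: faithful_density_def)
  hence c: "\<rho> \<in> carrier_mat d d" "\<sigma> \<in> carrier_mat d d" by (auto simp: posdef_def hermitian_def)
  have bc: "b y \<in> carrier_vec d" "b y \<bullet>c b y = 1" if "y < d" for y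
    using b that by (auto simp: orthonormal_basis_def)
  have a: "a s j k = braket (b j) \<rho> (b k) - complex_of_real s * braket (b j) \<sigma> (b k)" if "j < d" "k < d" for s j k
    unfolding a_def by (rule braket_minus_smult[OF c bc(1)[OF that(1)] bc(1)[OF that(2)]])
  show ?thesis
  proof (intro conjI allI impI)
    show "\<exists>j<d. \<exists>k<d. j \<noteq> k \<and> t j = t k \<and> a (t j) j k \<noteq> 0"
    proof (rule ccontr)
      assume none: "\<not> ?thesis"
      have "globally_optimal_pvm f \<rho> \<sigma> d (pvm_of d b)"
      proof (rule stationary_globally_optimal[OF lift \<rho> \<sigma> b])
        fix j k assume jk: "j < d" "k < d" "j \<noteq> k"
        show "complex_of_real (deriv (finite_part f) (likelihood_ratio \<rho> \<sigma> (pvm_of d b) j) -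
              deriv (finite_part f) (likelihood_ratio \<rho> \<sigma> (pvm_of d b) k)) * braket (b j) \<rho> (b k) =
            complex_of_real ((likelihood_ratio \<rho> \<sigma> (pvm_of d b) j * deriv (finite_part f) (likelihood_ratio \<rho> \<sigma> (pvm_of d b) j)
                - finite_part f (likelihood_ratio \<rho> \<sigma> (pvm_of d b) j))
              - (likelihood_ratio \<rho> \<sigma> (pvm_of d b) k * deriv (finite_part f) (likelihood_ratio \<rho> \<sigma> (pvm_of d b) k)
                - finite_part f (likelihood_ratio \<rho> \<sigma> (pvm_of d b) k))) * braket (b j) \<sigma> (b k)"
          by (rule critical_relation[OF liftable_finite[OF lift] liftable_deriv(1)[OF lift] \<rho> \<sigma> b _ jk])
             (use assms(10) in \<open>simp_all add: P_def\<close>)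
        assume "likelihood_ratio \<rho> \<sigma> (pvm_of d b) j = likelihood_ratio \<rho> \<sigma> (pvm_of d b) k"
        hence "a (t j) j k = 0" using none jk by (auto simp: t_def P_def)
        thus "braket (b j) \<rho> (b k) = complex_of_real (likelihood_ratio \<rho> \<sigma> (pvm_of d b) j) * braket (b j) \<sigma> (b k)"
          using a[OF jk(1,2)] by (simp add: t_def P_def)
      qed
      thus False using assms(11) by (simp add: P_def)
    qed
  next
    fix j k s \<phi>
    assume j: "j < d" and k: "k < d" and
      "j \<noteq> k \<and> t j = s \<and> t k = s \<and> a s j k \<noteq> 0 \<and> Re (cis \<phi> * a s j k) = cmod (a s j k)"
    hence jk: "j \<noteq> k" "t j = s" "t k = s" "Re (cis \<phi> * a s j k) = cmod (a s j k)" by auto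
    have w: "outcome_weight A (P j) = Re (braket (b j) A (b j))" if "A \<in> carrier_mat d d" for A
      unfolding P_def by (rule pvm_weight[OF that]) (rule bc(1)[OF j])
    have s: "0 < s"
      using jk(2) posdef_braket_pos[OF \<rho> bc[OF j]] posdef_braket_pos[OF \<sigma> bc[OF j]]
      by (auto simp: t_def likelihood_ratio_def w c)
    \<comment> \<open>Geometric factor common to all generators. The phase condition replaces the
      squared real part by the squared modulus of \<open>a s j k\<close>.\<close>
    define C where "C = 4 * (cmod (a s j k))\<^sup>2 * (1 / q j + 1 / q k)"
    have second: "has_second_deriv (rotated_div F \<rho> \<sigma> d b j k \<phi>) (g2 s * C) 0"
      if "\<And>s. 0 < s \<Longrightarrow> F s = ereal (g s)" "\<And>s. 0 < s \<Longrightarrow> (g has_real_derivative g1 s) (at s)"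
        "\<And>s. 0 < s \<Longrightarrow> (g1 has_real_derivative g2 s) (at s)" for F g g1 g2
      using rotated_div_second_deriv[OF b j k jk(1) that \<rho> \<sigma>, of s \<phi>] jk(2-4)
      by (simp add: C_def q_def a_def t_def P_def)
    have fm: "finite_measure \<nu>" and sets: "sets \<nu> = sets (restrict_space borel {0..1})"
      using assms(6) by (auto simp: atomic_measure_def)
    obtain e where e: "\<And>u. 0 < u \<Longrightarrow> f u = ereal ((\<integral>l. h_atom l u \<partial>\<nu>) + e * (u - 1))"
      using assms(6) by (auto simp: atomic_measure_def)
    note rep = atomic_representation_derivs[OF fm sets]
    \<comment> \<open>The term \<open>e * (u - 1)\<close> of the representation adds the constant
      \<open>e\<close> to the first derivative and drops out of the second.\<close>
    have F: "has_second_deriv (rotated_div f \<rho> \<sigma> d b j k \<phi>) ((\<integral>l. h_atom2 l s \<partial>\<nu>) * C) 0"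
    proof (rule second[where ?g1.0 = "\<lambda>u. (\<integral>l. h_atom1 l u \<partial>\<nu>) + e"
          and ?g2.0 = "\<lambda>u. \<integral>l. h_atom2 l u \<partial>\<nu>", OF e])
      fix u :: real assume u: "0 < u"
      show "((\<lambda>u. (\<integral>l. h_atom l u \<partial>\<nu>) + e * (u - 1)) has_real_derivative (\<integral>l. h_atom1 l u \<partial>\<nu>) + e) (at u)"
        by (rule DERIV_add[OF rep(2)[OF u]]) (auto intro!: derivative_eq_intros)
      show "((\<lambda>u. (\<integral>l. h_atom1 l u \<partial>\<nu>) + e) has_real_derivative (\<integral>l. h_atom2 l u \<partial>\<nu>)) (at u)"
        by (rule DERIV_cong[OF DERIV_add[OF rep(3)[OF u] DERIV_const]]) simp
    qed
    have "(\<integral>l. h_atom2 l s \<partial>\<nu>) = 2 * (\<integral>l. 1 / ((1 - l) * s + l) ^ 3 \<partial>\<nu>)"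
      unfolding integral_mult_right_zero[symmetric] by (simp add: h_atom2_def atom_den_def)
    hence "(\<integral>l. h_atom2 l s \<partial>\<nu>) * C = 8 * (cmod (a s j k))\<^sup>2 * (1 / q j + 1 / q k) * (\<integral>l. 1 / ((1 - l) * s + l) ^ 3 \<partial>\<nu>)"
      by (simp add: C_def)
    with F show "has_second_deriv (rotated_div f \<rho> \<sigma> d b j k \<phi>)
          (8 * (cmod (a s j k))\<^sup>2 * (1 / q j + 1 / q k) * (\<integral>l. 1 / ((1 - l) * s + l) ^ 3 \<partial>\<nu>)) 0"
      by simp
    show "\<exists>D. (\<forall>l\<in>{0..1}. has_second_deriv (rotated_div (\<lambda>s. ereal (h_atom l s)) \<rho> \<sigma> d b j k \<phi>) (D l) 0) \<and>
             integrable \<nu> D \<and> has_second_deriv (rotated_div f \<rho> \<sigma> d b j k \<phi>) (\<integral>l. D l \<partial>\<nu>) 0"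
    \<comment> \<open>Since \<open>C\<close> does not depend on the generator, the second derivative
      for the atom \<open>l\<close> is \<open>h_atom2 l s * C\<close>, and integrating it over
      \<open>\<nu>\<close> reproduces the value found for \<open>f\<close>.\<close>
    proof (intro exI[of _ "\<lambda>l. h_atom2 l s * C"] conjI ballI)
      fix l :: real assume l: "l \<in> {0..1}"
      show "has_second_deriv (rotated_div (\<lambda>s. ereal (h_atom l s)) \<rho> \<sigma> d b j k \<phi>) (h_atom2 l s * C) 0"
        by (rule second[OF refl h_atom_derivs(1,2)[OF l]])
    next
      show "integrable \<nu> (\<lambda>l. h_atom2 l s * C)" using rep(1)[OF s] by simp
      show "has_second_deriv (rotated_div f \<rho> \<sigma> d b j k \<phi>) (\<integral>l. h_atom2 l s * C \<partial>\<nu>) 0" using F by simp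
    qed
  qed
qed

end
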